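(* Let $B^4_{25}\subset (P_9-\mathcal{R}^2_6)^5$ be the quasi-projective variety of quintuples $(q_1,q_2,q_3,q_4,b)$ of distinct quadric surfaces of rank at least three such that $b$ is a common basket for $q_1,\ldots,q_4$. Then $B^4_{25}$ is irreducible, of dimension twenty five. The quadruple $(q_1,\ldots,q_4)$ of a generic point $(q_1,\ldots,q_4,b)\in B^4_{25}$ is characterized by the following property: the span $[q_1,\ldots,q_4]\subset P_9$ is a three-space ($\approx P_3$) containing a complete quadrilateral which consists of four pencils of cones; its six vertices $p_{kl}$ lie, respectively, on the six lines $[q_i,q_j]$ ($\{i,j,k,l\}=\{1,2,3,4\}$) and are precisely the rank two quadrics of the quadrilateral.
   Context: Quadric surfaces in $P_3=P_3(\mathbb{C})$ are identified with points of $P_9=P(\mathrm{Sym}_{\mathbb{C}}(4))$ (complex symmetric $4\times4$ matrices up to scale); the rank of a quadric is the rank of its matrix. Quadrics of rank at most three are called cones. $\mathcal{R}^2_6\subset P_9$ is the locus of quadrics of rank at most two. A pencil is a line in $P_9$; $[\cdot,\ldots,\cdot]$ denotes projective span in $P_9$. A complete quadrilateral consists of four lines $\ell_1,\ldots,\ell_4$ in a projective plane, no three concurrent; its six vertices are $p_{kl}=\ell_k\cap\ell_l$. Basket: for distinct quadric surfaces $q_1,q_2$ of rank at least three, $q_1$ is a basket for $q_2$ (and vice versa) when they are tangent along a conic, so that their intersection is twice this conic. Whenever one speaks of a common basket $b$ for quadrics $q_i$, all quadrics concerned are assumed distinct and of rank at least three. "The quadruple of a generic point is characterized by property (P)" means: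 for all points of a dense open subset of the variety the quadruple has (P), and conversely a generic quadruple of distinct quadrics of rank at least three with (P) admits a common basket.
   Formalization: In the converse, "generic quadruple" means off a relatively closed subset of smaller dimension, not on a dense open subset: the quadruples with the property form a reducible locus having an exceptional 24-dimensional family whose general member has no common basket. *)

theory Defs
  imports "HOL-Analysis.Analysis"
begin

section \<open>Polynomial functions\<close>

text \<open>The algebra of functions generated over the complex numbers by the coordinate functions in
  \<open>X\<close>. As the field is infinite, polynomials and polynomial functions are the same thing.\<close>

inductive_set poly_funs :: "('a \<Rightarrow> complex) set \<Rightarrow> ('a \<Rightarrow> complex) set"
  for X :: "('a \<Rightarrow> complex) set" where
  coord: "f \<in> X \<Longrightarrow> f \<in> poly_funs X"
| const: "(\<lambda>_. c) \<in> poly_funs X"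
| add: "f \<in> poly_funs X \<Longrightarrow> g \<in> poly_funs X \<Longrightarrow> (\<lambda>x. f x + g x) \<in> poly_funs X"
| mult: "f \<in> poly_funs X \<Longrightarrow> g \<in> poly_funs X \<Longrightarrow> (\<lambda>x. f x * g x) \<in> poly_funs X"

section \<open>The projective space of quadric surfaces\<close>

type_synonym mat4 = "complex^4^4"

definition smul :: "complex \<Rightarrow> mat4 \<Rightarrow> mat4" where
  "smul c A = map_matrix ((*) c) A"

text \<open>The library only provides the real vector space structure on \<^typ>\<open>mat4\<close>.\<close>

global_interpretation mat: vector_space smul
  by unfold_locales (simp_all add: smul_def vec_eq_iff algebra_simps)

definition Sym4 :: "mat4 set" where
  "Sym4 = {A. transpose A = A}"

text \<open>Projective linear subspaces of \<open>P(Sym4)\<close> are represented by linear subspaces of \<^const>\<open>Sym4\<close>,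
  whose linear dimension is one more than the projective one; in particular points are
  one-dimensional subspaces. The relation "lies on" is inclusion, the intersection of projective
  subspaces is intersection, and \<open>{0}\<close> is the empty projective subspace.\<close>

definition proj_subspace :: "nat \<Rightarrow> mat4 set \<Rightarrow> bool" where
  "proj_subspace d L \<longleftrightarrow> mat.subspace L \<and> L \<subseteq> Sym4 \<and> mat.dim L = d + 1"

definition P9 :: "mat4 set set" where
  "P9 = {p. proj_subspace 0 p}"

definition proj_span :: "mat4 set set \<Rightarrow> mat4 set" where
  "proj_span S = mat.span (\<Union>S)"

text \<open>All non-zero matrices in a point have the same rank.\<close>

definition qrank :: "mat4 set \<Rightarrow> nat" where
  "qrank p = (THE r. \<forall>A\<in>p - {0}. rank A = r)"

section \<open>Baskets\<close>

definition coords4 :: "(complex^4 \<Rightarrow> complex) set" where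
  "coords4 = range (\<lambda>i x. x $ i)"

definition quad_form :: "mat4 \<Rightarrow> complex^4 \<Rightarrow> complex" where
  "quad_form A x = (\<Sum>i\<in>UNIV. \<Sum>j\<in>UNIV. A $ i $ j * x $ i * x $ j)"

definition lin_form :: "complex^4 \<Rightarrow> complex^4 \<Rightarrow> complex" where
  "lin_form h x = (\<Sum>i\<in>UNIV. h $ i * x $ i)"

definition ideal2 ::
    "(complex^4 \<Rightarrow> complex) \<Rightarrow> (complex^4 \<Rightarrow> complex) \<Rightarrow> (complex^4 \<Rightarrow> complex) set" where
  "ideal2 f g = {(\<lambda>x. a x * f x + b x * g x) | a b. a \<in> poly_funs coords4 \<and> b \<in> poly_funs coords4}"

text \<open>The conic cut out on \<open>q\<^sub>1\<close> by the plane \<open>h = 0\<close> is a Cartier divisor on \<open>q\<^sub>1\<close>, and twice this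
  conic is the subscheme of \<open>q\<^sub>1\<close> with equation \<open>h\<^sup>2 = 0\<close>. That the scheme-theoretic intersection of
  \<open>q\<^sub>1\<close> and \<open>q\<^sub>2\<close> is twice the conic is an equality of homogeneous ideals; for quadrics of rank at
  least three both ideals define complete intersections, hence are saturated, so that equality of
  ideals is equality of subschemes of the projective space. Singular plane sections count
  as conics.\<close>

definition meet_in_double_conic :: "mat4 set \<Rightarrow> mat4 set \<Rightarrow> bool" where
  "meet_in_double_conic q\<^sub>1 q\<^sub>2 \<longleftrightarrow>
    (\<exists>A\<in>q\<^sub>1 - {0}. \<exists>B\<in>q\<^sub>2 - {0}. \<exists>h. h \<noteq> 0 \<and>
       ideal2 (quad_form A) (quad_form B) = ideal2 (quad_form A) (\<lambda>x. (lin_form h x)\<^sup>2))"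

definition basket_for :: "mat4 set \<Rightarrow> mat4 set \<Rightarrow> bool" where
  "basket_for b q \<longleftrightarrow>
    b \<in> P9 \<and> q \<in> P9 \<and> b \<noteq> q \<and> qrank b \<ge> 3 \<and> qrank q \<ge> 3 \<and> meet_in_double_conic b q"

text \<open>A quintuple \<open>(q\<^sub>1, q\<^sub>2, q\<^sub>3, q\<^sub>4, b)\<close> is a function \<open>x\<close> on \<^typ>\<open>4 option\<close> with \<open>x (Some i) = q\<^sub>i\<close>
  and \<open>x None = b\<close>. Its quadruple is \<open>x \<circ> Some\<close>.\<close>

definition B25 :: "(4 option \<Rightarrow> mat4 set) set" where
  "B25 = {x. (\<forall>i. x i \<in> P9 \<and> qrank (x i) \<ge> 3) \<and> inj x \<and> (\<forall>i. basket_for (x None) (x (Some i)))}"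

definition admits_common_basket :: "(4 \<Rightarrow> mat4 set) \<Rightarrow> bool" where
  "admits_common_basket q \<longleftrightarrow> (\<exists>b. case_option b q \<in> B25)"

section \<open>Quadrilaterals of pencils of cones\<close>

definition complete_quadrilateral :: "(4 \<Rightarrow> mat4 set) \<Rightarrow> bool" where
  "complete_quadrilateral L \<longleftrightarrow>
    (\<forall>k. proj_subspace 1 (L k)) \<and> inj L \<and>
    (\<exists>E. proj_subspace 2 E \<and> (\<forall>k. L k \<subseteq> E)) \<and>
    (\<forall>i j k. i \<noteq> j \<and> i \<noteq> k \<and> j \<noteq> k \<longrightarrow> L i \<inter> L j \<inter> L k = {0})"

definition pencil_of_cones :: "mat4 set \<Rightarrow> bool" where
  "pencil_of_cones L \<longleftrightarrow> proj_subspace 1 L \<and> (\<forall>p\<in>P9. p \<subseteq> L \<longrightarrow> qrank p \<le> 3)"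

definition property_P :: "(4 \<Rightarrow> mat4 set) \<Rightarrow> bool" where
  "property_P q \<longleftrightarrow>
    proj_subspace 3 (proj_span (range q)) \<and>
    (\<exists>L. complete_quadrilateral L \<and>
      (\<forall>k. L k \<subseteq> proj_span (range q)) \<and>
      (\<forall>k. pencil_of_cones (L k)) \<and>
      (\<forall>i j k l. {i, j, k, l} = UNIV \<longrightarrow> L k \<inter> L l \<subseteq> proj_span {q i, q j}) \<and>
      {p \<in> P9. (\<exists>k. p \<subseteq> L k) \<and> qrank p = 2} = {L k \<inter> L l | k l. k \<noteq> l})"

definition quadruples_with_P :: "(4 \<Rightarrow> mat4 set) set" where
  "quadruples_with_P = {q. (\<forall>i. q i \<in> P9 \<and> qrank (q i) \<ge> 3) \<and> inj q \<and> property_P q}"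

section \<open>The Zariski topology\<close>

definition entries :: "(('i::finite \<Rightarrow> mat4) \<Rightarrow> complex) set" where
  "entries = {(\<lambda>A. A i $ r $ s) | i r s. True}"

definition multihom_polys :: "(('i::finite \<Rightarrow> mat4) \<Rightarrow> complex) set" where
  "multihom_polys = {f \<in> poly_funs entries.
     \<exists>d :: 'i \<Rightarrow> nat. \<forall>c A. f (\<lambda>i. smul (c i) (A i)) = (\<Prod>i\<in>UNIV. c i ^ d i) * f A}"

definition nonvanishing :: "(('i::finite \<Rightarrow> mat4) \<Rightarrow> complex) \<Rightarrow> ('i \<Rightarrow> mat4 set) set" where
  "nonvanishing f = {p. (\<forall>i. p i \<in> P9) \<and> (\<forall>A. (\<forall>i. A i \<in> p i - {0}) \<longrightarrow> f A \<noteq> 0)}"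

text \<open>The Zariski topology on a finite product of copies of \<^const>\<open>P9\<close>, whose closed sets are the
  common zero sets of multihomogeneous polynomials. It is strictly finer than the product of the
  Zariski topologies of the factors.\<close>

definition zariski :: "('i::finite \<Rightarrow> mat4 set) topology" where
  "zariski = topology_generated_by (nonvanishing ` multihom_polys)"

definition quasi_projective :: "('i::finite \<Rightarrow> mat4 set) set \<Rightarrow> bool" where
  "quasi_projective S \<longleftrightarrow> (\<exists>V C. openin zariski V \<and> closedin zariski C \<and> S = V \<inter> C)"

definition irreducible_space :: "'a topology \<Rightarrow> bool" where
  "irreducible_space T \<longleftrightarrow> topspace T \<noteq> {} \<and>
    (\<forall>C D. closedin T C \<and> closedin T D \<and> C \<union> D = topspace T \<longrightarrow> C = topspace T \<or> D = topspace T)"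

text \<open>The supremum of the lengths of chains of irreducible closed subsets; the empty space has
  dimension \<open>-\<infinity>\<close>.\<close>

definition krull_dim :: "'a topology \<Rightarrow> ereal" where
  "krull_dim T = Sup {ereal (real n) | n. \<exists>Z :: nat \<Rightarrow> 'a set.
     (\<forall>i\<le>n. closedin T (Z i) \<and> irreducible_space (subtopology T (Z i))) \<and>
     (\<forall>i<n. Z i \<subset> Z (Suc i))}"

text \<open>A generic point of an irreducible variety \<open>S\<close> satisfies \<open>Q\<close>.\<close>

definition holds_on_dense_open ::
    "('i::finite \<Rightarrow> mat4 set) set \<Rightarrow> (('i \<Rightarrow> mat4 set) \<Rightarrow> bool) \<Rightarrow> bool" where
  "holds_on_dense_open S Q \<longleftrightarrow>
    (\<exists>U. openin (subtopology zariski S) U \<and> subtopology zariski S closure_of U = S \<and>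
      (\<forall>x\<in>U. Q x))"

text \<open>A generic point of a possibly reducible \<open>S\<close> satisfies \<open>Q\<close>: this holds off a relatively closed
  subset of smaller dimension (for irreducible \<open>S\<close> of finite dimension this amounts to holding on
  a dense open subset). Density is not required, since
  the set of quadruples with \<^const>\<open>property_P\<close> is reducible: it has an exceptional 24-dimensional
  family with all six vertices \<open>p\<^sub>k\<^sub>l\<close> singular at one common point of space, whose general member
  has no common basket. An example, for general symmetric \<open>G\<close>, is
  \<open>G + x\<^sup>2, G + y\<^sup>2, G + z\<^sup>2, G + S\<close> with
  \<open>S = 3/2 (x\<^sup>2 + y\<^sup>2 + z\<^sup>2 + xy + yz + zx)\<close>.\<close>

definition holds_off_smaller_dim ::
    "('i::finite \<Rightarrow> mat4 set) set \<Rightarrow> (('i \<Rightarrow> mat4 set) \<Rightarrow> bool) \<Rightarrow> bool" where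
  "holds_off_smaller_dim S Q \<longleftrightarrow>
    (\<exists>U. openin (subtopology zariski S) U \<and>
      krull_dim (subtopology zariski (S - U)) < krull_dim (subtopology zariski S) \<and>
      (\<forall>x\<in>U. Q x))"

end

theory Submission
  imports Defs "HOL-Library.Function_Algebras"
begin

text \<open>The quadrics with basket \<open>\<langle>G\<rangle>\<close> are the \<open>\<langle>G + h\<^sup>2\<rangle>\<close> with a linear form \<open>h\<close>. So \<^const>\<open>B25\<close> is the image of an open
  set of tuples \<open>(G, h\<^sub>1, \<dots>, h\<^sub>4)\<close>, whence irreducibility and the number \<open>25 = 10 + 16 - 1\<close>. If the \<open>h\<^sub>i\<close> are
  linearly independent, the vertices of the quadrilateral are the \<open>h\<^sub>i\<^sup>2 - h\<^sub>j\<^sup>2\<close>. Conversely, a quadrilateral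
  as in \<^const>\<open>property_P\<close> singles out representatives \<open>Q\<^sub>i\<close> of the quadrics such that the \<open>Q\<^sub>i - Q\<^sub>j\<close> are its
  vertices. The pencil through \<open>Q\<^sub>1 - Q\<^sub>4\<close> and \<open>Q\<^sub>2 - Q\<^sub>4\<close> can be diagonalised, which gives \<open>Q\<^sub>1 - Q\<^sub>4 = x\<^sup>2 - z\<^sup>2\<close> and
  \<open>Q\<^sub>2 - Q\<^sub>4 = y\<^sup>2 - z\<^sup>2\<close>. Comparing the normal forms of the three pencils through \<open>Q\<^sub>4\<close>, either also
  \<open>Q\<^sub>3 - Q\<^sub>4 = w\<^sup>2 - z\<^sup>2\<close>, and then \<open>Q\<^sub>4 - z\<^sup>2\<close> is a common basket unless its rank is too small, or
  \<open>Q\<^sub>3 - Q\<^sub>4\<close> is a form in \<open>x\<close>, \<open>y\<close>, \<open>z\<close> subject to three conditions; both exceptional families depend on 24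
  parameters.

  Dimensions are bounded from above by the growth of Hilbert functions: a chain of \<open>n\<close> proper inclusions
  of irreducible closed sets yields \<open>n\<close> algebraically independent functions, and their monomials grow
  too fast on a set parametrised by fewer parameters. They are bounded from below by the closures of
  the images of a flag of coordinate subspaces under a parametrisation that is an immersion at one
  point; the same count of monomials shows that these closures are distinct.\<close>

section \<open>Polynomial growth of spaces of functions\<close>

text \<open>The number 24 = 25 - 1 shapes the proof. The bad sets in \<open>B25\<close> and in
  \<open>quadruples_with_P\<close> are covered by families with at most 24 parameters: 9 + 12 + 3
  for dependent linear forms and for the exceptional quadruples, 8 + 16 for a degenerate basket u^2
  + v^2. Their closures have dimension at most 24, so something is left after removing them;
  irreducibility makes it dense in \<open>B25\<close>, whereas \<open>quadruples_with_P\<close> is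
  reducible and only the comparison of dimensions is available there. Counting functions suits this
  because it applies to any set covered by a polynomial family, injectively or not, and because
  parameters that are quadratic over the others, as in the exceptional family, cost nothing.
  Multihomogeneous forms have zeros but no values at points; hence the chosen representatives, and
  hence quotients of forms of equal multidegree. The lower bound 25 has to hold for quadruples too,
  so the local coordinates are read off from the four quadrics without the basket.\<close>

global_interpretation fn: vector_space "\<lambda>(c::complex) (f::'a \<Rightarrow> complex) x. c * f x"
  by unfold_locales (simp_all add: fun_eq_iff algebra_simps)

lemma fn_span_mult:
  assumes "f \<in> fn.span B"
  shows "(\<lambda>x. u x * f x) \<in> fn.span ((\<lambda>b x. u x * b x) ` B)"
  using assms
proof (induction rule: fn.span_induct_alt)
  case base
  then show ?case using fn.span_zero by (simp add: zero_fun_def)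
next
  case (step c x y)
  have "(\<lambda>t. u t * (((\<lambda>z. c * x z) + y) t)) = (\<lambda>t. c * (u t * x t)) + (\<lambda>t. u t * y t)"
    by (simp add: fun_eq_iff algebra_simps)
  then show ?case using step
    by (simp add: fn.span_add fn.span_scale fn.span_base)
qed

lemma fn_span_comp:
  assumes "f \<in> fn.span B"
  shows "(\<lambda>x. f (u x)) \<in> fn.span ((\<lambda>b x. b (u x)) ` B)"
  using assms
proof (induction rule: fn.span_induct_alt)
  case base
  then show ?case using fn.span_zero by (simp add: zero_fun_def)
next
  case (step c x y)
  have "(\<lambda>t. ((\<lambda>z. c * x z) + y) (u t)) = (\<lambda>t. c * x (u t)) + (\<lambda>t. y (u t))"
    by (simp add: fun_eq_iff)
  then show ?case using step
    by (simp add: fn.span_add fn.span_scale fn.span_base)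
qed

lemma fn_span_plus: "f \<in> fn.span B \<Longrightarrow> g \<in> fn.span B \<Longrightarrow> (\<lambda>x. f x + g x) \<in> fn.span B"
  using fn.span_add[of f B g] by (simp add: plus_fun_def)

lemma sum_fun_apply: "(\<Sum>i\<in>A. f i) x = (\<Sum>i\<in>A. f i x)" for f :: "'i \<Rightarrow> 'a \<Rightarrow> complex"
  by (induction A rule: infinite_finite_induct) auto

lemma fn_dependent_family:
  fixes v :: "'i \<Rightarrow> 'a \<Rightarrow> complex"
  assumes "finite A" "finite B" "card B < card A" "\<And>i. i \<in> A \<Longrightarrow> \<exists>b\<in>fn.span B. \<forall>p\<in>T. v i p = b p"
  shows "\<exists>c. (\<exists>i\<in>A. c i \<noteq> 0) \<and> (\<forall>p\<in>T. (\<Sum>i\<in>A. c i * v i p) = 0)"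
proof -
  obtain b where b: "\<And>i. i \<in> A \<Longrightarrow> b i \<in> fn.span B" "\<And>i p. i \<in> A \<Longrightarrow> p \<in> T \<Longrightarrow> v i p = b i p"
    using assms(4) by metis
  have red: "\<exists>c. (\<exists>i\<in>A. c i \<noteq> 0) \<and> (\<forall>p. (\<Sum>i\<in>A. c i * b i p) = 0)"
  \<comment> \<open>A repeated member of the family is a relation by itself; only an injective
    family can be treated as a set of vectors.\<close>
  proof (cases "inj_on b A")
    case False
    then obtain i j where ij: "i \<in> A" "j \<in> A" "i \<noteq> j" "b i = b j" by (auto simp: inj_on_def)
    define c where "c = (\<lambda>k. if k = i then 1 else if k = j then -1 else (0::complex))"
    have "(\<Sum>k\<in>A. c k * b k p) = 0" for p
    proof -
      have "(\<Sum>k\<in>A. c k * b k p) = (\<Sum>k\<in>{i,j}. c k * b k p)"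
        by (rule sum.mono_neutral_right) (use assms ij in \<open>auto simp: c_def\<close>)
      also have "\<dots> = 0" using ij by (simp add: c_def)
      finally show ?thesis .
    qed
    then show ?thesis using ij by (intro exI[of _ c]) (auto simp: c_def)
  next
    case True
    have "\<not> fn.independent (b ` A)"
    proof
      assume "fn.independent (b ` A)"
      moreover have "b ` A \<subseteq> fn.span B" using b by auto
      ultimately have "card (b ` A) \<le> card B"
        using fn.independent_span_bound[OF assms(2)] by blast
      then show False using assms(3) True by (simp add: card_image)
    qed
    then obtain u where u: "\<exists>w\<in>b ` A. u w \<noteq> 0" "(\<Sum>w\<in>b ` A. (\<lambda>x. u w * w x)) = 0"
      using fn.dependent_finite[of "b ` A"] assms(1) by auto
    have "(\<Sum>i\<in>A. u (b i) * b i p) = 0" for p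
    proof -
      have "(\<Sum>w\<in>b ` A. (\<lambda>x. u w * w x)) p = (\<Sum>w\<in>b ` A. u w * w p)"
        by (rule sum_fun_apply)
      then show ?thesis using u(2) True by (simp add: sum.reindex)
    qed
    then show ?thesis using u(1) by (intro exI[of _ "\<lambda>i. u (b i)"]) auto
  qed
  then obtain c where c: "\<exists>i\<in>A. c i \<noteq> 0" "\<And>p. (\<Sum>i\<in>A. c i * b i p) = 0" by auto
  have "(\<Sum>i\<in>A. c i * v i p) = 0" if "p \<in> T" for p
  proof -
    have "(\<Sum>i\<in>A. c i * v i p) = (\<Sum>i\<in>A. c i * b i p)" using b(2)[OF _ that] by (intro sum.cong) auto
    then show ?thesis using c(2) by simp
  qed
  then show ?thesis using c(1) by blast
qed

text \<open>A filtration by degree, not a grading: \<open>const\<close> and \<open>suc\<close> make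
  it increasing. Products are built one generator at a time, so that an induction has to deal with a
  single new factor.\<close>

inductive pdeg :: "('a \<Rightarrow> complex) set \<Rightarrow> nat \<Rightarrow> ('a \<Rightarrow> complex) \<Rightarrow> bool"
  for X :: "('a \<Rightarrow> complex) set" where
  const: "pdeg X D (\<lambda>_. c)"
| add: "pdeg X D f \<Longrightarrow> pdeg X D g \<Longrightarrow> pdeg X D (\<lambda>x. f x + g x)"
| gen: "f \<in> X \<Longrightarrow> pdeg X D g \<Longrightarrow> pdeg X (Suc D) (\<lambda>x. f x * g x)"
| suc: "pdeg X D f \<Longrightarrow> pdeg X (Suc D) f"

lemma pdeg_mono: "pdeg X D f \<Longrightarrow> D \<le> E \<Longrightarrow> pdeg X E f"
  by (induction E) (auto simp: le_Suc_eq intro: pdeg.suc)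

lemma pdeg_cmult: "pdeg X D f \<Longrightarrow> pdeg X D (\<lambda>x. c * f x)"
proof (induction rule: pdeg.induct)
  case (add D f g)
  then show ?case using pdeg.add[OF add.IH] by (simp add: algebra_simps)
next
  case (gen f D g)
  then show ?case using pdeg.gen[OF gen.hyps(1) gen.IH] by (simp add: algebra_simps)
qed (auto intro: pdeg.intros)

lemma pdeg_mult: "pdeg X D f \<Longrightarrow> pdeg X E g \<Longrightarrow> pdeg X (D + E) (\<lambda>x. f x * g x)"
proof (induction rule: pdeg.induct)
  case (const D c)
  then show ?case using pdeg_cmult pdeg_mono by (metis le_add2)
next
  case (add D f f')
  then show ?case using pdeg.add[OF add.IH(1)[OF add.prems] add.IH(2)[OF add.prems]] by (simp add: algebra_simps)
next
  case (gen f D f')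
  then show ?case using pdeg.gen[OF gen.hyps(1) gen.IH[OF gen.prems]] by (simp add: algebra_simps)
next
  case (suc D f)
  then show ?case by (auto intro: pdeg.suc)
qed

lemma pdeg_coord: "f \<in> X \<Longrightarrow> pdeg X (Suc 0) f"
  using pdeg.gen[OF _ pdeg.const[of X 0 1]] by simp

lemma pdeg_power: "pdeg X D f \<Longrightarrow> pdeg X (n * D) (\<lambda>x. f x ^ n)"
proof (induction n)
  case 0
  then show ?case using pdeg.const[of X 0 1] by simp
next
  case (Suc n)
  then show ?case using pdeg_mult[OF Suc.prems Suc.IH] by simp
qed

lemma pdeg_prod:
  assumes "\<And>i. i \<in> I \<Longrightarrow> pdeg X (d i) (f i)"
  shows "pdeg X (sum d I) (\<lambda>x. \<Prod>i\<in>I. f i x)"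
  using assms
proof (induction I rule: infinite_finite_induct)
  case (insert i I)
  then show ?case using pdeg_mult[of X "d i" "f i" "sum d I" "\<lambda>x. \<Prod>i\<in>I. f i x"] by simp
qed (auto intro: pdeg.intros)

lemma poly_funs_pdeg: "f \<in> poly_funs X \<Longrightarrow> \<exists>D. pdeg X D f"
proof (induction rule: poly_funs.induct)
  case (coord f)
  then show ?case using pdeg_coord by blast
next
  case (const c)
  then show ?case using pdeg.const by blast
next
  case (add f g)
  then obtain D E where "pdeg X D f" "pdeg X E g" by auto
  then have "pdeg X (max D E) f" "pdeg X (max D E) g" by (auto elim!: pdeg_mono)
  then show ?case using pdeg.add by blast
next
  case (mult f g)
  then show ?case using pdeg_mult by blast
qed

text \<open>Substitution multiplies degrees by \<open>c\<close>. Equality is asked on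
  \<open>Y\<close> only, so that equations valid on a parameter set may be used to rewrite the
  generators.\<close>

lemma pdeg_subst:
  assumes "\<And>f. f \<in> X \<Longrightarrow> \<exists>g. pdeg X' c g \<and> (\<forall>y\<in>Y. f (u y) = g y)" and "pdeg X D f"
  shows "\<exists>g. pdeg X' (c * D) g \<and> (\<forall>y\<in>Y. f (u y) = g y)"
  using assms(2)
proof (induction rule: pdeg.induct)
  case (const D k)
  then show ?case by (metis pdeg.const)
next
  case (add D f g)
  then obtain f' g' where "pdeg X' (c * D) f'" "pdeg X' (c * D) g'"
    "\<forall>y\<in>Y. f (u y) = f' y" "\<forall>y\<in>Y. g (u y) = g' y" by auto
  then show ?case by (intro exI[of _ "\<lambda>x. f' x + g' x"]) (auto intro: pdeg.add)
next
  case (gen f D g)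
  obtain f' where f': "pdeg X' c f'" "\<forall>y\<in>Y. f (u y) = f' y" using assms(1)[OF gen(1)] by auto
  obtain g' where g': "pdeg X' (c * D) g'" "\<forall>y\<in>Y. g (u y) = g' y" using gen by auto
  have "pdeg X' (c + c * D) (\<lambda>x. f' x * g' x)" using f' g' by (intro pdeg_mult)
  then show ?case using f' g' by (intro exI[of _ "\<lambda>x. f' x * g' x"]) auto
next
  case (suc D f)
  then show ?case by (metis le_add2 mult_Suc_right pdeg_mono)
qed

text \<open>A Hilbert function of order D^m: \<open>m\<close> bounds what would be the transcendence
  degree of the functions \<open>X\<close> restricted to \<open>Y\<close>. The spanning set may
  consist of arbitrary functions.\<close>

definition growth :: "'a set \<Rightarrow> ('a \<Rightarrow> complex) set \<Rightarrow> nat \<Rightarrow> bool" where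
  "growth Y X m \<longleftrightarrow> (\<exists>C. \<forall>D. \<exists>B. finite B \<and> card B \<le> C * (D + 1) ^ m \<and>
     (\<forall>f. pdeg X D f \<longrightarrow> (\<exists>b\<in>fn.span B. \<forall>y\<in>Y. f y = b y)))"

text \<open>The monomials with every exponent at most \<open>D\<close> span the polynomials of
  degree \<open>D\<close>. There are (D+1)^card X of them, a cruder count than the binomial one but
  of the same order.\<close>

lemma growth_card:
  assumes "finite X" "card X \<le> m"
  shows "growth Y X m"
proof -
  define mon where "mon = (\<lambda>(a :: ('a \<Rightarrow> complex) \<Rightarrow> nat) y. \<Prod>x\<in>X. x y ^ a x)"
  define E where "E = (\<lambda>D. PiE X (\<lambda>_. {..D::nat}))"
  have span: "pdeg X D f \<Longrightarrow> f \<in> fn.span (mon ` E D)" for D f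
  proof (induction rule: pdeg.induct)
    case (const D c)
    have "(\<lambda>x\<in>X. 0) \<in> E D" by (auto simp: E_def)
    moreover have "mon (\<lambda>x\<in>X. 0) = (\<lambda>_. 1)" by (auto simp: mon_def)
    ultimately have "(\<lambda>_. 1) \<in> fn.span (mon ` E D)" by (metis fn.span_base imageI)
    from fn.span_scale[OF this, of c] show ?case by simp
  next
    case (add D f g)
    then show ?case by (intro fn_span_plus) auto
  next
    case (gen f D g)
    have "(\<lambda>b y. f y * b y) ` (mon ` E D) \<subseteq> mon ` E (Suc D)"
    proof safe
      fix a assume a: "a \<in> E D"
      have "(\<lambda>y. f y * mon a y) = mon (a(f := Suc (a f)))"
      proof
        fix y
        have "(\<Prod>x\<in>X - {f}. x y ^ (a(f := Suc (a f))) x) = (\<Prod>x\<in>X - {f}. x y ^ a x)"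
          by (intro prod.cong) auto
        then show "f y * mon a y = mon (a(f := Suc (a f))) y"
          using assms(1) gen(1) by (simp add: mon_def prod.remove[of X f] del: fun_upd_apply) simp
      qed
      moreover have "a(f := Suc (a f)) \<in> E (Suc D)" using a gen(1) 
        by (auto simp: E_def PiE_iff extensional_def le_Suc_eq)
      ultimately show "(\<lambda>y. f y * mon a y) \<in> mon ` E (Suc D)" by auto
    qed
    then show ?case using fn_span_mult[OF gen.IH, of f] fn.span_mono by blast
  next
    case (suc D f)
    have "E D \<subseteq> E (Suc D)" by (force simp: E_def PiE_iff intro: le_SucI)
    from fn.span_mono[OF image_mono[OF this]] show ?case using suc.IH by blast
  qed
  have fin: "finite (E D)" for D unfolding E_def using assms(1) by (intro finite_PiE) auto
  have "card (mon ` E D) \<le> 1 * (D + 1) ^ m" for D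
  proof -
    have "card (mon ` E D) \<le> card (E D)" using fin by (rule card_image_le)
    also have "\<dots> = (D + 1) ^ card X" using assms(1) by (simp add: E_def card_PiE)
    also have "\<dots> \<le> (D + 1) ^ m" using assms(2) by (intro power_increasing) auto
    finally show ?thesis by simp
  qed
  then show ?thesis unfolding growth_def using fin span
    by (intro exI[of _ 1] allI exI[of _ "mon ` E _"] conjI) blast+
qed

text \<open>Every polynomial in \<open>X\<close> and \<open>g\<close> reduces to the form \<open>p g + r\<close>, where the degrees of \<open>p\<close> and \<open>r\<close> in \<open>X\<close>
  are bounded linearly.\<close>

lemma growth_quadratic:
  assumes "growth Y X m" "pdeg X c P" "pdeg X c R" "\<And>y. y \<in> Y \<Longrightarrow> (g y)\<^sup>2 = P y * g y + R y"
  shows "growth Y (insert g X) m"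
proof -
  \<comment> \<open>A factor \<open>g\<close> replaces (p, r) by (p P + r, p R), which adds at most
    \<open>c\<close> to the degrees; a factor from \<open>X\<close> adds one. The allowance
    \<open>Suc c\<close> per factor covers both.\<close>
  have red: "\<exists>p r. pdeg X (Suc c * D) p \<and> pdeg X (Suc c * D) r \<and> (\<forall>y\<in>Y. f y = p y * g y + r y)"
    if "pdeg (insert g X) D f" for D f
    using that
  proof (induction rule: pdeg.induct)
    case (const D k)
    then show ?case
      by (intro exI[of _ "\<lambda>_. 0"] exI[of _ "\<lambda>_. k"]) (auto intro: pdeg.const)
  next
    case (add D f f')
    then obtain p r p' r' where "pdeg X (Suc c * D) p" "pdeg X (Suc c * D) r" "\<forall>y\<in>Y. f y = p y * g y + r y"
      "pdeg X (Suc c * D) p'" "pdeg X (Suc c * D) r'" "\<forall>y\<in>Y. f' y = p' y * g y + r' y" by auto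
    then show ?case
      by (intro exI[of _ "\<lambda>y. p y + p' y"] exI[of _ "\<lambda>y. r y + r' y"])
        (auto intro: pdeg.add simp: algebra_simps)
  next
    case (gen f D f')
    then obtain p r where pr: "pdeg X (Suc c * D) p" "pdeg X (Suc c * D) r" "\<forall>y\<in>Y. f' y = p y * g y + r y"
      by auto
    show ?case
    proof (cases "f = g")
      case True
      have 1: "pdeg X (Suc c * D + c) (\<lambda>y. p y * P y)" "pdeg X (Suc c * D + c) (\<lambda>y. p y * R y)"
        using pr assms(2,3) by (auto intro: pdeg_mult)
      have 2: "pdeg X (Suc c * Suc D) (\<lambda>y. p y * P y + r y)" "pdeg X (Suc c * Suc D) (\<lambda>y. p y * R y)"
        using pdeg_mono[OF 1(1), of "Suc c * Suc D"] pdeg_mono[OF 1(2), of "Suc c * Suc D"]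
          pdeg_mono[OF pr(2), of "Suc c * Suc D"]
        by (auto intro!: pdeg.add)
      have "f y * f' y = (p y * P y + r y) * g y + p y * R y" if "y \<in> Y" for y
      proof -
        have "f y * f' y = p y * (g y)\<^sup>2 + r y * g y" using pr that True by (simp add: power2_eq_square algebra_simps)
        then show ?thesis using assms(4)[OF that] by (simp add: algebra_simps)
      qed
      then show ?thesis using 2 by blast
    next
      case False
      then have f: "f \<in> X" using gen by auto
      have "pdeg X (Suc c * Suc D) (\<lambda>y. f y * p y)" "pdeg X (Suc c * Suc D) (\<lambda>y. f y * r y)"
        using pdeg_mono[OF pdeg.gen[OF f pr(1)], of "Suc c * Suc D"] 
          pdeg_mono[OF pdeg.gen[OF f pr(2)], of "Suc c * Suc D"] by auto
      then show ?thesis using pr(3)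
        by (intro exI[of _ "\<lambda>y. f y * p y"] exI[of _ "\<lambda>y. f y * r y"]) (auto simp: algebra_simps)
    qed
  next
    case (suc D f)
    then obtain p r where "pdeg X (Suc c * D) p" "pdeg X (Suc c * D) r" "\<forall>y\<in>Y. f y = p y * g y + r y"
      by auto
    moreover have "Suc c * D \<le> Suc c * Suc D" by simp
    ultimately show ?case using pdeg_mono by blast
  qed
  obtain C where C: "\<And>D. \<exists>B. finite B \<and> card B \<le> C * (D + 1) ^ m \<and>
     (\<forall>f. pdeg X D f \<longrightarrow> (\<exists>b\<in>fn.span B. \<forall>y\<in>Y. f y = b y))"
    using assms(1) unfolding growth_def by blast
  show ?thesis unfolding growth_def
  proof (intro exI[of _ "2 * C * Suc c ^ m"] allI)
    fix D
    obtain B where B: "finite B" "card B \<le> C * (Suc c * D + 1) ^ m" 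
      "\<And>f. pdeg X (Suc c * D) f \<Longrightarrow> \<exists>b\<in>fn.span B. \<forall>y\<in>Y. f y = b y"
      using C[of "Suc c * D"] by blast
    let ?gB = "(\<lambda>b y. g y * b y) ` B"
    show "\<exists>B. finite B \<and> card B \<le> 2 * C * Suc c ^ m * (D + 1) ^ m \<and>
             (\<forall>f. pdeg (insert g X) D f \<longrightarrow> (\<exists>b\<in>fn.span B. \<forall>y\<in>Y. f y = b y))"
    proof (intro exI[of _ "B \<union> ?gB"] conjI allI impI)
      have "card (B \<union> ?gB) \<le> card B + card ?gB" by (rule card_Un_le)
      also have "\<dots> \<le> 2 * card B" using card_image_le[OF B(1), of "\<lambda>b y. g y * b y"] by simp
      also have "\<dots> \<le> 2 * (C * (Suc c * D + 1) ^ m)" using B(2) by simp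
      also have "\<dots> \<le> 2 * (C * (Suc c * (D + 1)) ^ m)" by (intro mult_le_mono2 power_mono) auto
      also have "\<dots> = 2 * C * Suc c ^ m * (D + 1) ^ m"
        by (simp only: power_mult_distrib mult.assoc)
      finally show "card (B \<union> ?gB) \<le> 2 * C * Suc c ^ m * (D + 1) ^ m" .
      fix f assume "pdeg (insert g X) D f"
      then obtain p r where "pdeg X (Suc c * D) p" "pdeg X (Suc c * D) r" and pr: "\<forall>y\<in>Y. f y = p y * g y + r y"
        using red by blast
      from B(3)[OF this(1)] B(3)[OF this(2)]
      obtain p' r' where p': "p' \<in> fn.span B" "\<forall>y\<in>Y. p y = p' y" 
        and r': "r' \<in> fn.span B" "\<forall>y\<in>Y. r y = r' y" by blast
      have "(\<lambda>y. g y * p' y) \<in> fn.span (B \<union> ?gB)"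
        using fn_span_mult[OF p'(1), of g] fn.span_mono[of ?gB "B \<union> ?gB"] by blast
      moreover have "r' \<in> fn.span (B \<union> ?gB)" using r'(1) fn.span_mono[of B "B \<union> ?gB"] by blast
      ultimately have "(\<lambda>y. g y * p' y + r' y) \<in> fn.span (B \<union> ?gB)" by (rule fn_span_plus)
      then show "\<exists>b\<in>fn.span (B \<union> ?gB). \<forall>y\<in>Y. f y = b y"
        using pr p' r' by (intro bexI[of _ "\<lambda>y. g y * p' y + r' y"]) auto
    qed (use B in auto)
  qed
qed

section \<open>Multihomogeneous polynomials and the dimension of chains\<close>

definition points :: "('i \<Rightarrow> mat4 set) set" where
  "points = {p. \<forall>i. p i \<in> P9}"

text \<open>The value of a form at \<open>rep p\<close> depends on the choice; whether it vanishes
  does not (\<open>mhom_rep_zero\<close>).\<close>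

definition rep :: "('i \<Rightarrow> mat4 set) \<Rightarrow> 'i \<Rightarrow> mat4" where
  "rep p i = (SOME A. A \<in> p i - {0})"

definition mhom :: "('i::finite \<Rightarrow> nat) \<Rightarrow> (('i \<Rightarrow> mat4) \<Rightarrow> complex) \<Rightarrow> bool" where
  "mhom d f \<longleftrightarrow> f \<in> poly_funs entries \<and>
     (\<forall>c A. f (\<lambda>i. smul (c i) (A i)) = (\<Prod>i\<in>UNIV. c i ^ d i) * f A)"

lemma multihom_polys_iff: "f \<in> multihom_polys \<longleftrightarrow> (\<exists>d. mhom d f)"
  by (auto simp: multihom_polys_def mhom_def)

lemma smul_nth [simp]: "smul c A $ i $ j = c * A $ i $ j"
  by (simp add: smul_def)

lemma Sym4_iff: "A \<in> Sym4 \<longleftrightarrow> (\<forall>i j. A $ i $ j = A $ j $ i)"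
  by (auto simp: Sym4_def transpose_def vec_eq_iff)

lemma subspace_Sym4: "mat.subspace Sym4"
  by (auto simp: mat.subspace_def Sym4_iff)

lemma P9_iff: "p \<in> P9 \<longleftrightarrow> (\<exists>A\<in>Sym4. A \<noteq> 0 \<and> p = mat.span {A})"
proof
  assume "p \<in> P9"
  then have p: "mat.subspace p" "p \<subseteq> Sym4" "mat.dim p = 1" by (auto simp: P9_def proj_subspace_def)
  obtain B where B: "B \<subseteq> p" "mat.independent B" "p \<subseteq> mat.span B" "card B = mat.dim p"
    using mat.basis_exists by blast
  then obtain A where A: "B = {A}" using p(3) card_1_singletonE by metis
  have "p = mat.span {A}" using B(1,3) A p(1) mat.span_minimal[of B p] by blast
  moreover have "A \<noteq> 0" using B(2) A by auto
  ultimately show "\<exists>A\<in>Sym4. A \<noteq> 0 \<and> p = mat.span {A}" using A B(1) p(2) by auto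
next
  assume "\<exists>A\<in>Sym4. A \<noteq> 0 \<and> p = mat.span {A}"
  then obtain A where A: "A \<in> Sym4" "A \<noteq> 0" "p = mat.span {A}" by blast
  have "p \<subseteq> Sym4" using A subspace_Sym4 mat.span_minimal[of "{A}" Sym4] by auto
  moreover have "mat.dim p = card {A}" using A mat.dim_span_eq_card_independent[of "{A}"] by simp
  ultimately show "p \<in> P9" using A by (auto simp: P9_def proj_subspace_def)
qed

lemma P9_memD:
  assumes "p \<in> P9" "A \<in> p - {0}"
  shows "p = mat.span {A}" "A \<in> Sym4"
proof -
  obtain A' where A': "A' \<in> Sym4" "A' \<noteq> 0" "p = mat.span {A'}" using assms P9_iff by auto
  then obtain k where k: "A = smul k A'" using assms by (auto simp: mat.span_singleton)
  then have k0: "k \<noteq> 0" using assms by auto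
  have "A' = smul (1/k) A" using k k0 by simp
  then have "A' \<in> mat.span {A}" by (metis mat.span_base mat.span_scale singletonI)
  moreover have "A \<in> mat.span {A'}" using k mat.span_scale[of A' "{A'}" k] mat.span_base[of A' "{A'}"] by auto
  ultimately show "p = mat.span {A}" using A'(3)
    by (metis empty_subsetI insert_subset mat.span_eq)
  show "A \<in> Sym4" using k A' subspace_Sym4 mat.subspace_scale by blast
qed

lemma span_in_P9 [intro]: "A \<in> Sym4 \<Longrightarrow> A \<noteq> 0 \<Longrightarrow> mat.span {A} \<in> P9"
  using P9_iff by blast

lemma rep_in: "p i \<in> P9 \<Longrightarrow> rep p i \<in> p i - {0}"
proof -
  assume "p i \<in> P9"
  then obtain A where "A \<noteq> 0" "p i = mat.span {A}" using P9_iff by auto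
  then have "A \<in> p i - {0}" by (auto simp: mat.span_base)
  then show ?thesis unfolding rep_def by (rule someI)
qed

lemma rep_span: "p i \<in> P9 \<Longrightarrow> p i = mat.span {rep p i}"
  by (rule P9_memD(1)[OF _ rep_in])

lemma rep_scale:
  assumes "p i \<in> P9" "A \<in> p i - {0}"
  shows "\<exists>c. c \<noteq> 0 \<and> rep p i = smul c A"
proof -
  have "rep p i \<in> mat.span {A}" using P9_memD(1)[OF assms] rep_in[of p i, OF assms(1)] by auto
  then obtain c where c: "rep p i = smul c A" by (auto simp: mat.span_singleton)
  moreover have "c \<noteq> 0" using c rep_in[of p i] assms(1) by auto
  ultimately show ?thesis by blast
qed

lemma rep_scale_all:
  assumes "p \<in> points" "\<And>i. A i \<in> p i - {0}"
  obtains c where "\<And>i. c i \<noteq> 0" "rep p = (\<lambda>i. smul (c i) (A i))"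
proof -
  have "\<forall>i. \<exists>c. c \<noteq> 0 \<and> rep p i = smul c (A i)" using assms rep_scale[of p] by (auto simp: points_def)
  then obtain c where "\<forall>i. c i \<noteq> 0 \<and> rep p i = smul (c i) (A i)" by metis
  then show ?thesis by (intro that[of c]) auto
qed

lemma mhom_rep_zero:
  assumes "mhom d f" "p \<in> points" "\<And>i. A i \<in> p i - {0}"
  shows "f (rep p) = 0 \<longleftrightarrow> f A = 0"
proof -
  obtain c where c: "\<And>i. c i \<noteq> 0" "rep p = (\<lambda>i. smul (c i) (A i))"
    using rep_scale_all[OF assms(2,3)] by blast
  have "f (rep p) = (\<Prod>i\<in>UNIV. c i ^ d i) * f A" using assms(1) c(2) by (simp add: mhom_def)
  then show ?thesis using c(1) by simp
qed

lemma mhom_mult: "mhom d f \<Longrightarrow> mhom e g \<Longrightarrow> mhom (\<lambda>i. d i + e i) (\<lambda>A. f A * g A)"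
  by (auto simp: mhom_def power_add prod.distrib intro: poly_funs.mult)

lemma mhom_add: "mhom d f \<Longrightarrow> mhom d g \<Longrightarrow> mhom d (\<lambda>A. f A + g A)"
  by (auto simp: mhom_def algebra_simps intro: poly_funs.add)

lemma mhom_const: "mhom (\<lambda>_. 0) (\<lambda>_. c)"
  by (auto simp: mhom_def intro: poly_funs.const)

lemma mhom_zero: "mhom d (\<lambda>_. 0)"
  by (auto simp: mhom_def intro: poly_funs.const)

lemma mhom_cmult: "mhom d f \<Longrightarrow> mhom d (\<lambda>A. c * f A)"
  using mhom_mult[OF mhom_const[of c]] by simp

lemma mhom_power: "mhom d f \<Longrightarrow> mhom (\<lambda>i. k * d i) (\<lambda>A. f A ^ k)"
proof (induction k)
  case 0
  then show ?case using mhom_const[of 1] by simp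
next
  case (Suc k)
  then show ?case using mhom_mult[OF Suc.prems Suc.IH[OF Suc.prems]] by simp
qed

lemma mhom_prod:
  assumes "\<And>j. j \<in> J \<Longrightarrow> mhom (d j) (f j)"
  shows "mhom (\<lambda>i. \<Sum>j\<in>J. d j i) (\<lambda>A. \<Prod>j\<in>J. f j A)"
  using assms
proof (induction J rule: infinite_finite_induct)
  case (insert j J)
  then show ?case using mhom_mult[of "d j" "f j" "\<lambda>i. \<Sum>j\<in>J. d j i" "\<lambda>A. \<Prod>j\<in>J. f j A"] by simp
qed (auto intro: mhom_const)

lemma mhom_sum:
  assumes "\<And>j. j \<in> J \<Longrightarrow> mhom d (f j)"
  shows "mhom d (\<lambda>A. \<Sum>j\<in>J. f j A)"
  using assms
  by (induction J rule: infinite_finite_induct) (auto intro: mhom_zero mhom_add)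

lemma mhom_entry: "mhom (\<lambda>j. if j = i then 1 else 0) (\<lambda>A. A i $ r $ s)"
proof -
  have "(\<Prod>j\<in>UNIV. c j ^ (if j = i then 1 else 0)) = c i" for c :: "'a::finite \<Rightarrow> complex"
    by (simp add: if_distrib[of "\<lambda>n. _ ^ n"] cong: if_cong)
  then show ?thesis by (auto simp: mhom_def entries_def intro!: poly_funs.coord)
qed

lemma mhom_diff: "mhom d f \<Longrightarrow> mhom d g \<Longrightarrow> mhom d (\<lambda>A. f A - g A)"
  using mhom_add[OF _ mhom_cmult[of d g "-1"]] by simp

section \<open>The Zariski topology in terms of forms\<close>

lemma nonvanishing_subset: "nonvanishing f \<subseteq> points"
  by (auto simp: nonvanishing_def points_def)

lemma nonvanishing_iff:
  assumes "f \<in> multihom_polys"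
  shows "p \<in> nonvanishing f \<longleftrightarrow> p \<in> points \<and> f (rep p) \<noteq> 0"
proof -
  obtain d where d: "mhom d f" using assms multihom_polys_iff by auto
  have "p \<in> points \<Longrightarrow> \<forall>i. rep p i \<in> p i - {0}" using rep_in[of p] by (auto simp: points_def)
  then show ?thesis using mhom_rep_zero[OF d, of p]
    by (auto simp: nonvanishing_def points_def)
qed

lemma multihom_mult: "f \<in> multihom_polys \<Longrightarrow> g \<in> multihom_polys \<Longrightarrow> (\<lambda>A. f A * g A) \<in> multihom_polys"
  unfolding multihom_polys_iff using mhom_mult by blast

text \<open>Products of multihomogeneous polynomials are multihomogeneous, so the generating sets
  are stable under intersection and form a base.\<close>

lemma openin_zariski:
  "openin zariski U \<longleftrightarrow> (\<forall>x\<in>U. \<exists>f\<in>multihom_polys. x \<in> nonvanishing f \<and> nonvanishing f \<subseteq> U)"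
proof
  assume "openin zariski U"
  then have "generate_topology_on (nonvanishing ` multihom_polys) U"
    by (simp add: zariski_def openin_topology_generated_by_iff)
  then show "\<forall>x\<in>U. \<exists>f\<in>multihom_polys. x \<in> nonvanishing f \<and> nonvanishing f \<subseteq> U"
  proof induction
    case (Int a b)
    show ?case
    proof
      fix x assume "x \<in> a \<inter> b"
      then obtain f g where fg: "f \<in> multihom_polys" "x \<in> nonvanishing f" "nonvanishing f \<subseteq> a"
        "g \<in> multihom_polys" "x \<in> nonvanishing g" "nonvanishing g \<subseteq> b" using Int.IH by blast
      have "nonvanishing (\<lambda>A. f A * g A) \<subseteq> a \<inter> b" "x \<in> nonvanishing (\<lambda>A. f A * g A)"
        using fg by (auto simp: nonvanishing_iff multihom_mult)
      then show "\<exists>f\<in>multihom_polys. x \<in> nonvanishing f \<and> nonvanishing f \<subseteq> a \<inter> b"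
        using multihom_mult[OF fg(1) fg(4)] by blast
    qed
  qed (blast+)
next
  assume R: "\<forall>x\<in>U. \<exists>f\<in>multihom_polys. x \<in> nonvanishing f \<and> nonvanishing f \<subseteq> U"
  then have "U = \<Union>{nonvanishing f | f. f \<in> multihom_polys \<and> nonvanishing f \<subseteq> U}" by blast
  moreover have "openin zariski (\<Union>{nonvanishing f | f. f \<in> multihom_polys \<and> nonvanishing f \<subseteq> U})"
    by (rule openin_Union) (auto simp: zariski_def intro: topology_generated_by_Basis)
  ultimately show "openin zariski U" by simp
qed

lemma topspace_zariski [simp]: "topspace zariski = points"
proof
  show "topspace zariski \<subseteq> points"
    using nonvanishing_subset openin_topspace[of zariski] unfolding openin_zariski by blast
  have 1: "(\<lambda>_. 1) \<in> multihom_polys" using mhom_const multihom_polys_iff by blast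
  have "points \<subseteq> nonvanishing (\<lambda>_. 1)" using nonvanishing_iff[OF 1] by auto
  moreover have "openin zariski (nonvanishing (\<lambda>_. 1))" using 1 openin_zariski by blast
  ultimately show "points \<subseteq> topspace zariski" using openin_subset by blast
qed

lemma openin_nonvanishing: "f \<in> multihom_polys \<Longrightarrow> openin zariski (nonvanishing f)"
  using openin_zariski by blast

lemma zariski_closure_iff:
  assumes "S \<subseteq> points"
  shows "x \<in> zariski closure_of S \<longleftrightarrow>
    x \<in> points \<and> (\<forall>f\<in>multihom_polys. (\<forall>s\<in>S. f (rep s) = 0) \<longrightarrow> f (rep x) = 0)"
proof -
  have "(\<forall>T. x \<in> T \<and> openin zariski T \<longrightarrow> (\<exists>y. y \<in> S \<and> y \<in> T)) \<longleftrightarrow>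
     (\<forall>f\<in>multihom_polys. (\<forall>s\<in>S. f (rep s) = 0) \<longrightarrow> f (rep x) = 0)" (is "?L \<longleftrightarrow> ?R") if "x \<in> points"
  proof
    assume ?L
    show ?R
    proof (intro ballI impI, rule ccontr)
      fix f assume "f \<in> multihom_polys" "\<forall>s\<in>S. f (rep s) = 0" "f (rep x) \<noteq> 0"
      then show False
        using \<open>?L\<close>[rule_format, of "nonvanishing f"] openin_nonvanishing[of f] nonvanishing_iff[of f] that by auto
    qed
  next
    assume ?R
    show ?L
    proof (intro allI impI, elim conjE)
      fix T assume "x \<in> T" "openin zariski T"
      then obtain f where "f \<in> multihom_polys" "x \<in> nonvanishing f" "nonvanishing f \<subseteq> T"
        unfolding openin_zariski by blast
      then show "\<exists>y. y \<in> S \<and> y \<in> T" using \<open>?R\<close> nonvanishing_iff[of f] assms by blast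
    qed
  qed
  then show ?thesis by (auto simp: in_closure_of)
qed

lemma closure_vanish:
  "S \<subseteq> points \<Longrightarrow> f \<in> multihom_polys \<Longrightarrow> \<forall>s\<in>S. f (rep s) = 0 \<Longrightarrow> x \<in> zariski closure_of S \<Longrightarrow> f (rep x) = 0"
  using zariski_closure_iff by blast

lemma closed_separation:
  assumes "T \<subseteq> points" "closedin (subtopology zariski T) Z" "x \<in> T" "x \<notin> Z"
  shows "\<exists>f\<in>multihom_polys. f (rep x) \<noteq> 0 \<and> (\<forall>z\<in>Z. f (rep z) = 0)"
proof -
  have "openin (subtopology zariski T) (T - Z)"
    using assms by (simp add: closedin_def topspace_subtopology Int_absorb1)
  then obtain U where U: "openin zariski U" "T - Z = U \<inter> T" by (auto simp: openin_subtopology)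
  then obtain f where f: "f \<in> multihom_polys" "x \<in> nonvanishing f" "nonvanishing f \<subseteq> U"
    using assms unfolding openin_zariski by blast
  have "Z \<subseteq> T" using assms closedin_subset by (force simp: topspace_subtopology)
  then have "\<forall>z\<in>Z. f (rep z) = 0"
    using U f nonvanishing_iff[OF f(1)] assms(1) by blast
  then show ?thesis using f nonvanishing_iff[OF f(1)] by blast
qed

lemma closedin_vanishing:
  assumes "T \<subseteq> points" "f \<in> multihom_polys"
  shows "closedin (subtopology zariski T) {p \<in> T. f (rep p) = 0}"
proof -
  have "T - {p \<in> T. f (rep p) = 0} = nonvanishing f \<inter> T"
    using nonvanishing_iff[OF assms(2)] assms(1) by auto
  then show ?thesis using openin_nonvanishing[OF assms(2)] assms(1)
    by (auto simp: closedin_def topspace_subtopology openin_subtopology)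
qed

text \<open>Irreducibility is primality of the vanishing ideal, tested on multihomogeneous elements:
  if two proper closed subsets cover \<open>Z\<close>, each is cut off from a missing point by a
  form, and the product of the two forms vanishes on \<open>Z\<close>.\<close>

lemma irreducible_iff:
  assumes "Z \<subseteq> points"
  shows "irreducible_space (subtopology zariski Z) \<longleftrightarrow> Z \<noteq> {} \<and>
    (\<forall>f\<in>multihom_polys. \<forall>g\<in>multihom_polys. (\<forall>z\<in>Z. f (rep z) * g (rep z) = 0) \<longrightarrow>
       (\<forall>z\<in>Z. f (rep z) = 0) \<or> (\<forall>z\<in>Z. g (rep z) = 0))" (is "?L \<longleftrightarrow> ?R")
proof
  assume L: ?L
  have top: "topspace (subtopology zariski Z) = Z" using assms by auto
  show ?R
  proof (intro conjI ballI impI)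
    show "Z \<noteq> {}" using L top by (simp add: irreducible_space_def)
    fix f g :: "('a \<Rightarrow> mat4) \<Rightarrow> complex"
    assume fg: "f \<in> multihom_polys" "g \<in> multihom_polys" "\<forall>z\<in>Z. f (rep z) * g (rep z) = 0"
    then have "{p \<in> Z. f (rep p) = 0} \<union> {p \<in> Z. g (rep p) = 0} = Z" by auto
    then have "{p \<in> Z. f (rep p) = 0} = Z \<or> {p \<in> Z. g (rep p) = 0} = Z"
      using L[unfolded irreducible_space_def top, THEN conjunct2, rule_format, OF conjI[OF
        closedin_vanishing[OF assms fg(1)] conjI[OF closedin_vanishing[OF assms fg(2)]]]] by simp
    then show "(\<forall>z\<in>Z. f (rep z) = 0) \<or> (\<forall>z\<in>Z. g (rep z) = 0)" by blast
  qed
next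
  assume R: ?R
  have top: "topspace (subtopology zariski Z) = Z" using assms by auto
  show ?L unfolding irreducible_space_def top
  proof (intro conjI allI impI)
    show "Z \<noteq> {}" using R by simp
    fix C D assume CD: "closedin (subtopology zariski Z) C \<and> closedin (subtopology zariski Z) D \<and> C \<union> D = Z"
    show "C = Z \<or> D = Z"
    proof (rule ccontr)
      assume "\<not> ?thesis"
      then obtain x y where xy: "x \<in> Z" "x \<notin> C" "y \<in> Z" "y \<notin> D" using CD by blast
      obtain f where f: "f \<in> multihom_polys" "f (rep x) \<noteq> 0" "\<forall>z\<in>C. f (rep z) = 0"
        using closed_separation[OF assms _ xy(1,2)] CD by blast
      obtain g where g: "g \<in> multihom_polys" "g (rep y) \<noteq> 0" "\<forall>z\<in>D. g (rep z) = 0"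
        using closed_separation[OF assms _ xy(3,4)] CD by blast
      have "\<forall>z\<in>Z. f (rep z) * g (rep z) = 0" using f(3) g(3) CD by auto
      then show False using R f g xy by blast
    qed
  qed
qed

text \<open>The growth of the multigraded Hilbert function of \<open>T\<close>. Bounding the total degree separately from
  the multidegree \<open>d\<close> makes it unnecessary to decompose polynomials into homogeneous parts.\<close>

definition hbound :: "('i::finite \<Rightarrow> mat4 set) set \<Rightarrow> nat \<Rightarrow> ('i \<Rightarrow> nat) \<Rightarrow> nat \<Rightarrow> bool" where
  "hbound T E d N \<longleftrightarrow> (\<exists>B. finite B \<and> card B \<le> N \<and>
     (\<forall>f. pdeg entries E f \<and> mhom d f \<longrightarrow> (\<exists>b\<in>fn.span B. \<forall>p\<in>T. f (rep p) = b p)))"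

text \<open>The slope \<open>e\<close> precedes \<open>C\<close> because the monomials to be counted
  have a degree proportional to \<open>D\<close>, with a factor depending on the chosen forms;
  \<open>C\<close> has to be uniform in the multidegree \<open>d\<close>.\<close>

definition hgrow :: "('i::finite \<Rightarrow> mat4 set) set \<Rightarrow> nat \<Rightarrow> bool" where
  "hgrow T m \<longleftrightarrow> (\<forall>e. \<exists>C. \<forall>D d. hbound T (e * D) d (C * (D + 1) ^ m))"

lemma hbound_subset: "hbound T E d N \<Longrightarrow> S \<subseteq> T \<Longrightarrow> hbound S E d N"
  unfolding hbound_def by (meson subsetD)

lemma hgrow_subset: "hgrow T m \<Longrightarrow> S \<subseteq> T \<Longrightarrow> hgrow S m"
  unfolding hgrow_def by (meson hbound_subset)

lemma hbound_Un:
  fixes S T :: "('i::finite \<Rightarrow> mat4 set) set"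
  assumes "hbound S E d M" "hbound T E d N"
  shows "hbound (S \<union> T) E d (M + N)"
proof -
  obtain B1 where B1: "finite B1" "card B1 \<le> M"
    "\<And>f. pdeg entries E f \<Longrightarrow> mhom d f \<Longrightarrow> \<exists>b\<in>fn.span B1. \<forall>p\<in>S. f (rep p) = b p"
    using assms(1) unfolding hbound_def by auto
  obtain B2 where B2: "finite B2" "card B2 \<le> N"
    "\<And>f. pdeg entries E f \<Longrightarrow> mhom d f \<Longrightarrow> \<exists>b\<in>fn.span B2. \<forall>p\<in>T. f (rep p) = b p"
    using assms(2) unfolding hbound_def by auto
  \<comment> \<open>Spanning functions may be arbitrary, so they can be cut off by an indicator
    function; the overlap is attributed to \<open>S\<close>.\<close>
  define u where "u = (\<lambda>p. if p \<in> S then 1 else (0::complex))"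
  define B where "B = (\<lambda>b p. u p * b p) ` B1 \<union> (\<lambda>b p. (1 - u p) * b p) ` B2"
  show ?thesis unfolding hbound_def
  proof (intro exI[of _ B] conjI allI impI)
    show "finite B" using B1 B2 by (simp add: B_def)
    have "card B \<le> card ((\<lambda>b p. u p * b p) ` B1) + card ((\<lambda>b p. (1 - u p) * b p) ` B2)"
      unfolding B_def by (rule card_Un_le)
    also have "\<dots> \<le> card B1 + card B2" by (intro add_mono card_image_le B1 B2)
    also have "\<dots> \<le> M + N" by (intro add_mono B1 B2)
    finally show "card B \<le> M + N" .
    fix f :: "('i \<Rightarrow> mat4) \<Rightarrow> complex" assume f: "pdeg entries E f \<and> mhom d f"
    obtain b1 where b1: "b1 \<in> fn.span B1" "\<forall>p\<in>S. f (rep p) = b1 p" using B1(3)[of f] f by auto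
    obtain b2 where b2: "b2 \<in> fn.span B2" "\<forall>p\<in>T. f (rep p) = b2 p" using B2(3)[of f] f by auto
    have "(\<lambda>p. u p * b1 p) \<in> fn.span B"
      using fn_span_mult[OF b1(1), of u] fn.span_mono[of "(\<lambda>b p. u p * b p) ` B1" B]
      by (auto simp: B_def)
    moreover have "(\<lambda>p. (1 - u p) * b2 p) \<in> fn.span B"
      using fn_span_mult[OF b2(1), of "\<lambda>p. 1 - u p"] fn.span_mono[of "(\<lambda>b p. (1 - u p) * b p) ` B2" B]
      by (auto simp: B_def)
    ultimately have "(\<lambda>p. u p * b1 p + (1 - u p) * b2 p) \<in> fn.span B" by (rule fn_span_plus)
    moreover have "f (rep p) = u p * b1 p + (1 - u p) * b2 p" if "p \<in> S \<union> T" for p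
      using that b1 b2 by (auto simp: u_def)
    ultimately show "\<exists>b\<in>fn.span B. \<forall>p\<in>S \<union> T. f (rep p) = b p"
      by (intro bexI[of _ "\<lambda>p. u p * b1 p + (1 - u p) * b2 p"]) auto
  qed
qed

lemma hgrow_Un:
  assumes "hgrow S m" "hgrow T m"
  shows "hgrow (S \<union> T) m"
  unfolding hgrow_def
proof
  fix e
  obtain C1 where C1: "\<forall>D d. hbound S (e * D) d (C1 * (D + 1) ^ m)"
    using assms(1) unfolding hgrow_def by blast
  obtain C2 where C2: "\<forall>D d. hbound T (e * D) d (C2 * (D + 1) ^ m)"
    using assms(2) unfolding hgrow_def by blast
  show "\<exists>C. \<forall>D d. hbound (S \<union> T) (e * D) d (C * (D + 1) ^ m)"
    using hbound_Un[OF C1[rule_format] C2[rule_format]]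
    by (intro exI[of _ "C1 + C2"]) (auto simp: add_mult_distrib)
qed

lemma hgrow_empty: "hgrow {} m"
  unfolding hgrow_def hbound_def by (intro allI exI[of _ 0] exI[of _ "{}"]) (auto intro: fn.span_zero)

lemma hgrow_UN:
  assumes "finite I" "\<And>i. i \<in> I \<Longrightarrow> hgrow (T i) m"
  shows "hgrow (\<Union>i\<in>I. T i) m"
  using assms by (induction I rule: finite_induct) (auto intro: hgrow_empty hgrow_Un)

text \<open>The family \<open>\<phi>\<close> is only required to be polynomial in \<open>X\<close> on \<open>Y\<close>; multihomogeneity absorbs the
  scaling factors between \<open>\<phi> y\<close> and the chosen representatives.\<close>

lemma hgrow_family:
  fixes \<phi> :: "'y \<Rightarrow> 'i::finite \<Rightarrow> mat4"
  assumes "T \<subseteq> points" "growth Y X m"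
    and "\<And>i r s. \<exists>g. pdeg X c g \<and> (\<forall>y\<in>Y. \<phi> y i $ r $ s = g y)"
    and "\<And>p. p \<in> T \<Longrightarrow> \<exists>y\<in>Y. \<forall>i. \<phi> y i \<in> p i - {0}"
  shows "hgrow T m"
  unfolding hgrow_def
proof
  fix e
  obtain y where y: "\<And>p. p \<in> T \<Longrightarrow> y p \<in> Y" "\<And>p i. p \<in> T \<Longrightarrow> \<phi> (y p) i \<in> p i - {0}"
    using assms(4) by metis
  have "\<forall>p\<in>T. \<exists>k. rep p = (\<lambda>i. smul (k i) (\<phi> (y p) i))"
  proof
    fix p assume p: "p \<in> T"
    obtain k where "rep p = (\<lambda>i. smul (k i) (\<phi> (y p) i))"
      by (rule rep_scale_all[of p "\<phi> (y p)"]) (use p y(2) assms(1) in auto)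
    then show "\<exists>k. rep p = (\<lambda>i. smul (k i) (\<phi> (y p) i))" by (rule exI[of _ k])
  qed
  then obtain k where k: "\<And>p. p \<in> T \<Longrightarrow> rep p = (\<lambda>i. smul (k p i) (\<phi> (y p) i))" by metis
  obtain C where C: "\<And>D. \<exists>B. finite B \<and> card B \<le> C * (D + 1) ^ m \<and>
     (\<forall>f. pdeg X D f \<longrightarrow> (\<exists>b\<in>fn.span B. \<forall>y\<in>Y. f y = b y))"
    using assms(2) unfolding growth_def by blast
  show "\<exists>C. \<forall>D d. hbound T (e * D) d (C * (D + 1) ^ m)"
  proof (intro exI[of _ "C * (c * e + 1) ^ m"] allI)
    fix D d
    obtain B where B: "finite B" "card B \<le> C * (c * (e * D) + 1) ^ m"
      "\<And>f. pdeg X (c * (e * D)) f \<Longrightarrow> \<exists>b\<in>fn.span B. \<forall>y\<in>Y. f y = b y" using C by blast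
    \<comment> \<open>The factor by which a form of multidegree \<open>d\<close> changes from the
      parametrised matrices to the chosen representatives.\<close>
    define K where "K = (\<lambda>p. \<Prod>i\<in>UNIV. k p i ^ d i)"
    define B' where "B' = (\<lambda>b p. K p * b p) ` (\<lambda>b p. b (y p)) ` B"
    show "hbound T (e * D) d (C * (c * e + 1) ^ m * (D + 1) ^ m)" unfolding hbound_def
    proof (intro exI[of _ B'] conjI allI impI)
      show "finite B'" using B by (simp add: B'_def)
      have "card B' \<le> card B" unfolding B'_def using B(1) by (meson card_image_le finite_imageI le_trans)
      also have "\<dots> \<le> C * ((c * e + 1) * (D + 1)) ^ m"
        using B(2) by (rule order_trans) (intro mult_le_mono2 power_mono, auto)
      finally show "card B' \<le> C * (c * e + 1) ^ m * (D + 1) ^ m" by (simp only: power_mult_distrib mult.assoc)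
      fix f :: "('i \<Rightarrow> mat4) \<Rightarrow> complex" assume f: "pdeg entries (e * D) f \<and> mhom d f"
      have "\<exists>g. pdeg X (c * (e * D)) g \<and> (\<forall>y\<in>Y. f (\<phi> y) = g y)"
        by (rule pdeg_subst[of entries]) (use f assms(3) in \<open>auto simp: entries_def\<close>)
      then obtain g where g: "pdeg X (c * (e * D)) g" "\<forall>y\<in>Y. f (\<phi> y) = g y" by blast
      then obtain b where b: "b \<in> fn.span B" "\<forall>y\<in>Y. f (\<phi> y) = b y" using B(3)[OF g(1)] by auto
      have "(\<lambda>p. K p * b (y p)) \<in> fn.span B'"
        unfolding B'_def using fn_span_mult[OF fn_span_comp[OF b(1), of y], of K] by simp
      moreover have "f (rep p) = K p * b (y p)" if "p \<in> T" for p
      proof -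
        have "f (rep p) = K p * f (\<phi> (y p))" using f k[OF that] by (simp add: mhom_def K_def)
        then show ?thesis using b(2) y(1)[OF that] by simp
      qed
      ultimately show "\<exists>b\<in>fn.span B'. \<forall>p\<in>T. f (rep p) = b p"
        by (intro bexI[of _ "\<lambda>p. K p * b (y p)"]) auto
    qed
  qed
qed

text \<open>A monomial in the \<open>F k\<close>, homogenised by \<open>g\<close>: with exponents at
  most \<open>D\<close> it is filled up to exactly \<open>card K * D\<close> factors, so that all
  these monomials share one multidegree.\<close>

definition hmon :: "'k set \<Rightarrow> nat \<Rightarrow> ('k \<Rightarrow> ('i \<Rightarrow> mat4) \<Rightarrow> complex) \<Rightarrow> (('i \<Rightarrow> mat4) \<Rightarrow> complex) \<Rightarrow>
    ('k \<Rightarrow> nat) \<Rightarrow> ('i \<Rightarrow> mat4) \<Rightarrow> complex" where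
  "hmon K D F g \<alpha> A = (\<Prod>k\<in>K. F k A ^ \<alpha> k) * g A ^ (card K * D - sum \<alpha> K)"

lemma PiE_sum_le: "finite K \<Longrightarrow> \<alpha> \<in> PiE K (\<lambda>_. {..D}) \<Longrightarrow> sum \<alpha> K \<le> card K * D"
  using sum_bounded_above[of K \<alpha> D] by (auto simp: PiE_iff)

lemma mhom_hmon:
  assumes "finite K" "\<alpha> \<in> PiE K (\<lambda>_. {..D})" "\<And>k. k \<in> K \<Longrightarrow> mhom d (F k)" "mhom d g"
  shows "mhom (\<lambda>i. card K * D * d i) (hmon K D F g \<alpha>)"
proof -
  have "mhom (\<lambda>i. (\<Sum>k\<in>K. \<alpha> k * d i) + (card K * D - sum \<alpha> K) * d i) (hmon K D F g \<alpha>)"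
    unfolding hmon_def using assms by (intro mhom_mult mhom_prod mhom_power)
  moreover have "(\<Sum>k\<in>K. \<alpha> k * d i) + (card K * D - sum \<alpha> K) * d i = card K * D * d i" for i
    using PiE_sum_le[OF assms(1,2)]
    by (simp add: sum_distrib_right[symmetric] diff_mult_distrib mult_le_mono1)
  ultimately show ?thesis by simp
qed

text \<open>There are \<open>(D + 1) ^ card K\<close> monomials with exponents at most \<open>D\<close> in the forms \<open>F\<close>.\<close>

lemma hgrow_relation:
  assumes "hgrow T m" "finite K" "m < card K" "\<And>k. k \<in> K \<Longrightarrow> mhom d (F k)" "mhom d g"
  shows "\<exists>D c. (\<exists>\<alpha>\<in>PiE K (\<lambda>_. {..D}). c \<alpha> \<noteq> 0) \<and>
    (\<forall>p\<in>T. (\<Sum>\<alpha>\<in>PiE K (\<lambda>_. {..D}). c \<alpha> * hmon K D F g \<alpha> (rep p)) = 0)"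
proof -
  have "\<exists>e. pdeg entries e (F k)" if "k \<in> K" for k
    using poly_funs_pdeg[of "F k" entries] assms(4)[OF that] unfolding mhom_def by blast
  then obtain e where e: "\<And>k. k \<in> K \<Longrightarrow> pdeg entries (e k) (F k)" by metis
  obtain e' where e': "pdeg entries e' g" using poly_funs_pdeg[of g entries] assms(5) unfolding mhom_def by blast
  define N where "N = e' + sum e K"
  have N: "pdeg entries N (F k)" if "k \<in> K" for k
    using pdeg_mono[OF e[OF that], of N] member_le_sum[of k K e] assms(2) that by (simp add: N_def trans_le_add2)
  have N': "pdeg entries N g" using pdeg_mono[OF e', of N] by (simp add: N_def)
  obtain C where C: "\<forall>D d. hbound T ((N * card K) * D) d (C * (D + 1) ^ m)"
    using assms(1) unfolding hgrow_def by blast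
  \<comment> \<open>The exponent bound is the growth constant \<open>C\<close> itself, which makes C
    (C+1)^m smaller than (C+1)^(m+1), hence than the number of monomials.\<close>
  define E where "E = PiE K (\<lambda>_. {..C})"
  obtain B where B: "finite B" "card B \<le> C * (C + 1) ^ m"
     "\<And>f. pdeg entries ((N * card K) * C) f \<Longrightarrow> mhom (\<lambda>i. card K * C * d i) f \<Longrightarrow> (\<exists>b\<in>fn.span B. \<forall>p\<in>T. f (rep p) = b p)"
    using C[rule_format, of C "\<lambda>i. card K * C * d i"] unfolding hbound_def by auto
  have finE: "finite E" unfolding E_def using assms(2) by (intro finite_PiE) auto
  have "card B < card E"
  proof -
    have "card B \<le> C * (C + 1) ^ m" by (rule B)
    also have "\<dots> < (C + 1) ^ Suc m" by simp
    also have "\<dots> \<le> (C + 1) ^ card K" using assms(3) by (intro power_increasing) auto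
    also have "\<dots> = card E" unfolding E_def using assms(2) by (simp add: card_PiE)
    finally show ?thesis .
  qed
  have "\<exists>c. (\<exists>\<alpha>\<in>E. c \<alpha> \<noteq> 0) \<and> (\<forall>p\<in>T. (\<Sum>\<alpha>\<in>E. c \<alpha> * hmon K C F g \<alpha> (rep p)) = 0)"
  proof (rule fn_dependent_family[OF finE B(1) \<open>card B < card E\<close>])
    fix \<alpha> assume a: "\<alpha> \<in> E"
    have "mhom (\<lambda>i. card K * C * d i) (hmon K C F g \<alpha>)"
      by (rule mhom_hmon[OF assms(2)]) (use a assms(4,5) in \<open>simp_all add: E_def\<close>)
    moreover have "pdeg entries ((N * card K) * C) (hmon K C F g \<alpha>)"
    proof -
      have "pdeg entries ((\<Sum>k\<in>K. \<alpha> k * N) + (card K * C - sum \<alpha> K) * N) (hmon K C F g \<alpha>)"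
        unfolding hmon_def using N N' by (intro pdeg_mult pdeg_prod pdeg_power) auto
      moreover have "(\<Sum>k\<in>K. \<alpha> k * N) + (card K * C - sum \<alpha> K) * N = (N * card K) * C"
        using PiE_sum_le[OF assms(2), of \<alpha> C] a unfolding E_def
        by (simp add: sum_distrib_right[symmetric] diff_mult_distrib mult_le_mono1)
      ultimately show ?thesis by simp
    qed
    ultimately show "\<exists>b\<in>fn.span B. \<forall>p\<in>T. hmon K C F g \<alpha> (rep p) = b p" using B(3) by simp
  qed
  then show ?thesis unfolding E_def by blast
qed

lemma sum_PiE_insert:
  assumes "j \<notin> K"
  shows "(\<Sum>\<alpha>\<in>PiE (insert j K) (\<lambda>_. {..D::nat}). h \<alpha>) = (\<Sum>i\<le>D. \<Sum>\<alpha>\<in>PiE K (\<lambda>_. {..D}). (h (\<alpha>(j := i)) :: complex))"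
proof -
  have inj: "inj_on (\<lambda>(y, g). g(j := y)) ({..D} \<times> PiE K (\<lambda>_. {..D}))"
  proof (rule inj_onI, clarsimp)
    fix i \<alpha> i' \<alpha>' assume a: "\<alpha> \<in> PiE K (\<lambda>_. {..D})" "\<alpha>' \<in> PiE K (\<lambda>_. {..D})" "\<alpha>(j := i) = \<alpha>'(j := i')"
    have "\<alpha> x = \<alpha>' x" for x
      using a(1,2) assms fun_cong[OF a(3), of x] by (cases "x = j") (simp_all add: PiE_iff extensional_def)
    then show "i = i' \<and> \<alpha> = \<alpha>'" using fun_cong[OF a(3), of j] by auto
  qed
  show ?thesis
    unfolding PiE_insert_eq by (subst sum.reindex[OF inj]) (simp add: sum.cartesian_product case_prod_unfold)
qed

text \<open>For each step of the chain choose a form vanishing on the smaller set but not on the larger one.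
  The quotients of these forms by a form \<open>g\<close> not vanishing at a point of the smallest set are algebraically
  independent: in a relation, the terms of lowest degree in the last quotient restrict to a relation
  on the previous set of the chain.\<close>

lemma chain_bound:
  fixes Z :: "nat \<Rightarrow> ('i::finite \<Rightarrow> mat4 set) set"
  assumes T: "T \<subseteq> points" "hgrow T m" "T' \<subseteq> zariski closure_of T"
    and Z: "\<And>i. i \<le> n \<Longrightarrow> closedin (subtopology zariski T') (Z i)"
      "\<And>i. i \<le> n \<Longrightarrow> irreducible_space (subtopology (subtopology zariski T') (Z i))"
      "\<And>i. i < n \<Longrightarrow> Z i \<subset> Z (Suc i)"
  shows "n \<le> m"
proof (rule ccontr)
  assume "\<not> n \<le> m"
  then have mn: "m < n" by simp
  have T'p: "T' \<subseteq> points" using T(3) closure_of_subset_topspace[of zariski T] by auto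
  have ZT: "Z i \<subseteq> T'" if "i \<le> n" for i using closedin_subset[OF Z(1)[OF that]] by auto
  have irr: "\<And>f h. f \<in> multihom_polys \<Longrightarrow> h \<in> multihom_polys \<Longrightarrow> (\<forall>z\<in>Z i. f (rep z) * h (rep z) = 0) \<Longrightarrow>
       (\<forall>z\<in>Z i. f (rep z) = 0) \<or> (\<forall>z\<in>Z i. h (rep z) = 0)" and ne: "Z i \<noteq> {}" if "i \<le> n" for i
    using Z(2)[OF that] ZT[OF that] T'p irreducible_iff[of "Z i"]
    by (auto simp: subtopology_subtopology Int_absorb1)
  have mono: "Z i \<subseteq> Z j" if "i \<le> j" "j \<le> n" for i j
    using that by (induction j rule: dec_induct) (use Z(3) in \<open>auto simp: psubset_eq Suc_le_eq\<close>)
  obtain p0 where p0: "p0 \<in> Z 0" using ne[of 0] by auto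
  have p0Z: "p0 \<in> Z j" if "j \<le> n" for j using mono[of 0 j] that p0 by auto
  have p0p: "p0 \<in> points" using p0 ZT[of 0] T'p by auto
  have "\<forall>i. \<exists>r s. rep p0 i $ r $ s \<noteq> 0"
    using rep_in[of p0] p0p by (force simp: points_def vec_eq_iff)
  then obtain r s where rs: "\<And>i. rep p0 i $ r i $ s i \<noteq> 0" by metis
  \<comment> \<open>Coordinates that do not vanish at \<open>p0\<close>. Monomials in them raise the
    forms of the chain to a common multidegree \<open>d\<close> and supply the denominator
    \<open>g\<close>.\<close>
  define l :: "'i \<Rightarrow> ('i \<Rightarrow> mat4) \<Rightarrow> complex" where "l = (\<lambda>i A. A i $ r i $ s i)"
  have l: "mhom (\<lambda>j. if j = i then 1 else 0) (l i)" for i unfolding l_def by (rule mhom_entry)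
  have "\<exists>f. mhom (fst f) (snd f) \<and> (\<forall>z\<in>Z j. snd f (rep z) = 0) \<and> (\<exists>x\<in>Z (Suc j). snd f (rep x) \<noteq> 0)" if "j < n" for j
  proof -
    note jn = that
    obtain x where x: "x \<in> Z (Suc j)" "x \<notin> Z j" using Z(3)[OF jn] by auto
    then have "x \<in> T'" using ZT[of "Suc j"] jn by auto
    then obtain f where f: "f \<in> multihom_polys" "f (rep x) \<noteq> 0" "\<forall>z\<in>Z j. f (rep z) = 0"
      using closed_separation[OF T'p Z(1)[of j] _ x(2)] jn by auto
    then obtain d where "mhom d f" using multihom_polys_iff by blast
    then show ?thesis using f x by (intro exI[of _ "(d, f)"] conjI bexI[of _ x]) simp_all
  qed
  then obtain f where f: "\<And>j. j < n \<Longrightarrow> mhom (fst (f j)) (snd (f j))"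
    "\<And>j z. j < n \<Longrightarrow> z \<in> Z j \<Longrightarrow> snd (f j) (rep z) = 0"
    "\<And>j. j < n \<Longrightarrow> \<exists>x\<in>Z (Suc j). snd (f j) (rep x) \<noteq> 0" by metis
  define d where "d = (\<lambda>i. \<Sum>j<n. fst (f j) i)"
  have dle: "fst (f j) i \<le> d i" if "j < n" for i j unfolding d_def using that by (intro member_le_sum) auto
  define P where "P = (\<lambda>e A. \<Prod>i\<in>UNIV. l i A ^ e i)"
  have P: "mhom e (P e)" for e
  proof -
    have "mhom (\<lambda>j. \<Sum>i\<in>UNIV. e i * (if j = i then 1 else 0)) (P e)" unfolding P_def
      by (intro mhom_prod mhom_power l)
    moreover have "(\<Sum>i\<in>UNIV. e i * (if j = i then 1 else 0)) = e j" for j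
      by (simp add: if_distrib cong: if_cong)
    ultimately show ?thesis by simp
  qed
  define L where "L = (\<lambda>A. P (\<lambda>_. 1) A)"
  define g where "g = P d"
  define F where "F = (\<lambda>j A. snd (f j) A * P (\<lambda>i. d i - fst (f j) i) A)"
  have g: "mhom d g" unfolding g_def by (rule P)
  have F: "mhom d (F j)" if "j < n" for j
    using mhom_mult[OF f(1)[OF that] P[of "\<lambda>i. d i - fst (f j) i"]] dle[OF that] by (simp add: F_def)
  have P0: "P e (rep p0) \<noteq> 0" for e unfolding P_def l_def using rs by simp
  have PL: "P e (rep p) \<noteq> 0" if "L (rep p) \<noteq> 0" for e p using that unfolding L_def P_def by simp
  \<comment> \<open>On the irreducible set \<open>Z (Suc j)\<close> neither the separating form nor
    the product \<open>L\<close> of the coordinates vanishes identically, the latter because of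
    \<open>p0\<close>; so both are nonzero at some common point.\<close>
  have Fnz: "\<exists>x\<in>Z (Suc j). F j (rep x) \<noteq> 0 \<and> g (rep x) \<noteq> 0" if "j < n" for j
  proof (rule ccontr)
    assume "\<not> ?thesis"
    then have "\<forall>z\<in>Z (Suc j). snd (f j) (rep z) * L (rep z) = 0"
      using PL unfolding F_def g_def by auto
    moreover have "snd (f j) \<in> multihom_polys" "L \<in> multihom_polys"
      using f(1)[OF that] P unfolding L_def multihom_polys_iff by blast+
    ultimately show False using irr[of "Suc j" "snd (f j)" L] f(3)[OF that] that P0 p0Z[of "Suc j"]
      unfolding L_def by (auto simp: Suc_le_eq)
  qed
  have Fz: "F j (rep z) = 0" if "j < n" "z \<in> Z j" for j z using f(2)[OF that] by (simp add: F_def)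
  define u where "u = (\<lambda>j p. F j (rep p) / g (rep p))"
  \<comment> \<open>Regular functions on the chart where \<open>g\<close> is nonzero. They form a
    ring, and by \<open>reg_irr\<close> this ring has no zero divisors on an irreducible member of
    the chain.\<close>
  define reg where "reg = (\<lambda>h. \<exists>k h'. mhom (\<lambda>i. k * d i) h' \<and> (\<forall>p. g (rep p) \<noteq> 0 \<longrightarrow> h p = h' (rep p) / g (rep p) ^ k))"
  have reg_const: "reg (\<lambda>_. c)" for c
    unfolding reg_def using mhom_const[of c] by (intro exI[of _ 0] exI[of _ "\<lambda>_. c"]) auto
  have reg_u: "reg (u j)" if "j < n" for j
    unfolding reg_def u_def using F[OF that] by (intro exI[of _ 1] exI[of _ "F j"]) auto
  have reg_mult: "reg (\<lambda>p. h p * h' p)" if hh: "reg h" "reg h'" for h h'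
  proof -
    obtain k e where k: "mhom (\<lambda>i. k * d i) e" "\<And>p. g (rep p) \<noteq> 0 \<Longrightarrow> h p = e (rep p) / g (rep p) ^ k"
      using hh(1) unfolding reg_def by blast
    obtain k' e' where k': "mhom (\<lambda>i. k' * d i) e'" "\<And>p. g (rep p) \<noteq> 0 \<Longrightarrow> h' p = e' (rep p) / g (rep p) ^ k'"
      using hh(2) unfolding reg_def by blast
    show ?thesis unfolding reg_def using mhom_mult[OF k(1) k'(1)] k(2) k'(2)
      by (intro exI[of _ "k + k'"] exI[of _ "\<lambda>A. e A * e' A"]) (auto simp: algebra_simps power_add)
  qed
  have reg_add: "reg (\<lambda>p. h p + h' p)" if hh: "reg h" "reg h'" for h h'
  proof -
    obtain k e where k: "mhom (\<lambda>i. k * d i) e" "\<And>p. g (rep p) \<noteq> 0 \<Longrightarrow> h p = e (rep p) / g (rep p) ^ k"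
      using hh(1) unfolding reg_def by blast
    obtain k' e' where k': "mhom (\<lambda>i. k' * d i) e'" "\<And>p. g (rep p) \<noteq> 0 \<Longrightarrow> h' p = e' (rep p) / g (rep p) ^ k'"
      using hh(2) unfolding reg_def by blast
    have "mhom (\<lambda>i. (k + k') * d i) (\<lambda>A. e A * g A ^ k' + g A ^ k * e' A)"
      using mhom_mult[OF k(1) mhom_power[OF g, of k']] mhom_mult[OF mhom_power[OF g, of k] k'(1)]
      by (intro mhom_add) (simp_all add: add_mult_distrib)
    then show ?thesis unfolding reg_def using k(2) k'(2)
      by (intro exI[of _ "k + k'"] exI[of _ "\<lambda>A. e A * g A ^ k' + g A ^ k * e' A"])
        (auto simp: power_add add_divide_distrib)
  qed
  have reg_sum': "reg (\<lambda>p. \<Sum>x\<in>S. h x p)" if "\<And>x. x \<in> S \<Longrightarrow> reg (h x)" for S :: "(nat \<Rightarrow> nat) set" and h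
    using that by (induction S rule: infinite_finite_induct) (auto intro: reg_const reg_add)
  have reg_sumn: "reg (\<lambda>p. \<Sum>x\<in>S. h x p)" if "\<And>x. x \<in> S \<Longrightarrow> reg (h x)" for S :: "nat set" and h
    using that by (induction S rule: infinite_finite_induct) (auto intro: reg_const reg_add)
  have reg_power: "reg (\<lambda>p. h p ^ k)" if "reg h" for h k
    using that by (induction k) (auto intro: reg_const reg_mult)
  have reg_prod: "reg (\<lambda>p. \<Prod>x\<in>S. h x p)" if "\<And>x. x \<in> S \<Longrightarrow> reg (h x)" for S :: "nat set" and h
    using that by (induction S rule: infinite_finite_induct) (auto intro: reg_const reg_mult)
  have reg_irr: "(\<forall>z\<in>Z i. g (rep z) \<noteq> 0 \<longrightarrow> h z = 0) \<or> (\<forall>z\<in>Z i. g (rep z) \<noteq> 0 \<longrightarrow> h' z = 0)"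
    if hh: "i \<le> n" "reg h" "reg h'" "\<forall>z\<in>Z i. g (rep z) \<noteq> 0 \<longrightarrow> h z * h' z = 0" for i h h'
  proof -
    obtain k e where k: "mhom (\<lambda>i. k * d i) e" "\<And>p. g (rep p) \<noteq> 0 \<Longrightarrow> h p = e (rep p) / g (rep p) ^ k"
      using hh(2) unfolding reg_def by blast
    obtain k' e' where k': "mhom (\<lambda>i. k' * d i) e'" "\<And>p. g (rep p) \<noteq> 0 \<Longrightarrow> h' p = e' (rep p) / g (rep p) ^ k'"
      using hh(3) unfolding reg_def by blast
    have mh: "e \<in> multihom_polys" "(\<lambda>A. e' A * g A) \<in> multihom_polys" "e' \<in> multihom_polys" "g \<in> multihom_polys"
      using k k' g mhom_mult unfolding multihom_polys_iff by blast+
    have "\<forall>z\<in>Z i. e (rep z) * (e' (rep z) * g (rep z)) = 0"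
      using hh(4) k(2) k'(2) by fastforce
    then have "(\<forall>z\<in>Z i. e (rep z) = 0) \<or> (\<forall>z\<in>Z i. e' (rep z) * g (rep z) = 0)"
      using irr[OF hh(1) mh(1,2)] by blast
    then show ?thesis using k(2) k'(2) by auto
  qed
  define E where "E = (\<lambda>j D. PiE {..<j::nat} (\<lambda>_. {..D::nat}))"
  have indep: "\<forall>\<alpha>\<in>E j D. c \<alpha> = 0"
    if "j \<le> n" "\<forall>p\<in>Z j. g (rep p) \<noteq> 0 \<longrightarrow> (\<Sum>\<alpha>\<in>E j D. c \<alpha> * (\<Prod>i<j. u i p ^ \<alpha> i)) = 0" for j D c
    using that
  proof (induction j arbitrary: c)
    case 0
    then show ?case using p0 P0 by (auto simp: E_def g_def)
  next
    case (Suc j)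
    define S where "S = (\<lambda>k p. \<Sum>\<alpha>\<in>E j D. c (\<alpha>(j := k)) * (\<Prod>i<j. u i p ^ \<alpha> i))"
    have expand: "(\<Sum>\<alpha>\<in>E (Suc j) D. c \<alpha> * (\<Prod>i<Suc j. u i p ^ \<alpha> i)) = (\<Sum>k\<le>D. u j p ^ k * S k p)" for p
    proof -
      have "(\<Sum>\<alpha>\<in>E (Suc j) D. c \<alpha> * (\<Prod>i<Suc j. u i p ^ \<alpha> i)) =
        (\<Sum>k\<le>D. \<Sum>\<alpha>\<in>E j D. c (\<alpha>(j := k)) * (\<Prod>i<Suc j. u i p ^ (\<alpha>(j := k)) i))"
        unfolding E_def lessThan_Suc by (rule sum_PiE_insert) auto
      also have "\<dots> = (\<Sum>k\<le>D. u j p ^ k * S k p)"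
      proof (rule sum.cong[OF refl])
        fix k
        have "(\<Prod>i<j. u i p ^ (\<alpha>(j := k)) i) = (\<Prod>i<j. u i p ^ \<alpha> i)" for \<alpha>
          by (intro prod.cong) auto
        then show "(\<Sum>\<alpha>\<in>E j D. c (\<alpha>(j := k)) * (\<Prod>i<Suc j. u i p ^ (\<alpha>(j := k)) i)) = u j p ^ k * S k p"
          unfolding S_def by (simp add: sum_distrib_left algebra_simps)
      qed
      finally show ?thesis .
    qed
    have regS: "reg (S k)" for k unfolding S_def using Suc.prems(1)
      by (intro reg_sum' reg_mult reg_const reg_prod reg_power reg_u) auto
    have zero: "\<forall>\<alpha>\<in>E j D. c (\<alpha>(j := k)) = 0" if "k \<le> D" for k
      using that
    proof (induction k rule: less_induct)
      case (less k)
      have S0: "S i p = 0" if "i < k" for i p unfolding S_def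
        using less.IH[OF that order.trans[OF less_imp_le[OF that] less.prems]]
        by (intro sum.neutral ballI) (metis mult_zero_left)
      \<comment> \<open>The \<open>S i\<close> with i < k vanish already, so the relation is
        divisible by the k-th power of \<open>u j\<close>. Irreducibility of
        \<open>Z (Suc j)\<close>, where \<open>u j\<close> is not identically zero, cancels this
        power; on \<open>Z j\<close>, where \<open>u j\<close> vanishes, only \<open>S k\<close> is
        left.\<close>
      define R where "R = (\<lambda>p. \<Sum>i\<in>{k..D}. u j p ^ (i - k) * S i p)"
      have regR: "reg R" unfolding R_def using Suc.prems(1)
        by (intro reg_sumn reg_mult regS reg_power reg_u) auto
      have split: "(\<Sum>i\<le>D. u j p ^ i * S i p) = u j p ^ k * R p" for p
      proof -
        have "(\<Sum>i\<le>D. u j p ^ i * S i p) = (\<Sum>i\<in>{k..D}. u j p ^ i * S i p)"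
          by (rule sum.mono_neutral_right) (auto simp: S0)
        also have "\<dots> = (\<Sum>i\<in>{k..D}. u j p ^ k * (u j p ^ (i - k) * S i p))"
          by (intro sum.cong refl) (simp add: mult.assoc[symmetric] power_add[symmetric])
        finally show ?thesis by (simp add: R_def sum_distrib_left)
      qed
      have "\<forall>z\<in>Z (Suc j). g (rep z) \<noteq> 0 \<longrightarrow> u j z ^ k * R z = 0"
        using Suc.prems(2) unfolding expand split by blast
      then have "(\<forall>z\<in>Z (Suc j). g (rep z) \<noteq> 0 \<longrightarrow> u j z ^ k = 0) \<or> (\<forall>z\<in>Z (Suc j). g (rep z) \<noteq> 0 \<longrightarrow> R z = 0)"
        using reg_irr[OF Suc.prems(1) reg_power[OF reg_u] regR] Suc.prems(1) by auto
      moreover have "\<exists>z\<in>Z (Suc j). g (rep z) \<noteq> 0 \<and> u j z ^ k \<noteq> 0"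
        using Fnz[of j] Suc.prems(1) by (auto simp: u_def Suc_le_eq)
      ultimately have R0: "\<forall>z\<in>Z (Suc j). g (rep z) \<noteq> 0 \<longrightarrow> R z = 0" by blast
      have "\<forall>p\<in>Z j. g (rep p) \<noteq> 0 \<longrightarrow> S k p = 0"
      proof (intro ballI impI)
        fix p assume p: "p \<in> Z j" "g (rep p) \<noteq> 0"
        have "u j p = 0" using Fz[of j p] p Suc.prems(1) by (simp add: u_def)
        then have "R p = (\<Sum>i\<in>{k}. u j p ^ (i - k) * S i p)"
          unfolding R_def using less.prems by (intro sum.mono_neutral_right) auto
        moreover have "R p = 0" using R0 p mono[of j "Suc j"] Suc.prems(1) by auto
        ultimately show "S k p = 0" by simp
      qed
      then show ?case
        using Suc.IH[of "\<lambda>\<alpha>. c (\<alpha>(j := k))"] Suc_leD[OF Suc.prems(1)] unfolding S_def by blast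
    qed
    show ?case
    proof
      fix \<alpha> assume a: "\<alpha> \<in> E (Suc j) D"
      have "\<alpha>(j := undefined) \<in> E j D" using a by (auto simp: E_def PiE_iff extensional_def)
      moreover have "\<alpha> j \<le> D" using a by (auto simp: E_def PiE_iff)
      ultimately have "c ((\<alpha>(j := undefined))(j := \<alpha> j)) = 0" using zero by blast
      then show "c \<alpha> = 0" by simp
    qed
  qed
  obtain D c where c: "\<exists>\<alpha>\<in>E n D. c \<alpha> \<noteq> 0"
    "\<forall>p\<in>T. (\<Sum>\<alpha>\<in>E n D. c \<alpha> * hmon {..<n} D F g \<alpha> (rep p)) = 0"
    using hgrow_relation[OF T(2), of "{..<n}" d F g] mn F g unfolding E_def by auto
  \<comment> \<open>The relation is the vanishing of a single form, since all \<open>hmon\<close>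
    have the same multidegree; so it passes from \<open>T\<close> to its closure and hence to
    \<open>Z n\<close>.\<close>
  have "mhom (\<lambda>i. card {..<n} * D * d i) (\<lambda>A. \<Sum>\<alpha>\<in>E n D. c \<alpha> * hmon {..<n} D F g \<alpha> A)"
    using F g unfolding E_def by (intro mhom_sum mhom_cmult mhom_hmon) auto
  then have "(\<lambda>A. \<Sum>\<alpha>\<in>E n D. c \<alpha> * hmon {..<n} D F g \<alpha> A) \<in> multihom_polys"
    using multihom_polys_iff by blast
  note closure_vanish[OF T(1) this c(2)]
  then have 0: "(\<Sum>\<alpha>\<in>E n D. c \<alpha> * hmon {..<n} D F g \<alpha> (rep p)) = 0" if "p \<in> Z n" for p
    using that ZT[of n] T(3) by auto
  have "\<forall>p\<in>Z n. g (rep p) \<noteq> 0 \<longrightarrow> (\<Sum>\<alpha>\<in>E n D. c \<alpha> * (\<Prod>i<n. u i p ^ \<alpha> i)) = 0"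
  proof (intro ballI impI)
    fix p assume p: "p \<in> Z n" "g (rep p) \<noteq> 0"
    have "hmon {..<n} D F g \<alpha> (rep p) = g (rep p) ^ (n * D) * (\<Prod>i<n. u i p ^ \<alpha> i)" if "\<alpha> \<in> E n D" for \<alpha>
    proof -
      have le: "sum \<alpha> {..<n} \<le> n * D" using PiE_sum_le[of "{..<n}" \<alpha> D] that by (simp add: E_def)
      have "(\<Prod>i<n. u i p ^ \<alpha> i) = (\<Prod>i<n. F i (rep p) ^ \<alpha> i) / g (rep p) ^ sum \<alpha> {..<n}"
        by (simp add: u_def power_divide prod_dividef power_sum)
      then show ?thesis using p le by (simp add: hmon_def power_diff)
    qed
    then have "(\<Sum>\<alpha>\<in>E n D. c \<alpha> * hmon {..<n} D F g \<alpha> (rep p)) =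
       (\<Sum>\<alpha>\<in>E n D. g (rep p) ^ (n * D) * (c \<alpha> * (\<Prod>i<n. u i p ^ \<alpha> i)))"
      by (intro sum.cong) (auto simp: algebra_simps)
    also have "\<dots> = g (rep p) ^ (n * D) * (\<Sum>\<alpha>\<in>E n D. c \<alpha> * (\<Prod>i<n. u i p ^ \<alpha> i))"
      by (simp add: sum_distrib_left)
    finally show "(\<Sum>\<alpha>\<in>E n D. c \<alpha> * (\<Prod>i<n. u i p ^ \<alpha> i)) = 0" using 0[OF p(1)] p(2) by simp
  qed
  from indep[OF order_refl this] show False using c(1) by blast
qed

text \<open>Growth is known for sets swept out by parameters, while the sets to be removed later are
  their closures; hence the two sets \<open>T\<close> and \<open>T'\<close>.\<close>

lemma krull_dim_le:
  assumes "T \<subseteq> points" "hgrow T m" "T' \<subseteq> zariski closure_of T"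
  shows "krull_dim (subtopology zariski T') \<le> ereal (real m)"
  unfolding krull_dim_def
proof (rule Sup_least, clarify)
  fix n and Z :: "nat \<Rightarrow> ('a \<Rightarrow> mat4 set) set"
  assume "\<forall>i\<le>n. closedin (subtopology zariski T') (Z i) \<and> irreducible_space (subtopology (subtopology zariski T') (Z i))"
    "\<forall>i<n. Z i \<subset> Z (Suc i)"
  then have "n \<le> m" using chain_bound[OF assms, of n Z] by blast
  then show "ereal (real n) \<le> ereal (real m)" by simp
qed

section \<open>A lower bound for the dimension\<close>

definition coordfuns :: "'k set \<Rightarrow> (('k \<Rightarrow> complex) \<Rightarrow> complex) set" where
  "coordfuns K = (\<lambda>k y. y k) ` K"

lemma poly_funs_subst:
  assumes "f \<in> poly_funs X" "\<And>x. x \<in> X \<Longrightarrow> (\<lambda>y. x (u y)) \<in> poly_funs X'"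
  shows "(\<lambda>y. f (u y)) \<in> poly_funs X'"
  using assms(1) by induction (auto intro: poly_funs.intros assms(2))

text \<open>Restriction to a line reduces nonvanishing in many variables to finiteness of the roots
  of a polynomial in one variable.\<close>

lemma poly_funs_line:
  assumes "F \<in> poly_funs (coordfuns K)"
  shows "\<exists>p :: complex poly. \<forall>t. F (\<lambda>k. x k + t * (z k - x k)) = poly p t"
  using assms
proof induction
  case (coord f)
  then obtain k where "f = (\<lambda>y. y k)" by (auto simp: coordfuns_def)
  then show ?case by (intro exI[of _ "[:x k, z k - x k:]"]) simp
next
  case (const c)
  then show ?case by (intro exI[of _ "[:c:]"]) simp
next
  case (add f g)
  then obtain p q where "\<forall>t. f (\<lambda>k. x k + t * (z k - x k)) = poly p t" "\<forall>t. g (\<lambda>k. x k + t * (z k - x k)) = poly q t"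
    by blast
  then show ?case by (intro exI[of _ "p + q"]) simp
next
  case (mult f g)
  then obtain p q where "\<forall>t. f (\<lambda>k. x k + t * (z k - x k)) = poly p t" "\<forall>t. g (\<lambda>k. x k + t * (z k - x k)) = poly q t"
    by blast
  then show ?case by (intro exI[of _ "p * q"]) simp
qed

text \<open>If neither \<open>f\<close> nor \<open>g\<close> vanishes on the image, join a parameter
  where \<open>f\<close> is nonzero to one where \<open>g\<close> is. On this line \<open>f\<close>,
  \<open>g\<close> and \<open>w\<close> are nonzero polynomials, hence simultaneously nonzero
  somewhere.\<close>

lemma irreducible_image:
  fixes \<phi> :: "('k \<Rightarrow> complex) \<Rightarrow> 'i::finite \<Rightarrow> mat4"
  assumes phi: "\<And>i r s. (\<lambda>y. \<phi> y i $ r $ s) \<in> poly_funs (coordfuns K)"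
    and w: "w \<in> poly_funs (coordfuns K)"
    and pts: "\<And>y i. y \<in> L \<Longrightarrow> w y \<noteq> 0 \<Longrightarrow> \<phi> y i \<in> Sym4 - {0}"
    and L: "\<And>x z t. x \<in> L \<Longrightarrow> z \<in> L \<Longrightarrow> (\<lambda>k. x k + t * (z k - x k)) \<in> L"
    and ne: "\<exists>y\<in>L. w y \<noteq> 0"
  shows "irreducible_space (subtopology zariski ((\<lambda>y i. mat.span {\<phi> y i}) ` {y \<in> L. w y \<noteq> 0}))"
proof -
  let ?Z = "(\<lambda>y i. mat.span {\<phi> y i}) ` {y \<in> L. w y \<noteq> 0}"
  have Zp: "?Z \<subseteq> points" using pts by (auto simp: points_def)
  have rep0: "f (rep (\<lambda>i. mat.span {\<phi> y i})) = 0 \<longleftrightarrow> f (\<phi> y) = 0"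
    if f: "f \<in> multihom_polys" and y: "y \<in> L" "w y \<noteq> 0" for f y
  proof -
    obtain d where d: "mhom d f" using f multihom_polys_iff by blast
    have "(\<lambda>i. mat.span {\<phi> y i}) \<in> points" using Zp y by blast
    moreover have "\<phi> y i \<in> mat.span {\<phi> y i} - {0}" for i using pts[OF y] by (auto simp: mat.span_base)
    ultimately show ?thesis by (rule mhom_rep_zero[OF d])
  qed
  have comp: "(\<lambda>y. f (\<phi> y)) \<in> poly_funs (coordfuns K)" if "f \<in> multihom_polys" for f
    by (rule poly_funs_subst[of f entries]) (use that phi in \<open>auto simp: multihom_polys_def entries_def\<close>)
  show ?thesis unfolding irreducible_iff[OF Zp]
  proof (intro conjI ballI impI)
    show "?Z \<noteq> {}" using ne by auto
    fix f g :: "('i \<Rightarrow> mat4) \<Rightarrow> complex"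
    assume fg: "f \<in> multihom_polys" "g \<in> multihom_polys" "\<forall>z\<in>?Z. f (rep z) * g (rep z) = 0"
    show "(\<forall>z\<in>?Z. f (rep z) = 0) \<or> (\<forall>z\<in>?Z. g (rep z) = 0)"
    proof (rule ccontr)
      assume "\<not> ?thesis"
      then obtain x z where x: "x \<in> L" "w x \<noteq> 0" "f (\<phi> x) \<noteq> 0" and z: "z \<in> L" "w z \<noteq> 0" "g (\<phi> z) \<noteq> 0"
        using rep0[OF fg(1)] rep0[OF fg(2)] by auto
      define y where "y = (\<lambda>t k. x k + t * (z k - x k))"
      obtain pf where pf: "\<And>t. f (\<phi> (y t)) = poly pf t"
        using poly_funs_line[OF comp[OF fg(1)], of x z] unfolding y_def by blast
      obtain pg where pg: "\<And>t. g (\<phi> (y t)) = poly pg t"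
        using poly_funs_line[OF comp[OF fg(2)], of x z] unfolding y_def by blast
      obtain pw where pw: "\<And>t. w (y t) = poly pw t"
        using poly_funs_line[OF w, of x z] unfolding y_def by blast
      have "y 0 = x" "y 1 = z" by (auto simp: y_def)
      then have "poly pf 0 \<noteq> 0" "poly pg 1 \<noteq> 0" "poly pw 0 \<noteq> 0"
        using pf[of 0] pg[of 1] pw[of 0] x z by auto
      then have "pf * pg * pw \<noteq> 0" by auto
      then have "finite {t. poly (pf * pg * pw) t = 0}" by (rule poly_roots_finite)
      then have "\<exists>t. t \<notin> {t. poly (pf * pg * pw) t = 0}" by (rule ex_new_if_finite[OF infinite_UNIV_char_0])
      then obtain t where t: "poly (pf * pg * pw) t \<noteq> 0" by auto
      have yL: "y t \<in> L" using L x z by (simp add: y_def)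
      moreover have wy: "w (y t) \<noteq> 0" using t pw by auto
      ultimately have "f (rep (\<lambda>i. mat.span {\<phi> (y t) i})) * g (rep (\<lambda>i. mat.span {\<phi> (y t) i})) = 0" using fg(3) by auto
      then have "f (\<phi> (y t)) * g (\<phi> (y t)) = 0" using rep0[OF fg(1) yL wy] rep0[OF fg(2) yL wy] by auto
      then show False using t pf pg by auto
    qed
  qed
qed

lemma irreducible_closure:
  assumes "Z \<subseteq> T" "T \<subseteq> points" "irreducible_space (subtopology zariski Z)"
  shows "irreducible_space (subtopology zariski (T \<inter> zariski closure_of Z))"
proof -
  have Zp: "Z \<subseteq> points" using assms by auto
  have Z: "Z \<subseteq> T \<inter> zariski closure_of Z" using assms(1) closure_of_subset[of Z zariski] Zp by auto
  have sub: "T \<inter> zariski closure_of Z \<subseteq> points" using assms by auto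
  show ?thesis unfolding irreducible_iff[OF sub]
  proof (intro conjI ballI impI)
    show "T \<inter> zariski closure_of Z \<noteq> {}" using Z assms(3) irreducible_iff[OF Zp] by blast
    fix f g :: "('a \<Rightarrow> mat4) \<Rightarrow> complex"
    assume fg: "f \<in> multihom_polys" "g \<in> multihom_polys"
      "\<forall>z\<in>T \<inter> zariski closure_of Z. f (rep z) * g (rep z) = 0"
    have "\<forall>z\<in>Z. f (rep z) * g (rep z) = 0" using fg(3) Z by auto
    then have "(\<forall>z\<in>Z. f (rep z) = 0) \<or> (\<forall>z\<in>Z. g (rep z) = 0)"
      using assms(3)[unfolded irreducible_iff[OF Zp]] fg(1,2) by auto
    then show "(\<forall>z\<in>T \<inter> zariski closure_of Z. f (rep z) = 0) \<or> (\<forall>z\<in>T \<inter> zariski closure_of Z. g (rep z) = 0)"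
      using closure_vanish[OF Zp fg(1)] closure_vanish[OF Zp fg(2)] by auto
  qed
qed

section \<open>Independent linear parts and flags of coordinate subspaces\<close>

lemma monomials_independent:
  assumes "finite K" "\<And>y :: 'k \<Rightarrow> complex. (\<Sum>\<alpha>\<in>PiE K (\<lambda>_. {..D}). c \<alpha> * (\<Prod>k\<in>K. y k ^ \<alpha> k)) = 0"
  shows "\<forall>\<alpha>\<in>PiE K (\<lambda>_. {..D}). c \<alpha> = (0::complex)"
  using assms
proof (induction K arbitrary: c rule: finite_induct)
  case (insert j K)
  let ?S = "\<lambda>i y. \<Sum>\<alpha>\<in>PiE K (\<lambda>_. {..D}). c (\<alpha>(j := i)) * (\<Prod>k\<in>K. y k ^ \<alpha> k)"
  have "?S i y = 0" if "i \<le> D" for i and y :: "'k \<Rightarrow> complex"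
  proof -
    have "(\<Sum>i\<le>D. ?S i y * t ^ i) = 0" for t
    proof -
      have "0 = (\<Sum>\<alpha>\<in>PiE (insert j K) (\<lambda>_. {..D}). c \<alpha> * (\<Prod>k\<in>insert j K. (y(j := t)) k ^ \<alpha> k))"
        using insert.prems[of "y(j := t)"] by simp
      also have "\<dots> = (\<Sum>i\<le>D. \<Sum>\<alpha>\<in>PiE K (\<lambda>_. {..D}). c (\<alpha>(j := i)) * (\<Prod>k\<in>insert j K. (y(j := t)) k ^ (\<alpha>(j := i)) k))"
        by (rule sum_PiE_insert[OF insert.hyps(2)])
      also have "\<dots> = (\<Sum>i\<le>D. ?S i y * t ^ i)"
      proof (rule sum.cong[OF refl])
        fix i
        have "(\<Prod>k\<in>K. (y(j := t)) k ^ (\<alpha>(j := i)) k) = (\<Prod>k\<in>K. y k ^ \<alpha> k)" for \<alpha>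
          using insert.hyps by (intro prod.cong) auto
        then show "(\<Sum>\<alpha>\<in>PiE K (\<lambda>_. {..D}). c (\<alpha>(j := i)) * (\<Prod>k\<in>insert j K. (y(j := t)) k ^ (\<alpha>(j := i)) k)) = ?S i y * t ^ i"
          using insert.hyps by (simp add: sum_distrib_right sum_distrib_left algebra_simps)
      qed
      finally show ?thesis by simp
    qed
    then show ?thesis using Transcendental.polyfun_eq_0[of "\<lambda>i. ?S i y" D] that by blast
  qed
  then have *: "\<forall>\<alpha>\<in>PiE K (\<lambda>_. {..D}). c (\<alpha>(j := i)) = 0" if "i \<le> D" for i
    using insert.IH[of "\<lambda>\<alpha>. c (\<alpha>(j := i))"] that by blast
  show ?case
  proof
    fix \<alpha> assume a: "\<alpha> \<in> PiE (insert j K) (\<lambda>_. {..D})"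
    have "\<alpha>(j := undefined) \<in> PiE K (\<lambda>_. {..D})" using a insert.hyps by (auto simp: PiE_iff extensional_def)
    moreover have "\<alpha> j \<le> D" using a by (auto simp: PiE_iff)
    ultimately have "c ((\<alpha>(j := undefined))(j := \<alpha> j)) = 0" using * by blast
    then show "c \<alpha> = 0" by simp
  qed
qed auto

text \<open>Forms whose pullbacks have the coordinates as linear parts satisfy no relation: the terms of
  lowest degree of a relation would give a relation between monomials.\<close>

lemma relation_trivial:
  fixes a :: "'k \<Rightarrow> ('k \<Rightarrow> complex) \<Rightarrow> complex"
  assumes K: "finite K"
    and a0: "\<And>k. k \<in> K \<Longrightarrow> a k (\<lambda>_. 0) = 0"
    and deriv: "\<And>k y. k \<in> K \<Longrightarrow> ((\<lambda>t. a k (\<lambda>j. t * y j)) has_field_derivative y k) (at 0)"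
    and g: "\<And>y. ((\<lambda>t. g (\<lambda>j. t * y j)) \<longlongrightarrow> g0) (at 0)" "g0 \<noteq> 0"
    and w: "\<And>y. ((\<lambda>t. w (\<lambda>j. t * y j)) \<longlongrightarrow> w0) (at 0)" "w0 \<noteq> (0::complex)"
    and rel: "\<And>y. (\<And>k. k \<notin> K \<Longrightarrow> y k = 0) \<Longrightarrow> w y \<noteq> 0 \<Longrightarrow>
       (\<Sum>\<alpha>\<in>PiE K (\<lambda>_. {..D}). c \<alpha> * ((\<Prod>k\<in>K. a k y ^ \<alpha> k) * g y ^ (card K * D - sum \<alpha> K))) = 0"
  shows "\<forall>\<alpha>\<in>PiE K (\<lambda>_. {..D}). c \<alpha> = 0"
proof (rule ccontr)
  define E where "E = PiE K (\<lambda>_. {..D})"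
  assume "\<not> ?thesis"
  then obtain \<beta> where \<beta>: "\<beta> \<in> E" "c \<beta> \<noteq> 0" unfolding E_def by blast
  define Q where "Q = (\<lambda>q. \<exists>\<alpha>\<in>E. c \<alpha> \<noteq> 0 \<and> sum \<alpha> K = q)"
  define q where "q = (LEAST q. Q q)"
  have "Q (sum \<beta> K)" unfolding Q_def using \<beta> by blast
  then have Qq: "Q q" unfolding q_def by (rule LeastI)
  have q_min: "q \<le> sum \<alpha> K" if "\<alpha> \<in> E" "c \<alpha> \<noteq> 0" for \<alpha>
    unfolding q_def by (rule Least_le) (use that in \<open>auto simp: Q_def\<close>)
  define N where "N = card K * D"
  define e where "e = (\<lambda>\<alpha>. if sum \<alpha> K = q then c \<alpha> else 0)"
  have lim0: "(\<Sum>\<alpha>\<in>E. e \<alpha> * (\<Prod>k\<in>K. y k ^ \<alpha> k)) = 0" if y: "\<And>k. k \<notin> K \<Longrightarrow> y k = 0" for y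
  proof -
    define A where "A = (\<lambda>k t. a k (\<lambda>j. t * y j) / t)"
    have A: "(A k \<longlongrightarrow> y k) (at 0)" if "k \<in> K" for k
      using deriv[OF that, of y] a0[OF that] by (simp add: has_field_derivative_iff A_def)
    \<comment> \<open>The relation along the ray t y, divided by t^q, where q is the least total
      degree that occurs; as t tends to 0 only the terms of degree q survive. Terms with zero
      coefficient are set to 0, because there the truncated difference
      \<open>sum \<alpha> K - q\<close> may be wrong.\<close>
    define h where "h = (\<lambda>t. \<Sum>\<alpha>\<in>E. if c \<alpha> = 0 then 0 else
      c \<alpha> * ((\<Prod>k\<in>K. A k t ^ \<alpha> k) * t ^ (sum \<alpha> K - q) * g (\<lambda>j. t * y j) ^ (N - sum \<alpha> K)))"
    have "(h \<longlongrightarrow> (\<Sum>\<alpha>\<in>E. if c \<alpha> = 0 then 0 else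
       c \<alpha> * ((\<Prod>k\<in>K. y k ^ \<alpha> k) * 0 ^ (sum \<alpha> K - q) * g0 ^ (N - sum \<alpha> K)))) (at 0)"
      unfolding h_def
      by (intro tendsto_sum tendsto_eq_intros if_cong) (auto intro!: tendsto_intros A g)
    moreover have "(\<Sum>\<alpha>\<in>E. if c \<alpha> = 0 then 0 else
       c \<alpha> * ((\<Prod>k\<in>K. y k ^ \<alpha> k) * 0 ^ (sum \<alpha> K - q) * g0 ^ (N - sum \<alpha> K))) =
       (\<Sum>\<alpha>\<in>E. g0 ^ (N - q) * (e \<alpha> * (\<Prod>k\<in>K. y k ^ \<alpha> k)))"
    proof (rule sum.cong[OF refl])
      fix \<alpha> assume "\<alpha> \<in> E"
      then show "(if c \<alpha> = 0 then 0 else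
         c \<alpha> * ((\<Prod>k\<in>K. y k ^ \<alpha> k) * 0 ^ (sum \<alpha> K - q) * g0 ^ (N - sum \<alpha> K))) =
         g0 ^ (N - q) * (e \<alpha> * (\<Prod>k\<in>K. y k ^ \<alpha> k))"
        using q_min[of \<alpha>] by (auto simp: e_def power_0_left)
    qed
    moreover have "\<forall>\<^sub>F t in at 0. h t = 0"
    proof -
      have "\<forall>\<^sub>F t in at 0. w (\<lambda>j. t * y j) \<noteq> 0" using w(1)[of y] w(2) by (rule tendsto_imp_eventually_ne)
      moreover have "\<forall>\<^sub>F t in at 0. t \<noteq> (0::complex)" by (rule eventually_neq_at_within)
      ultimately show ?thesis
      proof eventually_elim
        case (elim t)
        have "0 = (\<Sum>\<alpha>\<in>E. c \<alpha> * ((\<Prod>k\<in>K. a k (\<lambda>j. t * y j) ^ \<alpha> k) * g (\<lambda>j. t * y j) ^ (N - sum \<alpha> K)))"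
          using rel[of "\<lambda>j. t * y j"] y elim by (simp add: E_def N_def)
        also have "\<dots> = (\<Sum>\<alpha>\<in>E. t ^ q * (if c \<alpha> = 0 then 0 else
          c \<alpha> * ((\<Prod>k\<in>K. A k t ^ \<alpha> k) * t ^ (sum \<alpha> K - q) * g (\<lambda>j. t * y j) ^ (N - sum \<alpha> K))))"
        proof (rule sum.cong[OF refl])
          fix \<alpha> assume \<alpha>: "\<alpha> \<in> E"
          show "c \<alpha> * ((\<Prod>k\<in>K. a k (\<lambda>j. t * y j) ^ \<alpha> k) * g (\<lambda>j. t * y j) ^ (N - sum \<alpha> K)) =
            t ^ q * (if c \<alpha> = 0 then 0 else
            c \<alpha> * ((\<Prod>k\<in>K. A k t ^ \<alpha> k) * t ^ (sum \<alpha> K - q) * g (\<lambda>j. t * y j) ^ (N - sum \<alpha> K)))"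
          proof (cases "c \<alpha> = 0")
            case False
            have "(\<Prod>k\<in>K. a k (\<lambda>j. t * y j) ^ \<alpha> k) = (\<Prod>k\<in>K. A k t ^ \<alpha> k * t ^ \<alpha> k)"
              using elim by (intro prod.cong) (auto simp: A_def power_divide)
            also have "\<dots> = (\<Prod>k\<in>K. A k t ^ \<alpha> k) * t ^ sum \<alpha> K"
              by (simp add: prod.distrib power_sum)
            also have "t ^ sum \<alpha> K = t ^ q * t ^ (sum \<alpha> K - q)"
              using q_min[OF \<alpha> False] by (simp add: power_add[symmetric])
            finally show ?thesis using False by simp
          qed simp
        qed
        also have "\<dots> = t ^ q * h t" by (simp add: h_def sum_distrib_left)
        finally show ?case using elim by simp
      qed
    qed
    ultimately have "(\<Sum>\<alpha>\<in>E. g0 ^ (N - q) * (e \<alpha> * (\<Prod>k\<in>K. y k ^ \<alpha> k))) = 0"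
      using tendsto_eventually[of h 0 "at 0"] tendsto_unique[of "at (0::complex)" h] by simp
    then show ?thesis using g(2) by (simp add: sum_distrib_left[symmetric])
  qed
  have "\<forall>\<alpha>\<in>PiE K (\<lambda>_. {..D}). e \<alpha> = 0"
  proof (rule monomials_independent[OF K])
    fix y :: "'k \<Rightarrow> complex"
    have "(\<Sum>\<alpha>\<in>E. e \<alpha> * (\<Prod>k\<in>K. y k ^ \<alpha> k)) = (\<Sum>\<alpha>\<in>E. e \<alpha> * (\<Prod>k\<in>K. (if k \<in> K then y k else 0) ^ \<alpha> k))"
      by simp
    also have "\<dots> = 0" by (rule lim0) simp
    finally show "(\<Sum>\<alpha>\<in>PiE K (\<lambda>_. {..D}). e \<alpha> * (\<Prod>k\<in>K. y k ^ \<alpha> k)) = 0" by (simp add: E_def)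
  qed
  then show False using Qq unfolding Q_def e_def E_def by auto
qed

lemma poly_funs_pdeg_uniform:
  fixes \<phi> :: "'y \<Rightarrow> 'i::finite \<Rightarrow> mat4"
  assumes "\<And>i r s. (\<lambda>y. \<phi> y i $ r $ s) \<in> poly_funs X"
  shows "\<exists>D. \<forall>i r s. pdeg X D (\<lambda>y. \<phi> y i $ r $ s)"
proof -
  have "\<forall>x. \<exists>D. pdeg X D (\<lambda>y. \<phi> y (fst x) $ (fst (snd x)) $ (snd (snd x)))"
    using poly_funs_pdeg[OF assms] by blast
  then obtain D where D: "\<And>x. pdeg X (D x) (\<lambda>y. \<phi> y (fst x) $ (fst (snd x)) $ (snd (snd x)))" by metis
  have "pdeg X (sum D UNIV) (\<lambda>y. \<phi> y i $ r $ s)" for i r s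
    using pdeg_mono[OF D[of "(i, r, s)"], of "sum D UNIV"] member_le_sum[of "(i, r, s)" UNIV D] by simp
  then show ?thesis by blast
qed

text \<open>\<open>F\<close> and \<open>g\<close> are affine coordinates of the target in
  homogeneous form. That their pullbacks along rays have derivative \<open>y k\<close> at the origin
  expresses that \<open>\<phi>\<close> is an immersion there.\<close>

lemma krull_dim_ge:
  fixes \<phi> :: "('k \<Rightarrow> complex) \<Rightarrow> 'i::finite \<Rightarrow> mat4"
  assumes K: "finite K" and T: "T \<subseteq> points"
    and phi: "\<And>i r s. (\<lambda>y. \<phi> y i $ r $ s) \<in> poly_funs (coordfuns K)"
    and w: "w \<in> poly_funs (coordfuns K)" "w (\<lambda>_. 0) \<noteq> 0"
    and wT: "\<And>y i. w y \<noteq> 0 \<Longrightarrow> \<phi> y i \<in> Sym4 - {0}" "\<And>y. w y \<noteq> 0 \<Longrightarrow> (\<lambda>i. mat.span {\<phi> y i}) \<in> T"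
    and F: "\<And>k. k \<in> K \<Longrightarrow> mhom d (F k)" "\<And>k. k \<in> K \<Longrightarrow> F k (\<phi> (\<lambda>_. 0)) = 0"
      "\<And>k y. k \<in> K \<Longrightarrow> ((\<lambda>t. F k (\<phi> (\<lambda>j. t * y j))) has_field_derivative y k) (at 0)"
    and g: "mhom d g" "g (\<phi> (\<lambda>_. 0)) \<noteq> 0"
  shows "ereal (real (card K)) \<le> krull_dim (subtopology zariski T)"
proof -
  define n where "n = card K"
  obtain e where e: "bij_betw e {..<n} K" using ex_bij_betw_nat_finite[OF K] by (auto simp: n_def atLeast0LessThan)
  define J where "J = (\<lambda>j. e ` {..<j})"
  have J: "finite (J j)" "J j \<subseteq> K" "card (J j) = j" if "j \<le> n" for j
  proof -
    have "inj_on e {..<j}" using e that by (auto simp: bij_betw_def intro: inj_on_subset)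
    then show "card (J j) = j" by (simp add: J_def card_image)
    show "finite (J j)" by (simp add: J_def)
    show "J j \<subseteq> K" using e that unfolding J_def bij_betw_def by auto
  qed
  define L where "L = (\<lambda>j. {y :: 'k \<Rightarrow> complex. \<forall>k. k \<notin> J j \<longrightarrow> y k = 0})"
  define \<Phi> where "\<Phi> = (\<lambda>y i. mat.span {\<phi> y i})"
  define S where "S = (\<lambda>j. \<Phi> ` {y \<in> L j. w y \<noteq> 0})"
  define Z where "Z = (\<lambda>j. T \<inter> zariski closure_of S j)"
  have ST: "S j \<subseteq> T" for j using wT(2) by (auto simp: S_def \<Phi>_def)
  have Sp: "S j \<subseteq> points" for j using ST T by blast
  have irrS: "irreducible_space (subtopology zariski (S j))" for j
    unfolding S_def \<Phi>_def
  proof (rule irreducible_image[OF phi w(1)])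
    show "\<exists>y\<in>L j. w y \<noteq> 0" using w(2) by (auto simp: L_def intro!: bexI[of _ "\<lambda>_. 0"])
  qed (use wT(1) in \<open>auto simp: L_def\<close>)
  have Zp: "Z j \<subseteq> T" for j by (auto simp: Z_def)
  have irrZ: "irreducible_space (subtopology (subtopology zariski T) (Z j))" for j
    using irreducible_closure[OF ST T irrS, of j] by (simp add: subtopology_subtopology Z_def Int_absorb1)
  have closedZ: "closedin (subtopology zariski T) (Z j)" for j
    unfolding Z_def closedin_subtopology by (intro exI[of _ "zariski closure_of S j"]) auto
  have mono: "Z j \<subseteq> Z (Suc j)" for j
    unfolding Z_def S_def L_def J_def by (intro Int_mono closure_of_mono image_mono) (auto simp: lessThan_Suc)
  have comp: "(\<lambda>y. f (\<phi> y)) \<in> poly_funs (coordfuns K)" if "f \<in> poly_funs entries" for f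
    by (rule poly_funs_subst[of f entries]) (use that phi in \<open>auto simp: entries_def\<close>)
  have lim: "((\<lambda>t. f (\<lambda>j. t * y j)) \<longlongrightarrow> f (\<lambda>_. 0)) (at 0)" if f: "f \<in> poly_funs (coordfuns K)" for f y
  proof -
    obtain p where p: "\<And>t. f (\<lambda>k. t * y k) = poly p t"
      using poly_funs_line[OF f, of "\<lambda>_. 0" y] by auto
    have "(poly p \<longlongrightarrow> poly p 0) (at 0)" by (intro tendsto_intros)
    then show ?thesis using p p[of 0] by simp
  qed
  \<comment> \<open>\<open>S j\<close> depends on \<open>j\<close> parameters, so
    \<open>j + 1\<close> of the forms satisfy a relation on it. If the closures agreed, the relation
    would persist on \<open>S (Suc j)\<close>, where these forms have independent linear
    parts.\<close>
  have strict: "Z j \<noteq> Z (Suc j)" if j: "j < n" for j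
  proof
    assume eq: "Z j = Z (Suc j)"
    obtain D0 where D0: "\<And>i r s. pdeg (coordfuns K) D0 (\<lambda>y. \<phi> y i $ r $ s)"
      using poly_funs_pdeg_uniform[of \<phi>, OF phi] by auto
    have grow: "hgrow (S j) j"
    proof (rule hgrow_family[OF Sp, where \<phi> = \<phi> and Y = "{y \<in> L j. w y \<noteq> 0}" and X = "coordfuns (J j)" and c = "1 * D0"])
      have "card (coordfuns (J j)) \<le> j"
        using card_image_le[OF J(1), of j] J(3)[of j] j by (simp add: coordfuns_def)
      then show "growth {y \<in> L j. w y \<noteq> 0} (coordfuns (J j)) j"
        using J(1)[of j] j by (intro growth_card) (auto simp: coordfuns_def)
      show "\<exists>g. pdeg (coordfuns (J j)) (1 * D0) g \<and> (\<forall>y\<in>{y \<in> L j. w y \<noteq> 0}. \<phi> y i $ r $ s = g y)" for i r s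
      proof (rule pdeg_subst[OF _ D0])
        fix f assume "f \<in> coordfuns K"
        then obtain k where k: "f = (\<lambda>y. y k)" by (auto simp: coordfuns_def)
        show "\<exists>g. pdeg (coordfuns (J j)) 1 g \<and> (\<forall>y\<in>{y \<in> L j. w y \<noteq> 0}. f y = g y)"
        proof (cases "k \<in> J j")
          case True
          then have "pdeg (coordfuns (J j)) 1 f" using pdeg_coord[of f] k by (auto simp: coordfuns_def)
          then show ?thesis by blast
        next
          case False
          then have "\<forall>y\<in>L j. f y = 0" using k by (auto simp: L_def)
          then show ?thesis using pdeg.const[of _ 1 0] by (intro exI[of _ "\<lambda>_. 0"]) auto
        qed
      qed
      fix p assume "p \<in> S j"
      then obtain y where "y \<in> L j" "w y \<noteq> 0" "p = \<Phi> y" by (auto simp: S_def)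
      then show "\<exists>y\<in>{y \<in> L j. w y \<noteq> 0}. \<forall>i. \<phi> y i \<in> p i - {0}"
        using wT(1) by (intro bexI[of _ y]) (auto simp: \<Phi>_def mat.span_base)
    qed
    let ?K = "J (Suc j)"
    have JS: "finite ?K" "?K \<subseteq> K" "card ?K = Suc j" using J[of "Suc j"] j by auto
    have FK: "mhom d (F k)" if "k \<in> ?K" for k using F(1) JS that by auto
    obtain D c where c: "\<exists>\<alpha>\<in>PiE ?K (\<lambda>_. {..D}). c \<alpha> \<noteq> 0"
      "\<forall>p\<in>S j. (\<Sum>\<alpha>\<in>PiE ?K (\<lambda>_. {..D}). c \<alpha> * hmon ?K D F g \<alpha> (rep p)) = 0"
      using hgrow_relation[of "S j" j ?K d F g, OF grow JS(1) _ FK g(1)] JS(3) by auto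
    define R where "R = (\<lambda>A. \<Sum>\<alpha>\<in>PiE ?K (\<lambda>_. {..D}). c \<alpha> * hmon ?K D F g \<alpha> A)"
    have R: "mhom (\<lambda>i. card ?K * D * d i) R"
      using FK g(1) JS unfolding R_def by (intro mhom_sum mhom_cmult mhom_hmon) auto
    then have Rm: "R \<in> multihom_polys" using multihom_polys_iff by blast
    have R0: "R (rep p) = 0" if "p \<in> S (Suc j)" for p
    proof (rule closure_vanish[OF Sp Rm])
      show "\<forall>s\<in>S j. R (rep s) = 0" using c(2) by (simp add: R_def)
      show "p \<in> zariski closure_of S j"
        using that eq closure_of_subset[of "S (Suc j)" zariski] Sp ST[of "Suc j"] unfolding Z_def by auto
    qed
    have "\<forall>\<alpha>\<in>PiE ?K (\<lambda>_. {..D}). c \<alpha> = 0"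
    proof (rule relation_trivial[where a = "\<lambda>k y. F k (\<phi> y)" and g = "\<lambda>y. g (\<phi> y)" and w = w
          and ?g0.0 = "g (\<phi> (\<lambda>_. 0))" and ?w0.0 = "w (\<lambda>_. 0)"])
      show "((\<lambda>t. g (\<phi> (\<lambda>j. t * y j))) \<longlongrightarrow> g (\<phi> (\<lambda>_. 0))) (at 0)" for y
        using lim[OF comp, of g y] g(1) by (simp add: mhom_def)
      show "((\<lambda>t. w (\<lambda>j. t * y j)) \<longlongrightarrow> w (\<lambda>_. 0)) (at 0)" for y by (rule lim[OF w(1)])
      fix y :: "'k \<Rightarrow> complex" assume y: "\<And>k. k \<notin> ?K \<Longrightarrow> y k = 0" "w y \<noteq> 0"
      then have "\<Phi> y \<in> S (Suc j)" by (auto simp: S_def L_def)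
      then have "R (rep (\<Phi> y)) = 0" "\<Phi> y \<in> points" using R0 Sp by auto
      moreover have "\<phi> y i \<in> \<Phi> y i - {0}" for i using wT(1)[OF y(2)] by (auto simp: \<Phi>_def mat.span_base)
      ultimately have "R (\<phi> y) = 0" using mhom_rep_zero[OF R] by blast
      then show "(\<Sum>\<alpha>\<in>PiE ?K (\<lambda>_. {..D}). c \<alpha> *
          ((\<Prod>k\<in>?K. F k (\<phi> y) ^ \<alpha> k) * g (\<phi> y) ^ (card ?K * D - sum \<alpha> ?K))) = 0"
        by (simp add: R_def hmon_def)
    qed (use JS F g w in auto)
    then show False using c(1) by blast
  qed
  have "(\<forall>i\<le>n. closedin (subtopology zariski T) (Z i) \<and>
       irreducible_space (subtopology (subtopology zariski T) (Z i))) \<and> (\<forall>i<n. Z i \<subset> Z (Suc i))"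
    using irrZ closedZ mono strict by blast
  then show ?thesis unfolding krull_dim_def n_def[symmetric] by (intro Sup_upper CollectI) blast
qed

section \<open>Symmetric matrices and squares of linear forms\<close>

definition dot :: "complex^4 \<Rightarrow> complex^4 \<Rightarrow> complex" where
  "dot u v = (\<Sum>i\<in>UNIV. u $ i * v $ i)"

definition outer :: "complex^4 \<Rightarrow> complex^4 \<Rightarrow> mat4" where
  "outer u v = (\<chi> i j. u $ i * v $ j)"

abbreviation sq :: "complex^4 \<Rightarrow> mat4" where
  "sq u \<equiv> outer u u"

definition bil :: "mat4 \<Rightarrow> complex^4 \<Rightarrow> complex^4 \<Rightarrow> complex" where
  "bil A k l = (\<Sum>i\<in>UNIV. \<Sum>j\<in>UNIV. A $ i $ j * k $ i * l $ j)"

lemma outer_nth [simp]: "outer u v $ i $ j = u $ i * v $ j"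
  by (simp add: outer_def)

text \<open>Every complex number is a square, so coefficients can be absorbed into linear forms.
  Rescalings of a basket are matched in this way.\<close>

lemma outer_csqrt: "outer (csqrt t *s u) (csqrt t *s v) = smul t (outer u v)"
proof -
  have "csqrt t * p * (csqrt t * q) = (csqrt t)\<^sup>2 * (p * q)" for p q by algebra
  then show ?thesis by (simp add: vec_eq_iff)
qed

lemma sq_Sym4 [simp]: "sq u \<in> Sym4"
  by (simp add: Sym4_iff)

lemma Sym4_add: "A \<in> Sym4 \<Longrightarrow> B \<in> Sym4 \<Longrightarrow> A + B \<in> Sym4"
  and Sym4_diff: "A \<in> Sym4 \<Longrightarrow> B \<in> Sym4 \<Longrightarrow> A - B \<in> Sym4"
  and Sym4_smul: "A \<in> Sym4 \<Longrightarrow> smul c A \<in> Sym4"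
  by (simp_all add: Sym4_iff)

lemma dot_add [simp]: "dot (u + v) w = dot u w + dot v w" "dot w (u + v) = dot w u + dot w v"
  and dot_diff [simp]: "dot (u - v) w = dot u w - dot v w" "dot w (u - v) = dot w u - dot w v"
  and dot_scale [simp]: "dot (c *s u) w = c * dot u w" "dot w (c *s u) = c * dot w u"
  and dot_zero [simp]: "dot 0 w = 0" "dot w 0 = 0"
  by (simp_all add: dot_def algebra_simps sum.distrib sum_subtractf sum_distrib_left)

lemma dot_sum: "dot (\<Sum>j\<in>J. f j) w = (\<Sum>j\<in>J. dot (f j) w)"
  by (induction J rule: infinite_finite_induct) auto

lemma bil_add [simp]: "bil (A + B) k l = bil A k l + bil B k l"
  and bil_diff [simp]: "bil (A - B) k l = bil A k l - bil B k l"
  and bil_smul [simp]: "bil (smul c A) k l = c * bil A k l"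
  and bil_zero [simp]: "bil 0 k l = 0"
  by (simp_all add: bil_def algebra_simps sum.distrib sum_subtractf sum_distrib_left)

lemma bil_outer [simp]: "bil (outer u v) k l = dot u k * dot v l"
  by (simp add: bil_def dot_def sum_product algebra_simps)

lemma bil_add_arg [simp]: "bil A (k + k') l = bil A k l + bil A k' l" "bil A k (l + l') = bil A k l + bil A k l'"
  and bil_scale_arg [simp]: "bil A (c *s k) l = c * bil A k l" "bil A k (c *s l) = c * bil A k l"
  by (simp_all add: bil_def algebra_simps sum.distrib sum_distrib_left)

lemma bil_axis: "bil A (axis i 1) (axis j 1) = A $ i $ j"
proof -
  have "bil A (axis i 1) (axis j 1) = (\<Sum>a\<in>UNIV. \<Sum>b\<in>UNIV. if b = j then (if a = i then A $ a $ b else 0) else 0)"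
    unfolding bil_def by (intro sum.cong refl) (simp add: axis_def)
  then show ?thesis by simp
qed

text \<open>Independence of a family, not of a set: a repeated vector counts as a
  dependency.\<close>

definition indepf :: "'j set \<Rightarrow> ('j \<Rightarrow> complex^4) \<Rightarrow> bool" where
  "indepf J h \<longleftrightarrow> (\<forall>c. (\<Sum>j\<in>J. c j *s h j) = 0 \<longrightarrow> (\<forall>j\<in>J. c j = 0))"

lemma indepfD: "indepf J h \<Longrightarrow> (\<Sum>j\<in>J. c j *s h j) = 0 \<Longrightarrow> j \<in> J \<Longrightarrow> c j = 0"
  by (auto simp: indepf_def)

lemma indepf_independent:
  assumes "finite J" "indepf J h"
  shows "inj_on h J" "vec.independent (h ` J)"
proof -
  show inj: "inj_on h J"
  proof (rule inj_onI, rule ccontr)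
    fix i j assume ij: "i \<in> J" "j \<in> J" "h i = h j" "i \<noteq> j"
    define c where "c = (\<lambda>k. if k = i then 1 else if k = j then -1 else (0::complex))"
    have "(\<Sum>k\<in>J. c k *s h k) = (\<Sum>k\<in>{i,j}. c k *s h k)"
      by (rule sum.mono_neutral_right) (use assms ij in \<open>auto simp: c_def\<close>)
    also have "\<dots> = 0" using ij by (simp add: c_def)
    finally have "c i = 0" using assms(2) ij(1) unfolding indepf_def by blast
    then show False by (simp add: c_def)
  qed
  show "vec.independent (h ` J)"
  proof
    assume "vec.dependent (h ` J)"
    then obtain u where u: "\<exists>v\<in>h ` J. u v \<noteq> 0" "(\<Sum>v\<in>h ` J. u v *s v) = 0"
      using vec.dependent_finite[of "h ` J"] assms(1) by auto
    then have "(\<Sum>j\<in>J. u (h j) *s h j) = 0" using inj by (simp add: sum.reindex)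
    then have "\<forall>j\<in>J. u (h j) = 0" using indepfD[OF assms(2), of "\<lambda>j. u (h j)"] by simp
    then show False using u(1) by auto
  qed
qed

text \<open>At dual vectors, \<open>bil\<close> reads off the coefficients of a quadratic form
  written in the \<open>h i\<close>; most coefficient comparisons below rest on this.\<close>

lemma indepf_dual:
  assumes "finite J" "indepf J h"
  obtains k where "\<And>i j. i \<in> J \<Longrightarrow> j \<in> J \<Longrightarrow> dot (h i) (k j) = (if i = j then 1 else 0)"
proof -
  note ind = indepf_independent[OF assms]
  have "\<exists>k. \<forall>i\<in>J. dot (h i) k = (if i = j then 1 else 0)" if j: "j \<in> J" for j
  proof -
    \<comment> \<open>The functional that is one at \<open>h j\<close> and zero at the other vectors
      is realised as the first coordinate of an endomorphism; its coefficients are the first row of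
      the matrix.\<close>
    obtain g where g: "Vector_Spaces.linear (*s) (*s) g"
      "\<And>x. x \<in> h ` J \<Longrightarrow> g x = (if x = h j then axis 1 1 else (0 :: complex^4))"
      using vec.linear_independent_extend[OF ind(2), of "\<lambda>x. if x = h j then axis 1 1 else (0 :: complex^4)"] by auto
    define k where "k = row 1 (matrix g)"
    have "dot (h i) k = g (h i) $ 1" for i
      using matrix_works[OF g(1), of "h i"]
      by (simp add: dot_def k_def row_def matrix_vector_mult_def vec_eq_iff mult.commute)
    then have "\<forall>i\<in>J. dot (h i) k = (if i = j then 1 else 0)"
      using g(2) ind(1) j by (auto simp: inj_on_def axis_def)
    then show ?thesis by blast
  qed
  then obtain k where "\<forall>j\<in>J. \<forall>i\<in>J. dot (h i) (k j) = (if i = j then 1 else 0)" by metis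
  then show ?thesis by (intro that[of k]) auto
qed

lemma dual_indepf:
  assumes "finite J" "\<And>i j. i \<in> J \<Longrightarrow> j \<in> J \<Longrightarrow> dot (h i) (k j) = (if i = j then 1 else 0)"
  shows "indepf J h"
  unfolding indepf_def
proof (intro allI impI ballI)
  fix c j assume c: "(\<Sum>j\<in>J. c j *s h j) = 0" and j: "j \<in> J"
  have "0 = dot (\<Sum>i\<in>J. c i *s h i) (k j)" using c by simp
  also have "\<dots> = (\<Sum>i\<in>J. if i = j then c i else 0)"
    unfolding dot_sum by (intro sum.cong) (use assms(2) j in auto)
  also have "\<dots> = c j" using assms(1) j by simp
  finally show "c j = 0" by simp
qed

section \<open>Rank and sums of squares\<close>

lemma rank_le_card:
  assumes "\<And>i. row i A \<in> vec.span B" "finite B"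
  shows "rank (A :: mat4) \<le> card B"
  unfolding row_rank_def_gen using assms by (intro vec.dim_le_card) (auto simp: rows_def)

lemma rank_squares_le:
  assumes "finite J" "\<And>r s. A $ r $ s = (\<Sum>j\<in>J. a j * h j $ r * h j $ s)"
  shows "rank (A :: mat4) \<le> card J"
proof -
  have "row i A \<in> vec.span (h ` J)" for i
  proof -
    have "row i A = (\<Sum>j\<in>J. (a j * h j $ i) *s h j)" using assms(2) by (simp add: row_def vec_eq_iff)
    then show ?thesis by (auto intro!: vec.span_sum vec.span_scale intro: vec.span_base)
  qed
  then have "rank A \<le> card (h ` J)" using assms(1) by (intro rank_le_card) auto
  also have "\<dots> \<le> card J" using assms(1) by (rule card_image_le)
  finally show ?thesis .
qed

text \<open>Combining the rows with the entries of a dual vector yields \<open>a j *s h j\<close>,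
  so every \<open>h j\<close> lies in the row space.\<close>

lemma rank_squares:
  assumes "finite J" "indepf J h" "\<And>j. j \<in> J \<Longrightarrow> a j \<noteq> 0"
    "\<And>r s. A $ r $ s = (\<Sum>j\<in>J. a j * h j $ r * h j $ s)"
  shows "rank (A :: mat4) = card J"
proof (rule antisym)
  show "rank A \<le> card J" using rank_squares_le assms(1,4) by blast
  obtain k where k: "\<And>i j. i \<in> J \<Longrightarrow> j \<in> J \<Longrightarrow> dot (h i) (k j) = (if i = j then 1 else 0)"
    using indepf_dual[OF assms(1,2)] by blast
  have "h j \<in> vec.span (rows A)" if j: "j \<in> J" for j
  proof -
    have "(\<Sum>i\<in>UNIV. k j $ i *s row i A) \<in> vec.span (rows A)"
      by (intro vec.span_sum vec.span_scale vec.span_base) (auto simp: rows_def)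
    moreover have "(\<Sum>i\<in>UNIV. k j $ i *s row i A) = a j *s h j"
    proof -
      have "(\<Sum>i\<in>UNIV. k j $ i * A $ i $ s) = a j * h j $ s" for s
      proof -
        have "(\<Sum>i\<in>UNIV. k j $ i * A $ i $ s) = (\<Sum>i\<in>UNIV. \<Sum>m\<in>J. a m * h m $ s * (h m $ i * k j $ i))"
          unfolding assms(4) by (simp add: sum_distrib_left algebra_simps)
        also have "\<dots> = (\<Sum>m\<in>J. a m * h m $ s * dot (h m) (k j))"
          by (subst sum.swap) (simp add: dot_def sum_distrib_left)
        also have "\<dots> = (\<Sum>m\<in>J. if m = j then a m * h m $ s else 0)"
          by (intro sum.cong) (use k j in auto)
        finally show ?thesis using assms(1) j by simp
      qed
      then show ?thesis by (simp add: vec_eq_iff row_def)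
    qed
    ultimately have "a j *s h j \<in> vec.span (rows A)" by simp
    then have "(1 / a j) *s (a j *s h j) \<in> vec.span (rows A)" by (rule vec.span_scale)
    then show ?thesis using assms(3)[OF j] by simp
  qed
  then have "card (h ` J) \<le> vec.dim (vec.span (rows A))"
    using indepf_independent[OF assms(1,2)] by (intro vec.independent_card_le_dim) auto
  then show "card J \<le> rank A" using indepf_independent[OF assms(1,2)] by (simp add: card_image row_rank_def_gen)
qed

lemma rank_zero_iff: "rank (A :: mat4) = 0 \<longleftrightarrow> A = 0"
proof
  assume "rank A = 0"
  then have "rows A \<subseteq> {0}" by (simp add: row_rank_def_gen)
  then have "row i A = 0" for i by (auto simp: rows_def)
  then show "A = 0" by (simp add: row_def vec_eq_iff)
next
  assume "A = 0"
  then have "rank A \<le> card ({} :: (complex^4) set)" by (intro rank_le_card) (auto simp: row_def vec.span_zero zero_vec_def)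
  then show "rank A = 0" by simp
qed

text \<open>Polarisation: the diagonal values of a symmetric bilinear form determine it.\<close>

lemma bil_nonzero:
  assumes "A \<in> Sym4" "A \<noteq> 0"
  shows "\<exists>v. bil A v v \<noteq> 0"
proof (rule ccontr)
  assume "\<not> ?thesis"
  then have z: "bil A v v = 0" for v by auto
  have "A $ i $ j = 0" for i j
    using z[of "axis i 1 + axis j 1"] z[of "axis i 1"] z[of "axis j 1"] assms(1) 
    by (simp add: bil_axis Sym4_iff)
  then show False using assms(2) by (simp add: vec_eq_iff)
qed

text \<open>Lagrange reduction. Splitting off the square of \<open>A *v v\<close>, divided by a root
  of \<open>bil A v v\<close>, leaves rows that annihilate \<open>v\<close>; as \<open>u\<close>
  does not annihilate \<open>v\<close>, the row space shrinks.\<close>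

lemma sum_of_squares:
  assumes "A \<in> Sym4" "rank A \<le> r"
  shows "\<exists>w. \<forall>i j. A $ i $ j = (\<Sum>k<r. w k $ i * w k $ j)"
  using assms
proof (induction r arbitrary: A)
  case 0
  then have "A = 0" using rank_zero_iff by simp
  then show ?case by simp
next
  case (Suc r)
  show ?case
  proof (cases "A = 0")
    case True
    then show ?thesis by (intro exI[of _ "\<lambda>_. 0"]) simp
  next
    case False
    obtain v where v: "bil A v v \<noteq> 0" using bil_nonzero[OF Suc.prems(1) False] by blast
    define c where "c = csqrt (bil A v v)"
    have c: "c * c = bil A v v" "c \<noteq> 0" using v by (auto simp: c_def power2_eq_square[symmetric])
    define u where "u = (1 / c) *s (A *v v)"
    have Av: "(A *v v) $ i = (\<Sum>j\<in>UNIV. A $ i $ j * v $ j)" for i by (simp add: matrix_vector_mult_def)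
    have uv: "dot u v = c"
    proof -
      have "dot (A *v v) v = bil A v v"
        by (simp add: dot_def Av bil_def sum_distrib_left sum_distrib_right algebra_simps)
      then show ?thesis using c by (simp add: u_def field_simps)
    qed
    have usum: "u = (\<Sum>j\<in>UNIV. (v $ j / c) *s row j A)"
      using Suc.prems(1) by (simp add: vec_eq_iff u_def Av row_def Sym4_iff sum_divide_distrib algebra_simps)
    have u_span: "u \<in> vec.span (rows A)"
      unfolding usum by (intro vec.span_sum vec.span_scale vec.span_base) (auto simp: rows_def)
    define A' where "A' = A - sq u"
    have row': "row i A' = row i A - u $ i *s u" for i by (simp add: A'_def row_def vec_eq_iff)
    have "rows A' \<subseteq> vec.span (rows A)"
      using u_span by (auto simp: rows_def row' intro!: vec.span_diff vec.span_scale intro: vec.span_base)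
    then have sub: "vec.span (rows A') \<subseteq> vec.span (rows A)" by (simp add: vec.span_minimal)
    have "dot x v = 0" if "x \<in> vec.span (rows A')" for x
      using that
    proof (induction rule: vec.span_induct_alt)
      case (step a x y)
      then obtain i where x: "x = row i A'" by (auto simp: rows_def)
      have "dot (row i A) v = (A *v v) $ i" by (simp add: Av dot_def row_def)
      also have "\<dots> = c * u $ i" using c by (simp add: u_def)
      finally have "dot x v = 0" using uv by (simp add: x row')
      then show ?case using step by simp
    qed simp
    then have "u \<notin> vec.span (rows A')" using uv c by auto
    then have "vec.span (rows A') \<subset> vec.span (rows A)" using sub u_span by blast
    then have "rank A' < rank A" unfolding row_rank_def_gen by (rule vec.dim_psubset)
    then have "rank A' \<le> r" using Suc.prems by simp
    moreover have "A' \<in> Sym4" using Suc.prems by (auto simp: A'_def intro: Sym4_diff)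
    ultimately obtain w where w: "\<forall>i j. A' $ i $ j = (\<Sum>k<r. w k $ i * w k $ j)" using Suc.IH by blast
    have "A $ i $ j = (\<Sum>k<Suc r. (w(r := u)) k $ i * (w(r := u)) k $ j)" for i j
    proof -
      have "(\<Sum>k<r. (w(r := u)) k $ i * (w(r := u)) k $ j) = (\<Sum>k<r. w k $ i * w k $ j)"
        by (intro sum.cong) auto
      then show ?thesis using w[rule_format, of i j] by (simp add: A'_def algebra_simps)
    qed
    then show ?thesis by blast
  qed
qed

text \<open>With exactly \<open>rank A\<close> squares the forms are automatically independent,
  since otherwise fewer vectors would span the rows.\<close>

lemma sum_of_squares_indep:
  assumes "A \<in> Sym4"
  shows "\<exists>w. indepf {..<rank A} w \<and> (\<forall>i j. A $ i $ j = (\<Sum>k<rank A. w k $ i * w k $ j))"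
proof -
  obtain w where w: "\<forall>i j. A $ i $ j = (\<Sum>k<rank A. w k $ i * w k $ j)"
    using sum_of_squares[OF assms order_refl] by blast
  have "indepf {..<rank A} w"
  proof (rule ccontr)
    assume "\<not> ?thesis"
    then obtain c j where c: "(\<Sum>j<rank A. c j *s w j) = 0" "j < rank A" "c j \<noteq> 0"
      unfolding indepf_def by auto
    define B where "B = w ` ({..<rank A} - {j})"
    have "(\<Sum>i\<in>{..<rank A}. c i *s w i) = c j *s w j + (\<Sum>i\<in>{..<rank A} - {j}. c i *s w i)"
      using c(2) by (intro sum.remove) auto
    then have "c j *s w j = - (\<Sum>i\<in>{..<rank A} - {j}. c i *s w i)"
      using c(1) by (simp add: eq_neg_iff_add_eq_0)
    moreover have "- (\<Sum>i\<in>{..<rank A} - {j}. c i *s w i) \<in> vec.span B"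
      unfolding B_def by (intro vec.span_neg vec.span_sum vec.span_scale) (auto intro: vec.span_base)
    ultimately have "(1 / c j) *s (c j *s w j) \<in> vec.span B" using vec.span_scale by metis
    then have wj: "w j \<in> vec.span B" using c(3) by simp
    have ws: "w i \<in> vec.span B" if "i < rank A" for i
      using wj that by (cases "i = j") (auto simp: B_def intro: vec.span_base)
    have "row i A \<in> vec.span B" for i
    proof -
      have "row i A = (\<Sum>k<rank A. w k $ i *s w k)" using w by (simp add: row_def vec_eq_iff)
      then show ?thesis using ws by (auto intro!: vec.span_sum vec.span_scale)
    qed
    then have "rank A \<le> card B" by (intro rank_le_card) (auto simp: B_def)
    also have "\<dots> \<le> card ({..<rank A} - {j})" unfolding B_def by (intro card_image_le) auto
    also have "\<dots> < rank A" using c(2) by simp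
    finally show False by simp
  qed
  then show ?thesis using w by blast
qed

lemma rank_le_1:
  assumes "A \<in> Sym4" "rank A \<le> 1"
  shows "\<exists>h. A = sq h"
  using sum_of_squares[OF assms] by (auto simp: vec_eq_iff)

lemma rank_le_2:
  assumes "A \<in> Sym4" "rank A \<le> 2"
  shows "\<exists>u v. A = sq u + sq v"
  using sum_of_squares[OF assms] by (auto simp: vec_eq_iff numeral_2_eq_2)

lemma rank_sq_le: "rank (sq h) \<le> 1"
  using rank_squares_le[of "{()}" "sq h" "\<lambda>_. 1" "\<lambda>_. h"] by simp

lemma rank_smul:
  assumes "c \<noteq> 0"
  shows "rank (smul c A) = rank A"
proof -
  have le: "rank (smul c A) \<le> rank A" for c A
    unfolding row_rank_def_gen
  proof (rule vec.dim_mono)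
    have "row i (smul c A) = c *s row i A" for i by (simp add: row_def vec_eq_iff)
    then show "rows (smul c A) \<subseteq> vec.span (rows A)"
      by (auto simp: rows_def intro!: vec.span_scale intro: vec.span_base)
  qed
  have "rank (smul (1 / c) (smul c A)) \<le> rank (smul c A)" by (rule le)
  then show ?thesis using le[of c A] assms by simp
qed

lemma qrank_eq:
  assumes "p \<in> P9" "A \<in> p - {0}"
  shows "qrank p = rank A"
  unfolding qrank_def
proof (rule the_equality)
  show *: "\<forall>B\<in>p - {0}. rank B = rank A"
  proof
    fix B assume "B \<in> p - {0}"
    moreover have "p = range (\<lambda>k. smul k A)" using P9_memD(1)[OF assms] by (simp add: mat.span_singleton)
    ultimately obtain k where "B = smul k A" "k \<noteq> 0" by auto
    then show "rank B = rank A" by (simp add: rank_smul)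
  qed
  show "r = rank A" if "\<forall>B\<in>p - {0}. rank B = r" for r using bspec[OF that assms(2)] by simp
qed

text \<open>Minors in arbitrary directions: dual vectors can be inserted directly, and the result is
  still polynomial in the entries of \<open>A\<close>.\<close>

definition minor3 :: "mat4 \<Rightarrow> (3 \<Rightarrow> complex^4) \<Rightarrow> (3 \<Rightarrow> complex^4) \<Rightarrow> complex" where
  "minor3 A u v = det (\<chi> a b. bil A (u a) (v b))"

lemma minor3_rank_le_2:
  assumes "A \<in> Sym4" "rank A \<le> 2"
  shows "minor3 A u v = 0"
proof -
  obtain p q where "A = sq p + sq q" using rank_le_2[OF assms] by blast
  then show ?thesis by (simp add: minor3_def det_3 algebra_simps)
qed

text \<open>This makes rank at least three a Zariski-open condition. Directions dual to three of the
  squares give the minor one.\<close>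

lemma rank_ge_3_iff:
  assumes "A \<in> Sym4"
  shows "rank A \<ge> 3 \<longleftrightarrow> (\<exists>u v. minor3 A u v \<noteq> 0)"
proof
  assume r: "rank A \<ge> 3"
  obtain w where w: "indepf {..<rank A} w" "\<And>i j. A $ i $ j = (\<Sum>k<rank A. w k $ i * w k $ j)"
    using sum_of_squares_indep[OF assms] by blast
  obtain k where k: "\<And>i j. i \<in> {..<rank A} \<Longrightarrow> j \<in> {..<rank A} \<Longrightarrow> dot (w i) (k j) = (if i = j then 1 else 0)"
    using indepf_dual[OF _ w(1)] by auto
  have A: "A = (\<Sum>k<rank A. sq (w k))" by (simp add: vec_eq_iff w(2) sum_component)
  have bsum: "bil (\<Sum>k\<in>S. sq (w k)) x y = (\<Sum>k\<in>S. dot (w k) x * dot (w k) y)" for S :: "nat set" and x y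
    by (induction S rule: infinite_finite_induct) auto
  have bil: "bil A (k i) (k j) = (if i = j then 1 else 0)" if "i < rank A" "j < rank A" for i j
  proof -
    have "bil A (k i) (k j) = (\<Sum>m<rank A. dot (w m) (k i) * dot (w m) (k j))" using bsum[of "{..<rank A}"] A by simp
    also have "\<dots> = (\<Sum>m<rank A. if m = i then (if i = j then 1 else 0) else 0)"
      by (intro sum.cong) (use k that in auto)
    finally show ?thesis using that by simp
  qed
  define f where "f = (\<lambda>a :: 3. if a = 1 then 0 else if a = 2 then 1 else (2::nat))"
  have "minor3 A (\<lambda>a. k (f a)) (\<lambda>a. k (f a)) = 1"
    using bil r by (simp add: minor3_def det_3 f_def)
  then show "\<exists>u v. minor3 A u v \<noteq> 0" by (metis zero_neq_one)
next
  assume "\<exists>u v. minor3 A u v \<noteq> 0"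
  then show "rank A \<ge> 3" using minor3_rank_le_2[OF assms] by fastforce
qed

text \<open>The left-hand side is the determinant of the Gram matrix of \<open>k\<close>,
  \<open>l\<close>, \<open>m\<close> with respect to \<open>A\<close>.\<close>

lemma gram3:
  assumes "A \<in> Sym4" "rank A \<le> 2"
  shows "bil A k k * bil A l l * bil A m m + 2 * bil A k l * bil A k m * bil A l m
    - bil A k k * (bil A l m)\<^sup>2 - bil A l l * (bil A k m)\<^sup>2 - bil A m m * (bil A k l)\<^sup>2 = 0"
proof -
  obtain p q where "A = sq p + sq q" using rank_le_2[OF assms] by blast
  then show ?thesis by (simp add: power2_eq_square algebra_simps)
qed

section \<open>Independence of two, three and four linear forms\<close>

definition indep2 :: "complex^4 \<Rightarrow> complex^4 \<Rightarrow> bool" where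
  "indep2 x y \<longleftrightarrow> (\<forall>a b. a *s x + b *s y = 0 \<longrightarrow> a = 0 \<and> b = 0)"

definition indep3 :: "complex^4 \<Rightarrow> complex^4 \<Rightarrow> complex^4 \<Rightarrow> bool" where
  "indep3 x y z \<longleftrightarrow> (\<forall>a b c. a *s x + b *s y + c *s z = 0 \<longrightarrow> a = 0 \<and> b = 0 \<and> c = 0)"

definition indep4 :: "complex^4 \<Rightarrow> complex^4 \<Rightarrow> complex^4 \<Rightarrow> complex^4 \<Rightarrow> bool" where
  "indep4 x y z w \<longleftrightarrow> (\<forall>a b c d. a *s x + b *s y + c *s z + d *s w = 0 \<longrightarrow> a = 0 \<and> b = 0 \<and> c = 0 \<and> d = 0)"

lemma indep2_indepf: "indep2 x y \<longleftrightarrow> indepf {..<2::nat} (\<lambda>i. if i = 0 then x else y)" (is "?L \<longleftrightarrow> ?R")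
proof
  assume ?L then show ?R unfolding indep2_def indepf_def by (auto simp: numeral_2_eq_2 less_Suc_eq)
next
  assume R: ?R
  show ?L unfolding indep2_def
  proof (intro allI impI)
    fix a b assume "a *s x + b *s y = 0"
    then have "(\<Sum>j\<in>{..<2::nat}. (if j = 0 then a else b) *s (if j = 0 then x else y)) = 0"
      by (simp add: numeral_2_eq_2)
    then have "\<forall>j\<in>{..<2::nat}. (if j = 0 then a else b) = 0"
      using indepfD[OF R, of "\<lambda>j. if j = 0 then a else b"] by simp
    from this[rule_format, of 0] this[rule_format, of 1] show "a = 0 \<and> b = 0" by simp
  qed
qed

lemma indep3_indepf: "indep3 x y z \<longleftrightarrow> indepf {..<3::nat} (\<lambda>i. if i = 0 then x else if i = 1 then y else z)" (is "?L \<longleftrightarrow> ?R")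
proof
  assume ?L then show ?R unfolding indep3_def indepf_def by (auto simp: numeral_3_eq_3 less_Suc_eq)
next
  assume R: ?R
  show ?L unfolding indep3_def
  proof (intro allI impI)
    fix a b c assume "a *s x + b *s y + c *s z = 0"
    then have "(\<Sum>j\<in>{..<3::nat}. (if j = 0 then a else if j = 1 then b else c) *s (if j = 0 then x else if j = 1 then y else z)) = 0"
      by (simp add: numeral_3_eq_3)
    then have "\<forall>j\<in>{..<3::nat}. (if j = 0 then a else if j = 1 then b else c) = 0"
      using indepfD[OF R, of "\<lambda>j. if j = 0 then a else if j = 1 then b else c"] by simp
    from this[rule_format, of 0] this[rule_format, of 1] this[rule_format, of 2] show "a = 0 \<and> b = 0 \<and> c = 0" by simp
  qed
qed

lemma indep4_indepf: "indep4 x y z w \<longleftrightarrow> indepf {..<4::nat} (\<lambda>i. if i = 0 then x else if i = 1 then y else if i = 2 then z else w)" (is "?L \<longleftrightarrow> ?R")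
proof
  have 4: "4 = Suc (Suc (Suc (Suc 0)))" by simp
  assume ?L then show ?R unfolding indep4_def indepf_def 4 by (auto simp: less_Suc_eq)
next
  have 4: "4 = Suc (Suc (Suc (Suc 0)))" by simp
  assume R: ?R
  show ?L unfolding indep4_def
  proof (intro allI impI)
    fix a b c d assume "a *s x + b *s y + c *s z + d *s w = 0"
    then have "(\<Sum>j\<in>{..<4::nat}. (if j = 0 then a else if j = 1 then b else if j = 2 then c else d) *s (if j = 0 then x else if j = 1 then y else if j = 2 then z else w)) = 0"
      unfolding 4 by simp
    then have "\<forall>j\<in>{..<4::nat}. (if j = 0 then a else if j = 1 then b else if j = 2 then c else d) = 0"
      using indepfD[OF R, of "\<lambda>j. if j = 0 then a else if j = 1 then b else if j = 2 then c else d"] by simp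
    from this[rule_format, of 0] this[rule_format, of 1] this[rule_format, of 2] this[rule_format, of 3]
    show "a = 0 \<and> b = 0 \<and> c = 0 \<and> d = 0" by simp
  qed
qed

lemma indep2_dual:
  assumes "indep2 x y"
  obtains k l where "dot x k = 1" "dot x l = 0" "dot y k = 0" "dot y l = 1"
proof -
  obtain k where "\<And>i j. i \<in> {..<2::nat} \<Longrightarrow> j \<in> {..<2} \<Longrightarrow> dot (if i = 0 then x else y) (k j) = (if i = j then 1 else 0)"
    using indepf_dual[OF _ assms[unfolded indep2_indepf]] by auto
  from this[of 0 0] this[of 0 1] this[of 1 0] this[of 1 1] show ?thesis by (intro that[of "k 0" "k 1"]) auto
qed

lemma indep3_dual:
  assumes "indep3 x y z"
  obtains k l m where "dot x k = 1" "dot x l = 0" "dot x m = 0" "dot y k = 0" "dot y l = 1" "dot y m = 0"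
    "dot z k = 0" "dot z l = 0" "dot z m = 1"
proof -
  obtain k where "\<And>i j. i \<in> {..<3::nat} \<Longrightarrow> j \<in> {..<3} \<Longrightarrow> dot (if i = 0 then x else if i = 1 then y else z) (k j) = (if i = j then 1 else 0)"
    using indepf_dual[OF _ assms[unfolded indep3_indepf]] by auto
  from this[of 0 0] this[of 0 1] this[of 0 2] this[of 1 0] this[of 1 1] this[of 1 2] this[of 2 0] this[of 2 1] this[of 2 2]
  show ?thesis by (intro that[of "k 0" "k 1" "k 2"]) auto
qed

lemma indep3_indep2: "indep3 x y z \<Longrightarrow> indep2 x y" "indep3 x y z \<Longrightarrow> indep2 x z" "indep3 x y z \<Longrightarrow> indep2 y z"
proof -
  assume i: "indep3 x y z"
  show "indep2 x y" unfolding indep2_def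
  proof (intro allI impI)
    fix a b assume "a *s x + b *s y = 0"
    then show "a = 0 \<and> b = 0" using i[unfolded indep3_def, rule_format, of a b 0] by simp
  qed
  show "indep2 x z" unfolding indep2_def
  proof (intro allI impI)
    fix a b assume "a *s x + b *s z = 0"
    then show "a = 0 \<and> b = 0" using i[unfolded indep3_def, rule_format, of a 0 b] by simp
  qed
  show "indep2 y z" unfolding indep2_def
  proof (intro allI impI)
    fix a b assume "a *s y + b *s z = 0"
    then show "a = 0 \<and> b = 0" using i[unfolded indep3_def, rule_format, of 0 a b] by simp
  qed
qed

lemma rank_binary_form_le: "rank (smul a (sq z) + smul b (outer z y + outer y z) + smul c (sq y)) \<le> 2"
proof -
  let ?A = "smul a (sq z) + smul b (outer z y + outer y z) + smul c (sq y)"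
  have "row i ?A = (a * z $ i + b * y $ i) *s z + (b * z $ i + c * y $ i) *s y" for i
    by (simp add: vec_eq_iff row_def algebra_simps)
  then have "row i ?A \<in> vec.span {z, y}" for i
    by (auto intro!: vec.span_add vec.span_scale intro: vec.span_base)
  then have "rank ?A \<le> card {z, y}" by (rule rank_le_card) auto
  also have "\<dots> \<le> 2" by (simp add: card_insert_if)
  finally show ?thesis .
qed

lemma rank_binary_form:
  assumes "indep2 z y" "a * c \<noteq> b\<^sup>2"
  shows "rank (smul a (sq z) + smul b (outer z y + outer y z) + smul c (sq y)) = 2"
proof (rule ccontr)
  let ?A = "smul a (sq z) + smul b (outer z y + outer y z) + smul c (sq y)"
  assume "rank ?A \<noteq> 2"
  then have "rank ?A \<le> 1" using rank_binary_form_le[of a z b y c] by simp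
  moreover have "?A \<in> Sym4" by (simp add: Sym4_iff algebra_simps)
  ultimately obtain h where h: "?A = sq h" using rank_le_1 by blast
  obtain k l where kl: "dot z k = 1" "dot z l = 0" "dot y k = 0" "dot y l = 1" using indep2_dual[OF assms(1)] by blast
  have "a = (dot h k)\<^sup>2" "b = dot h k * dot h l" "c = (dot h l)\<^sup>2"
    using arg_cong[OF h, of "\<lambda>A. bil A k k"] arg_cong[OF h, of "\<lambda>A. bil A k l"] arg_cong[OF h, of "\<lambda>A. bil A l l"] kl
    by (simp_all add: power2_eq_square)
  then show False using assms(2) by (simp add: power_mult_distrib)
qed

section \<open>Pencils of cones and quadruples of quadrics\<close>

lemma mv_outer: "outer u v *v l = dot v l *s u"
  by (simp add: vec_eq_iff matrix_vector_mult_def dot_def sum_distrib_left algebra_simps)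

lemma rank_eq_2:
  assumes "A \<in> Sym4" "rank A = 2"
  shows "\<exists>u v. indep2 u v \<and> A = sq u + sq v"
proof -
  obtain w where w: "indepf {..<2::nat} w" "\<forall>i j. A $ i $ j = (\<Sum>k<2::nat. w k $ i * w k $ j)"
    using sum_of_squares_indep[OF assms(1)] assms(2) by auto
  have "indep2 (w 0) (w 1)" unfolding indep2_def
  proof (intro allI impI)
    fix a b assume "a *s w 0 + b *s w 1 = 0"
    then have "(\<Sum>j\<in>{..<2::nat}. (if j = 0 then a else b) *s w j) = 0" by (simp add: numeral_2_eq_2)
    from indepfD[OF w(1) this, of 0] indepfD[OF w(1) this, of 1] show "a = 0 \<and> b = 0" by simp
  qed
  moreover have "A = sq (w 0) + sq (w 1)" using w(2) by (simp add: vec_eq_iff numeral_2_eq_2)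
  ultimately show ?thesis by blast
qed

abbreviation binform :: "complex^4 \<Rightarrow> complex^4 \<Rightarrow> complex \<Rightarrow> complex \<Rightarrow> complex \<Rightarrow> mat4" where
  "binform z y a b c \<equiv> smul a (sq z) + smul b (outer z y + outer y z) + smul c (sq y)"

lemma binform_basis_aux:
  assumes "indep2 u v" "c1 \<noteq> 0" "z = c1 *s u + c2 *s v"
  shows "\<exists>a b c. sq u + sq v = binform z v a b c \<and> a * c \<noteq> b\<^sup>2 \<and> indep2 z v"
proof (intro exI conjI)
  let ?a = "1 / c1\<^sup>2" and ?b = "- c2 / c1\<^sup>2" and ?c = "1 + c2\<^sup>2 / c1\<^sup>2"
  show "sq u + sq v = binform z v ?a ?b ?c"
    using assms(2) by (simp add: vec_eq_iff assms(3) field_simps power2_eq_square)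
  have "?a * ?c - ?b\<^sup>2 = 1 / c1\<^sup>2" using assms(2) by (simp add: field_simps power2_eq_square)
  then show "?a * ?c \<noteq> ?b\<^sup>2" using assms(2) by auto
  show "indep2 z v" unfolding indep2_def
  proof (intro allI impI)
    fix a b assume "a *s z + b *s v = 0"
    then have "(a * c1) *s u + (a * c2 + b) *s v = 0" by (simp add: assms(3) vec_eq_iff algebra_simps)
    then have "a * c1 = 0 \<and> a * c2 + b = 0" using assms(1) unfolding indep2_def by blast
    then show "a = 0 \<and> b = 0" using assms(2) by auto
  qed
qed

text \<open>In the pencils below, two quadrics of rank two share a linear form \<open>z\<close>;
  both are to be rewritten with \<open>z\<close> as one of their two variables.\<close>

lemma binform_basis:
  assumes "indep2 u v" "z = c1 *s u + c2 *s v" "z \<noteq> 0"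
  shows "\<exists>y a b c. sq u + sq v = binform z y a b c \<and> a * c \<noteq> b\<^sup>2 \<and> indep2 z y"
proof (cases "c1 = 0")
  case False
  then show ?thesis using binform_basis_aux[OF assms(1) _ assms(2)] by blast
next
  case True
  then have "c2 \<noteq> 0" using assms(2,3) by auto
  moreover have "indep2 v u" using assms(1) unfolding indep2_def by (metis add.commute)
  moreover have "z = c2 *s v + c1 *s u" using assms(2) by (simp add: add.commute)
  ultimately obtain a b c where "sq v + sq u = binform z u a b c \<and> a * c \<noteq> b\<^sup>2 \<and> indep2 z u"
    using binform_basis_aux[of v u c2 z c1] by blast
  then show ?thesis by (metis add.commute)
qed

lemma rank_four_squares:
  assumes "indep4 x y z w"
  shows "rank (sq x + sq y + (sq z + sq w)) = 4"
proof -
  let ?h = "\<lambda>i::nat. if i = 0 then x else if i = 1 then y else if i = 2 then z else w"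
  have 4: "4 = Suc (Suc (Suc (Suc 0)))" by simp
  have "rank (sq x + sq y + (sq z + sq w)) = card {..<4::nat}"
  proof (rule rank_squares[of _ ?h "\<lambda>_. 1"])
    show "indepf {..<4} ?h" using assms indep4_indepf by blast
    show "(sq x + sq y + (sq z + sq w)) $ r $ s = (\<Sum>j<4. 1 * ?h j $ r * ?h j $ s)" for r s
      unfolding 4 by simp
  qed auto
  then show ?thesis by simp
qed

text \<open>The pencil spanned by \<open>D\<^sub>1\<close> and \<open>D\<^sub>2\<close> consists of cones with a common vertex and has exactly the
  three members \<open>D\<^sub>1\<close>, \<open>D\<^sub>2\<close>, \<open>D\<^sub>1 - D\<^sub>2\<close> of rank two; so it can be diagonalised.\<close>

lemma pencil_normal_form:
  assumes S: "D1 \<in> Sym4" "D2 \<in> Sym4" and r: "rank D1 = 2" "rank D2 = 2" "rank (D1 - D2) = 2"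
    and le: "rank (D1 + D2) \<le> 3"
    and ne: "\<And>s t. s \<noteq> 0 \<Longrightarrow> t \<noteq> 0 \<Longrightarrow> s + t \<noteq> 0 \<Longrightarrow> rank (smul s D1 + smul t D2) \<noteq> 2"
  shows "\<exists>x y z. indep3 x y z \<and> D1 = sq x - sq z \<and> D2 = sq y - sq z"
proof -
  obtain u1 v1 where 1: "indep2 u1 v1" "D1 = sq u1 + sq v1" using rank_eq_2[OF S(1) r(1)] by blast
  obtain u2 v2 where 2: "indep2 u2 v2" "D2 = sq u2 + sq v2" using rank_eq_2[OF S(2) r(2)] by blast
  \<comment> \<open>As D1 + D2 is a cone, the four forms are dependent. Geometrically, the singular
    lines of the two pairs of planes meet, and \<open>z\<close> is a plane through both
    lines.\<close>
  have "\<not> indep4 u1 v1 u2 v2" using rank_four_squares le 1 2 by fastforce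
  then obtain c1 c2 c3 c4 where rel: "c1 *s u1 + c2 *s v1 + c3 *s u2 + c4 *s v2 = 0"
    and nz: "\<not> (c1 = 0 \<and> c2 = 0 \<and> c3 = 0 \<and> c4 = 0)" unfolding indep4_def by blast
  define z where "z = c1 *s u1 + c2 *s v1"
  have z2: "z = (- c3) *s u2 + (- c4) *s v2"
  proof -
    have "c1 *s u1 + c2 *s v1 + (c3 *s u2 + c4 *s v2) = 0" using rel by (simp add: add.assoc)
    then have "c1 *s u1 + c2 *s v1 = - (c3 *s u2 + c4 *s v2)" by (simp only: eq_neg_iff_add_eq_0)
    then show ?thesis by (simp add: z_def vec_eq_iff)
  qed
  have "z \<noteq> 0"
  proof
    assume z0: "z = 0"
    then have "c1 = 0 \<and> c2 = 0" using 1(1) z_def unfolding indep2_def by auto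
    moreover have "- c3 = 0 \<and> - c4 = 0" using 2(1) z0 z2 unfolding indep2_def by metis
    ultimately show False using nz by simp
  qed
  obtain y a b c where y: "D1 = binform z y a b c" "a * c \<noteq> b\<^sup>2" "indep2 z y"
    using binform_basis[OF 1(1) z_def \<open>z \<noteq> 0\<close>] 1(2) by blast
  obtain x a' b' c' where x: "D2 = binform z x a' b' c'" "a' * c' \<noteq> b'\<^sup>2" "indep2 z x"
    using binform_basis[OF 2(1) z2 \<open>z \<noteq> 0\<close>] 2(2) by blast
  have ind: "indep3 z y x"
  proof (rule ccontr)
    assume "\<not> indep3 z y x"
    then obtain p q s where pqs: "p *s z + q *s y + s *s x = 0" "\<not> (p = 0 \<and> q = 0 \<and> s = 0)"
      unfolding indep3_def by blast
    have s0: "s \<noteq> 0" using pqs y(3) unfolding indep2_def by auto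
    define p' where "p' = - p / s"
    define q' where "q' = - q / s"
    have xe: "x = p' *s z + q' *s y"
    proof -
      have "x $ i = (p' *s z + q' *s y) $ i" for i
      proof -
        have "p * z $ i + q * y $ i + s * x $ i = 0" using arg_cong[OF pqs(1), of "\<lambda>v. v $ i"] by simp
        then have "s * x $ i = - p * z $ i - q * y $ i" by algebra
        then show ?thesis using s0 by (simp add: p'_def q'_def field_simps)
      qed
      then show ?thesis by (simp add: vec_eq_iff)
    qed
    define a2 where "a2 = a' + 2 * b' * p' + c' * p'\<^sup>2"
    define b2 where "b2 = b' * q' + c' * p' * q'"
    define c2' where "c2' = c' * q'\<^sup>2"
    have D2: "D2 = binform z y a2 b2 c2'"
      unfolding x(1) xe a2_def b2_def c2'_def by (simp add: vec_eq_iff algebra_simps power2_eq_square)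
    have comb: "smul s D1 + smul 1 D2 = binform z y (s * a + a2) (s * b + b2) (s * c + c2')" for s
      unfolding y(1) D2 by (simp add: vec_eq_iff algebra_simps)
    have disc: "(s * a + a2) * (s * c + c2') = (s * b + b2)\<^sup>2" if "s \<noteq> 0" "s + 1 \<noteq> 0" for s
      using rank_binary_form[OF y(3)] ne[of s 1] that unfolding comb by auto
    \<comment> \<open>The discriminant of s D1 + D2 is quadratic in s with leading coefficient a c -
      b^2; having the three roots 1, 2, 3 it is zero.\<close>
    have "a * c = b\<^sup>2" using disc[of 1] disc[of 2] disc[of 3] by algebra
    then show False using y(2) by simp
  qed
  obtain k l m where klm: "dot z k = 1" "dot z l = 0" "dot z m = 0" "dot y k = 0" "dot y l = 1" "dot y m = 0"
    "dot x k = 0" "dot x l = 0" "dot x m = 1" using indep3_dual[OF ind] by blast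
  \<comment> \<open>The determinant of D1 - D2 in the variables z, y, x. Its vanishing says that
    completing the square leaves the same multiple of z^2 in both forms.\<close>
  have "- ((a - a') * c * c') - c * b'\<^sup>2 + c' * b\<^sup>2 = 0"
    using gram3[of "D1 - D2" k l m] S r(3) klm
    by (simp add: Sym4_diff y(1) x(1))
  then have det: "c' * (b\<^sup>2 - a * c) = c * (b'\<^sup>2 - a' * c')" by algebra
  \<comment> \<open>If c = 0, then c' = 0 as well and \<open>z\<close> divides both forms, so that
    the forbidden member D1 + D2 would have rank two.\<close>
  have c0: "c \<noteq> 0"
  proof
    assume "c = 0"
    then have b0: "b \<noteq> 0" using y(2) by auto
    then have "c' = 0" using det \<open>c = 0\<close> by auto
    then have b'0: "b' \<noteq> 0" using x(2) by auto
    have "smul 1 D1 + smul 1 D2 = binform z (b *s y + b' *s x) (a + a') 1 0"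
      unfolding y(1) x(1) \<open>c = 0\<close> \<open>c' = 0\<close> by (simp add: vec_eq_iff algebra_simps)
    moreover have "indep2 z (b *s y + b' *s x)" unfolding indep2_def
    proof (intro allI impI)
      fix p q assume "p *s z + q *s (b *s y + b' *s x) = 0"
      then have "p *s z + (q * b) *s y + (q * b') *s x = 0" by (simp add: vec_eq_iff algebra_simps)
      then have "p = 0 \<and> q * b = 0 \<and> q * b' = 0" using ind unfolding indep3_def by blast
      then show "p = 0 \<and> q = 0" using b0 by auto
    qed
    ultimately have "rank (smul 1 D1 + smul 1 D2) = 2"
      using rank_binary_form[of z "b *s y + b' *s x" "a + a'" 0 1] by simp
    then show False using ne[of 1 1] by simp
  qed
  have c'0: "c' \<noteq> 0" using det c0 x(2) by auto
  \<comment> \<open>Both forms leave the remainder - e z^2 after completing the square in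
    \<open>y\<close> and in \<open>x\<close>.\<close>
  define e where "e = (b\<^sup>2 - a * c) / c"
  have e': "e = (b'\<^sup>2 - a' * c') / c'" using det c0 c'0 by (simp add: e_def field_simps)
  have e0: "e \<noteq> 0" using y(2) c0 by (simp add: e_def)
  define x1 where "x1 = csqrt c *s (y + (b / c) *s z)"
  define y1 where "y1 = csqrt c' *s (x + (b' / c') *s z)"
  define z1 where "z1 = csqrt e *s z"
  have "D1 = sq x1 - sq z1"
    unfolding y(1) x1_def z1_def outer_csqrt using c0 by (simp add: vec_eq_iff e_def field_simps power2_eq_square)
  moreover have "D2 = sq y1 - sq z1"
    unfolding x(1) y1_def z1_def outer_csqrt using c'0 by (simp add: vec_eq_iff e' field_simps power2_eq_square)
  moreover have "indep3 x1 y1 z1" unfolding indep3_def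
  proof (intro allI impI)
    fix p q s assume "p *s x1 + q *s y1 + s *s z1 = 0"
    then have "(p * csqrt c * (b / c) + q * csqrt c' * (b' / c') + s * csqrt e) *s z + (p * csqrt c) *s y + (q * csqrt c') *s x = 0"
      by (simp add: x1_def y1_def z1_def vec_eq_iff algebra_simps)
    then have "p * csqrt c * (b / c) + q * csqrt c' * (b' / c') + s * csqrt e = 0 \<and> p * csqrt c = 0 \<and> q * csqrt c' = 0"
      using ind unfolding indep3_def by blast
    then show "p = 0 \<and> q = 0 \<and> s = 0" using c0 c'0 e0 by auto
  qed
  ultimately show ?thesis by blast
qed

text \<open>Applied to a vector that is annihilated by \<open>x'\<close> and dual to
  \<open>z'\<close>, the right-hand matrix returns - z', the left-hand one a combination of
  \<open>x\<close> and \<open>z\<close>.\<close>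

lemma difference_of_squares_span:
  assumes "sq x - sq z = sq x' - sq z'" "indep2 x' z'"
  shows "\<exists>p q. z' = p *s z + q *s x"
proof -
  obtain k l where l: "dot x' l = 0" "dot z' l = 1" using indep2_dual[OF assms(2)] by metis
  have "(sq x - sq z) *v l = (sq x' - sq z') *v l" using assms(1) by simp
  then have "dot x l *s x - dot z l *s z = - z'" using l by (simp add: matrix_vector_mult_diff_rdistrib mv_outer)
  then have "z' = dot z l *s z + (- dot x l) *s x" by (simp add: vec_eq_iff algebra_simps)
  then show ?thesis by blast
qed

text \<open>The binary form x^2 + (p^2 - 1) z^2 equals the square of x', so its discriminant
  vanishes.\<close>

lemma difference_of_squares_unique:
  assumes "sq x - sq z = sq x' - sq (p *s z)" "indep2 x z"
  shows "sq (p *s z) = sq z"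
proof -
  have "sq x' = binform x z 1 0 (p\<^sup>2 - 1)"
  proof -
    have "sq x' = sq x - sq z + sq (p *s z)" using assms(1) by simp
    then show ?thesis by (simp add: vec_eq_iff algebra_simps power2_eq_square)
  qed
  then have "p\<^sup>2 - 1 = 0" using rank_binary_form[OF assms(2), of 1 "p\<^sup>2 - 1" 0] rank_sq_le[of x'] by fastforce
  then have "p * p = 1" by (simp add: power2_eq_square)
  then show ?thesis by (simp add: vec_eq_iff algebra_simps)
qed

section \<open>The third difference and the exceptional case\<close>

definition ternform :: "complex^4 \<Rightarrow> complex^4 \<Rightarrow> complex^4 \<Rightarrow> complex \<Rightarrow> complex \<Rightarrow> complex \<Rightarrow>
    complex \<Rightarrow> complex \<Rightarrow> complex \<Rightarrow> mat4" where
  "ternform x y z a b c d e f = smul a (sq x) + smul b (sq y) + smul c (sq z) +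
    smul d (outer x y + outer y x) + smul e (outer x z + outer z x) + smul f (outer y z + outer z y)"

text \<open>The negative squares of the three normal forms are compared in pairs: z' is a
  combination of z and x, z'' one of z and y, and z'' one of z' and w'. If z' or z'' is a multiple
  of z, its square is that of z and the first case holds; otherwise the last combination can be
  solved for w' in terms of x, y, z.\<close>

lemma third_difference:
  assumes "indep3 x y z" "D1 = sq x - sq z" "D2 = sq y - sq z"
    and 13: "indep3 x' w' z'" "D1 = sq x' - sq z'" "D3 = sq w' - sq z'"
    and 23: "indep3 y'' w'' z''" "D2 = sq y'' - sq z''" "D3 = sq w'' - sq z''"
  shows "(\<exists>w. D3 = sq w - sq z) \<or> (\<exists>a b c d e f. D3 = ternform x y z a b c d e f)"
proof -
  obtain p q where pq: "z' = p *s z + q *s x"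
    using difference_of_squares_span[of x z x' z'] assms(2) 13(2) indep3_indep2(2)[OF 13(1)] by metis
  obtain s t where st: "z'' = s *s z + t *s y"
    using difference_of_squares_span[of y z y'' z''] assms(3) 23(2) indep3_indep2(2)[OF 23(1)] by metis
  consider "q = 0" | "t = 0" | "q \<noteq> 0" "t \<noteq> 0" by blast
  then show ?thesis
  proof cases
    case 1
    then have "sq z' = sq z" using pq difference_of_squares_unique[of x z x' p] assms(2) 13(2) indep3_indep2(2)[OF assms(1)]
      by simp
    then show ?thesis using 13(3) by metis
  next
    case 2
    then have "sq z'' = sq z" using st difference_of_squares_unique[of y z y'' s] assms(3) 23(2) indep3_indep2(3)[OF assms(1)]
      by simp
    then show ?thesis using 23(3) by metis
  next
    case 3
    obtain g h where gh: "z'' = g *s z' + h *s w'"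
      using difference_of_squares_span[of w' z' w'' z''] 13(3) 23(3) indep3_indep2(3)[OF 23(1)] by metis
    have h0: "h \<noteq> 0"
    proof
      assume "h = 0"
      then have "(- g * q) *s x + t *s y + (s - g * p) *s z = 0"
        using gh st pq by (simp add: vec_eq_iff algebra_simps)
      then show False using assms(1) 3 unfolding indep3_def by blast
    qed
    define A where "A = - g * q / h"
    define B where "B = t / h"
    define C where "C = (s - g * p) / h"
    have w': "w' = A *s x + B *s y + C *s z"
    proof -
      have "w' $ i = (A *s x + B *s y + C *s z) $ i" for i
      proof -
        have "s * z $ i + t * y $ i = g * (p * z $ i + q * x $ i) + h * w' $ i"
          using arg_cong[OF gh, of "\<lambda>v. v $ i"] st pq by (simp add: algebra_simps)
        then have "h * w' $ i = - g * q * x $ i + t * y $ i + (s - g * p) * z $ i" by algebra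
        moreover have "h * A = - g * q" "h * B = t" "h * C = s - g * p"
          using h0 by (simp_all add: A_def B_def C_def)
        ultimately have "h * w' $ i = h * (A * x $ i + B * y $ i + C * z $ i)" by algebra
        then show ?thesis using h0 by simp
      qed
      then show ?thesis by (simp add: vec_eq_iff)
    qed
    have "D3 = ternform x y z (A * A - q * q) (B * B) (C * C - p * p) (A * B) (A * C - p * q) (B * C)"
      unfolding 13(3) w' pq ternform_def by (simp add: vec_eq_iff algebra_simps)
    then show ?thesis by blast
  qed
qed

text \<open>The matrices of \<open>D3\<close>, \<open>D3 - D2\<close>, \<open>D3 - D1\<close> arise
  from the one with determinant \<open>P\<close> by lowering one diagonal entry by one, which
  subtracts the complementary principal minor from the determinant.\<close>

lemma ternform_conditions:
  assumes "indep3 x y z" "D1 = sq x - sq z" "D2 = sq y - sq z" "D3 = ternform x y z a b (c - 1) d e f"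
    and r: "rank D3 \<le> 2" "rank (D3 - D1) \<le> 2" "rank (D3 - D2) \<le> 2"
    and P: "P = a * b * c + 2 * d * e * f - a * f\<^sup>2 - b * e\<^sup>2 - c * d\<^sup>2"
  shows "P = a * b - d\<^sup>2" "P = a * c - e\<^sup>2" "P = b * c - f\<^sup>2"
proof -
  obtain k l m where klm: "dot x k = 1" "dot x l = 0" "dot x m = 0" "dot y k = 0" "dot y l = 1" "dot y m = 0"
    "dot z k = 0" "dot z l = 0" "dot z m = 1" using indep3_dual[OF assms(1)] by blast
  have S: "D1 \<in> Sym4" "D2 \<in> Sym4" "D3 \<in> Sym4" unfolding assms(2-4)
    by (simp_all add: Sym4_iff ternform_def) (simp_all add: algebra_simps)
  show "P = a * b - d\<^sup>2" using gram3[OF S(3) r(1), of k l m] klm unfolding P assms(4)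
    by (simp add: ternform_def) algebra
  show "P = a * c - e\<^sup>2" using gram3[OF Sym4_diff[OF S(3) S(2)] r(3), of k l m] klm unfolding P assms(3,4)
    by (simp add: ternform_def) algebra
  show "P = b * c - f\<^sup>2" using gram3[OF Sym4_diff[OF S(3) S(1)] r(2), of k l m] klm unfolding P assms(2,4)
    by (simp add: ternform_def) algebra
qed

text \<open>The vanishing principal minors give d e = a f only up to sign; the vanishing determinant
  decides the sign.\<close>

lemma symmetric3_rank_one:
  fixes a b c d e f :: complex
  assumes "a * b = d\<^sup>2" "a * c = e\<^sup>2" "b * c = f\<^sup>2" "a * b * c + 2 * d * e * f - a * f\<^sup>2 - b * e\<^sup>2 - c * d\<^sup>2 = 0"
  shows "\<exists>p q r. a = p * p \<and> b = q * q \<and> c = r * r \<and> d = p * q \<and> e = p * r \<and> f = q * r"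
proof (cases "a = 0")
  case False
  define p where "p = csqrt a"
  have p: "a = p * p" "p \<noteq> 0" using False by (simp_all add: p_def power2_eq_square[symmetric])
  have def: "d * e * f = a * b * c"
    using assms by algebra
  have "d * e = a * f"
  proof (cases "f = 0")
    case True
    then have "b * c = 0" using assms(3) by simp
    then have "d\<^sup>2 * e\<^sup>2 = 0" using assms(1,2) by (metis mult.assoc mult.left_commute mult_zero_right)
    then show ?thesis using True by auto
  next
    case False
    have "d * e * f = a * f * f" using def assms(3) by (simp add: power2_eq_square)
    then show ?thesis using False by simp
  qed
  then have "b = (d / p) * (d / p)" "c = (e / p) * (e / p)" "d = p * (d / p)" "e = p * (e / p)" "f = (d / p) * (e / p)"
    using assms(1,2) p by (auto simp: field_simps power2_eq_square)
  then show ?thesis using p by blast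
next
  case True
  then have de: "d = 0" "e = 0" using assms(1,2) by auto
  show ?thesis
  proof (cases "b = 0")
    case b: False
    define q where "q = csqrt b"
    have q: "b = q * q" "q \<noteq> 0" using b by (simp_all add: q_def power2_eq_square[symmetric])
    have "c = (f / q) * (f / q)" using q assms(3) by (simp add: field_simps power2_eq_square)
    then show ?thesis using q True de by (intro exI[of _ 0] exI[of _ q] exI[of _ "f / q"]) auto
  next
    case b: True
    then have "f = 0" using assms(3) by auto
    moreover have "c = csqrt c * csqrt c" by (simp add: power2_eq_square[symmetric])
    ultimately show ?thesis using b True de by (intro exI[of _ 0] exI[of _ 0] exI[of _ "csqrt c"]) auto
  qed
qed

text \<open>Inserting the values of d^2, e^2, f^2 in the determinant makes 2 d e f linear in
  \<open>P\<close>. Squaring and inserting them again eliminates d, e, f; the result is divisible by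
  \<open>P\<close>, and the quotient is quadratic with constant leading coefficient, as
  \<open>growth_quadratic\<close> requires.\<close>

lemma delta_quadratic:
  fixes a b c d e f P :: complex
  assumes "P = a * b * c + 2 * d * e * f - a * f\<^sup>2 - b * e\<^sup>2 - c * d\<^sup>2"
    "P = a * b - d\<^sup>2" "P = a * c - e\<^sup>2" "P = b * c - f\<^sup>2" "P \<noteq> 0"
  shows "P\<^sup>2 = ((a * b + b * c + c * a) - (1 - a - b - c)\<^sup>2 / 4) * P + (- (a * b * c))"
proof -
  have d: "d\<^sup>2 = a * b - P" "e\<^sup>2 = a * c - P" "f\<^sup>2 = b * c - P" using assms(2-4) by algebra+
  have "2 * (d * e * f) = P * (1 - a - b - c) + 2 * a * b * c"
    using assms(1) unfolding d by algebra
  then have "4 * (d\<^sup>2 * e\<^sup>2 * f\<^sup>2) = (P * (1 - a - b - c) + 2 * a * b * c)\<^sup>2" by algebra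
  then have "P * (P * (4 * P * (a * b + b * c + c * a) - 4 * P\<^sup>2 - P * (1 - a - b - c)\<^sup>2 - 4 * a * b * c)) = 0"
    unfolding d by algebra
  then have "4 * P * (a * b + b * c + c * a) - 4 * P\<^sup>2 - P * (1 - a - b - c)\<^sup>2 - 4 * a * b * c = 0"
    using assms(5) by simp
  then show ?thesis by (simp add: field_simps)
qed

text \<open>Put \<open>N = ternform x y z a b c d e f\<close>, so that \<open>Q 3 - Q 4 = N - z\<^sup>2\<close>. That \<open>Q 3 - Q 4\<close>, \<open>Q 3 - Q 1\<close>
  and \<open>Q 3 - Q 2\<close> have rank two means that the determinant \<open>P\<close> of \<open>N\<close> equals each of its three principal
  minors of order two; the quadratic equation for \<open>P\<close> results from eliminating \<open>d\<close>, \<open>e\<close>, \<open>f\<close>.\<close>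

definition exceptional :: "(4 \<Rightarrow> mat4) \<Rightarrow> bool" where
  "exceptional Q \<longleftrightarrow> (\<exists>x y z a b c d e f P.
     P = a * b - d\<^sup>2 \<and> P = a * c - e\<^sup>2 \<and> P = b * c - f\<^sup>2 \<and>
     P\<^sup>2 = ((a * b + b * c + c * a) - (1 - a - b - c)\<^sup>2 / 4) * P + (- (a * b * c)) \<and>
     Q 1 = Q 4 + sq x - sq z \<and> Q 2 = Q 4 + sq y - sq z \<and> Q 3 = Q 4 + ternform x y z a b (c - 1) d e f)"

lemma quadruple_classification:
  assumes S: "\<And>i. Q i \<in> Sym4" and r: "\<And>i j. i \<noteq> j \<Longrightarrow> rank (Q i - Q j) = 2"
    and le: "\<And>i j k s t. i \<noteq> j \<Longrightarrow> i \<noteq> k \<Longrightarrow> j \<noteq> k \<Longrightarrow> rank (smul s (Q i - Q k) + smul t (Q j - Q k)) \<le> 3"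
    and ne: "\<And>i j k s t. i \<noteq> j \<Longrightarrow> i \<noteq> k \<Longrightarrow> j \<noteq> k \<Longrightarrow> s \<noteq> 0 \<Longrightarrow> t \<noteq> 0 \<Longrightarrow> s + t \<noteq> 0 \<Longrightarrow>
      rank (smul s (Q i - Q k) + smul t (Q j - Q k)) \<noteq> 2"
  shows "(\<exists>G h. G \<in> Sym4 \<and> (\<forall>i. Q i = G + sq (h i))) \<or> exceptional Q"
proof -
  have nf: "\<exists>x y z. indep3 x y z \<and> Q i - Q 4 = sq x - sq z \<and> Q j - Q 4 = sq y - sq z"
    if "i \<noteq> j" "i \<noteq> 4" "j \<noteq> 4" for i j
  proof (rule pencil_normal_form)
    show "rank (Q i - Q 4 - (Q j - Q 4)) = 2" using r[OF that(1)] by simp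
    show "rank (Q i - Q 4 + (Q j - Q 4)) \<le> 3" using le[OF that, of 1 1] by simp
  qed (use S r that ne[OF that] in \<open>auto intro: Sym4_diff\<close>)
  have n: "(1::4) \<noteq> 2" "(1::4) \<noteq> 3" "(2::4) \<noteq> 3" "(1::4) \<noteq> 4" "(2::4) \<noteq> 4" "(3::4) \<noteq> 4" by auto
  obtain x y z where xyz: "indep3 x y z" "Q 1 - Q 4 = sq x - sq z" "Q 2 - Q 4 = sq y - sq z"
    using nf[OF n(1,4,5)] by blast
  obtain x' w' z' where 13: "indep3 x' w' z'" "Q 1 - Q 4 = sq x' - sq z'" "Q 3 - Q 4 = sq w' - sq z'"
    using nf[OF n(2,4,6)] by blast
  obtain y'' w'' z'' where 23: "indep3 y'' w'' z''" "Q 2 - Q 4 = sq y'' - sq z''" "Q 3 - Q 4 = sq w'' - sq z''"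
    using nf[OF n(3,5,6)] by blast
  have good: ?thesis if w: "Q 3 - Q 4 = sq w - sq z" for w
  proof -
    define h where "h = (\<lambda>i :: 4. if i = 1 then x else if i = 2 then y else if i = 3 then w else z)"
    have "\<forall>i. Q i = (Q 4 - sq z) + sq (h i)"
      using xyz(2,3) w by (simp add: forall_4 h_def algebra_simps)
    moreover have "Q 4 - sq z \<in> Sym4" using S by (auto intro: Sym4_diff)
    ultimately show ?thesis by blast
  qed
  consider w where "Q 3 - Q 4 = sq w - sq z" | a b c d e f where "Q 3 - Q 4 = ternform x y z a b c d e f"
    using third_difference[OF xyz 13 23] by blast
  then show ?thesis
  proof cases
    case 1
    then show ?thesis by (rule good)
  next
    case (2 a b c' d e f)
    define c where "c = c' + 1"
    have T: "Q 3 - Q 4 = ternform x y z a b (c - 1) d e f" using 2 by (simp add: c_def)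
    define P where "P = a * b * c + 2 * d * e * f - a * f\<^sup>2 - b * e\<^sup>2 - c * d\<^sup>2"
    have "rank (Q 3 - Q 4) \<le> 2" "rank (Q 3 - Q 4 - (Q 1 - Q 4)) \<le> 2" "rank (Q 3 - Q 4 - (Q 2 - Q 4)) \<le> 2"
      using r[of 3 4] r[of 3 1] r[of 3 2] by simp_all
    note P = ternform_conditions[OF xyz T this P_def]
    show ?thesis
    \<comment> \<open>For P = 0 the matrix with determinant \<open>P\<close> has rank at most one,
      so it is a square w^2, and the third difference has the form already treated.\<close>
    proof (cases "P = 0")
      case True
      then have "\<exists>p q r. a = p * p \<and> b = q * q \<and> c = r * r \<and> d = p * q \<and> e = p * r \<and> f = q * r"
        using P P_def by (intro symmetric3_rank_one) auto
      then obtain p q r where pqr: "a = p * p" "b = q * q" "c = r * r" "d = p * q" "e = p * r" "f = q * r" by blast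
      have "Q 3 - Q 4 = sq (p *s x + q *s y + r *s z) - sq z"
        unfolding T pqr ternform_def by (simp add: vec_eq_iff algebra_simps)
      then show ?thesis by (rule good)
    next
      case False
      have "exceptional Q" unfolding exceptional_def
      proof (intro exI conjI)
        show "P\<^sup>2 = ((a * b + b * c + c * a) - (1 - a - b - c)\<^sup>2 / 4) * P + (- (a * b * c))"
          using delta_quadratic[OF P_def P False] .
        show "Q 1 = Q 4 + sq x - sq z" "Q 2 = Q 4 + sq y - sq z" using xyz by (simp_all add: algebra_simps)
        show "Q 3 = Q 4 + ternform x y z a b (c - 1) d e f" using T by (simp add: algebra_simps)
      qed (use P in auto)
      then show ?thesis ..
    qed
  qed
qed

section \<open>Baskets\<close>

lemma quad_form_bil: "quad_form A x = bil A x x"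
  by (simp add: quad_form_def bil_def)

lemma lin_form_dot: "lin_form h x = dot h x"
  by (simp add: lin_form_def dot_def)

text \<open>Limits along rays extract the constant terms of the multipliers in an ideal membership,
  in place of a decomposition into homogeneous parts.\<close>

lemma poly_coords4_tendsto:
  assumes "f \<in> poly_funs coords4"
  shows "((\<lambda>t. f (t *s x)) \<longlongrightarrow> f 0) (at 0)"
  using assms
proof induction
  case (coord f)
  then obtain i where "f = (\<lambda>x. x $ i)" by (auto simp: coords4_def)
  moreover have "((\<lambda>t. t * x $ i) \<longlongrightarrow> 0 * x $ i) (at 0)" by (intro tendsto_intros)
  ultimately show ?case by simp
qed (auto intro!: tendsto_intros)

lemma bil_diag_eq:
  assumes "A \<in> Sym4" "B \<in> Sym4" "\<And>x. bil A x x = bil B x x"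
  shows "A = B"
  using bil_nonzero[OF Sym4_diff[OF assms(1,2)]] assms(3) by auto

lemma P9_smul:
  assumes "p \<in> P9" "A \<in> p - {0}" "k \<noteq> 0"
  shows "smul k A \<in> p - {0}"
proof -
  have "mat.subspace p" using assms(1) by (auto simp: P9_def proj_subspace_def)
  then show ?thesis using assms by (auto simp: mat.subspace_scale)
qed

lemma P9_proportional:
  assumes "p \<in> P9" "A \<in> p - {0}" "B \<in> p - {0}"
  shows "\<exists>k. k \<noteq> 0 \<and> B = smul k A"
proof -
  have "B \<in> mat.span {A}" using P9_memD(1)[OF assms(1,2)] assms(3) by auto
  then obtain k where "B = smul k A" by (auto simp: mat.span_singleton)
  then show ?thesis using assms(3) by auto
qed

lemma P9_eqI:
  assumes "p \<in> P9" "q \<in> P9" "A \<in> p - {0}" "A \<in> q - {0}"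
  shows "p = q"
  using P9_memD(1)[OF assms(1,3)] P9_memD(1)[OF assms(2,4)] by simp

lemma ideal2I:
  "f \<in> poly_funs coords4 \<Longrightarrow> g \<in> poly_funs coords4 \<Longrightarrow> u = (\<lambda>x. f x * F x + g x * G x) \<Longrightarrow> u \<in> ideal2 F G"
  by (auto simp: ideal2_def)

lemma ideal2E:
  assumes "u \<in> ideal2 F G"
  obtains f g where "f \<in> poly_funs coords4" "g \<in> poly_funs coords4" "u = (\<lambda>x. f x * F x + g x * G x)"
  using assms by (auto simp: ideal2_def)

text \<open>Write the second form as f A + g h^2 with polynomials f and g. Evaluating at t x,
  dividing by t^2 and letting t tend to 0 gives f(0) A + g(0) h^2. Here f(0) is nonzero, since
  otherwise the quadric would be a double plane.\<close>

lemma meet_in_double_conic_iff: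
  assumes b: "b \<in> P9" and q: "q \<in> P9" and ne: "b \<noteq> q" and r: "qrank q \<ge> 3"
  shows "meet_in_double_conic b q \<longleftrightarrow> (\<exists>G h. G \<in> b - {0} \<and> G + sq h \<in> q - {0})"
proof
  assume "meet_in_double_conic b q"
  then obtain A B h where AB: "A \<in> b - {0}" "B \<in> q - {0}"
    and eq: "ideal2 (quad_form A) (quad_form B) = ideal2 (quad_form A) (\<lambda>x. (lin_form h x)\<^sup>2)"
    unfolding meet_in_double_conic_def by blast
  have "quad_form B \<in> ideal2 (quad_form A) (quad_form B)"
    by (rule ideal2I[OF poly_funs.const[of 0] poly_funs.const[of 1]]) simp
  then obtain f g where fg: "f \<in> poly_funs coords4" "g \<in> poly_funs coords4"
    and B: "quad_form B = (\<lambda>x. f x * quad_form A x + g x * (lin_form h x)\<^sup>2)"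
    unfolding eq by (rule ideal2E)
  have "bil B x x = bil (smul (f 0) A + smul (g 0) (sq h)) x x" for x
  proof -
    have "((\<lambda>t. f (t *s x) * bil A x x + g (t *s x) * (dot h x)\<^sup>2) \<longlongrightarrow> f 0 * bil A x x + g 0 * (dot h x)\<^sup>2) (at 0)"
      using fg by (intro tendsto_intros poly_coords4_tendsto)
    moreover have "\<forall>\<^sub>F t in at 0. f (t *s x) * bil A x x + g (t *s x) * (dot h x)\<^sup>2 = bil B x x"
    proof -
      have "\<forall>\<^sub>F t in at 0. t \<noteq> (0::complex)" by (rule eventually_neq_at_within)
      then show ?thesis
      proof eventually_elim
        case (elim t)
        have "t\<^sup>2 * bil B x x = t\<^sup>2 * (f (t *s x) * bil A x x + g (t *s x) * (dot h x)\<^sup>2)"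
          using fun_cong[OF B, of "t *s x"] unfolding quad_form_bil lin_form_dot
          by (simp add: power2_eq_square algebra_simps)
        then show ?case using elim by simp
      qed
    qed
    ultimately have "f 0 * bil A x x + g 0 * (dot h x)\<^sup>2 = bil B x x"
      by (rule tendsto_unique[OF at_neq_bot _ tendsto_eventually])
    then show ?thesis by (simp add: power2_eq_square)
  qed
  then have Beq: "B = smul (f 0) A + smul (g 0) (sq h)"
    using P9_memD(2)[OF b AB(1)] P9_memD(2)[OF q AB(2)]
    by (intro bil_diag_eq Sym4_add Sym4_smul sq_Sym4)
  have "f 0 \<noteq> 0"
  proof
    assume "f 0 = 0"
    then have "B = sq (csqrt (g 0) *s h)" using Beq by (simp add: outer_csqrt)
    then show False using r qrank_eq[OF q AB(2)] rank_sq_le[of "csqrt (g 0) *s h"] by simp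
  qed
  then have "smul (f 0) A \<in> b - {0}" by (intro P9_smul b AB)
  moreover have "smul (f 0) A + sq (csqrt (g 0) *s h) \<in> q - {0}" using Beq AB(2) by (simp only: outer_csqrt)
  ultimately show "\<exists>G h. G \<in> b - {0} \<and> G + sq h \<in> q - {0}" by blast
next
  assume "\<exists>G h. G \<in> b - {0} \<and> G + sq h \<in> q - {0}"
  then obtain G h where G: "G \<in> b - {0}" "G + sq h \<in> q - {0}" by blast
  have "h \<noteq> 0"
  proof
    assume "h = 0"
    then have "sq h = 0" by (simp add: vec_eq_iff)
    then have "G \<in> q - {0}" using G(2) by simp
    then show False using P9_eqI[OF b q G(1)] ne by blast
  qed
  let ?A = "quad_form G" and ?h = "\<lambda>x. (lin_form h x)\<^sup>2"
  have B: "quad_form (G + sq h) = (\<lambda>x. ?A x + ?h x)"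
    by (simp add: quad_form_bil lin_form_dot fun_eq_iff power2_eq_square)
  have neg: "(\<lambda>x. f x - g x) \<in> poly_funs coords4" if fg: "f \<in> poly_funs coords4" "g \<in> poly_funs coords4" for f g
    using poly_funs.add[OF fg(1) poly_funs.mult[OF poly_funs.const[of "-1"] fg(2)]] by simp
  have "ideal2 ?A (quad_form (G + sq h)) = ideal2 ?A ?h"
  proof (rule set_eqI, rule iffI)
    fix u assume "u \<in> ideal2 ?A (quad_form (G + sq h))"
    then obtain f g where fg: "f \<in> poly_funs coords4" "g \<in> poly_funs coords4"
      and u: "u = (\<lambda>x. f x * ?A x + g x * (?A x + ?h x))" unfolding B by (rule ideal2E)
    have "u = (\<lambda>x. (f x + g x) * ?A x + g x * ?h x)" unfolding u by (simp add: algebra_simps)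
    then show "u \<in> ideal2 ?A ?h" by (rule ideal2I[OF poly_funs.add[OF fg] fg(2)])
  next
    fix u assume "u \<in> ideal2 ?A ?h"
    then obtain f g where fg: "f \<in> poly_funs coords4" "g \<in> poly_funs coords4"
      and u: "u = (\<lambda>x. f x * ?A x + g x * ?h x)" by (rule ideal2E)
    have "u = (\<lambda>x. (f x - g x) * ?A x + g x * (?A x + ?h x))" unfolding u by (simp add: algebra_simps)
    then show "u \<in> ideal2 ?A (quad_form (G + sq h))" unfolding B by (rule ideal2I[OF neg[OF fg] fg(2)])
  qed
  then show "meet_in_double_conic b q" unfolding meet_in_double_conic_def using G \<open>h \<noteq> 0\<close> by blast
qed

definition wide :: "('i \<Rightarrow> mat4 set) set" where
  "wide = {x \<in> points. inj x \<and> (\<forall>i. qrank (x i) \<ge> 3)}"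

lemma B25_iff_separate:
  "x \<in> B25 \<longleftrightarrow> x \<in> wide \<and> (\<forall>i. \<exists>G h. G \<in> x None - {0} \<and> G + sq h \<in> x (Some i) - {0})"
proof -
  have "meet_in_double_conic (x None) (x (Some i)) \<longleftrightarrow> (\<exists>G h. G \<in> x None - {0} \<and> G + sq h \<in> x (Some i) - {0})"
    if "x \<in> wide" for i
    using that by (intro meet_in_double_conic_iff) (auto simp: wide_def points_def inj_def)
  moreover have "x None \<noteq> x (Some i)" if "x \<in> wide" for i using that by (auto simp: wide_def inj_def)
  ultimately show ?thesis unfolding B25_def basket_for_def by (auto simp: wide_def points_def)
qed

text \<open>The representatives of the basket belonging to different \<open>i\<close> are rescaled
  to a common one, the factors being absorbed by the \<open>h i\<close>.\<close>

lemma B25_iff: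
  "x \<in> B25 \<longleftrightarrow> x \<in> wide \<and> (\<exists>G h. G \<in> x None - {0} \<and> (\<forall>i. G + sq (h i) \<in> x (Some i) - {0}))"
proof
  assume "x \<in> B25"
  then have w: "x \<in> wide" and ex: "\<And>i. \<exists>G h. G \<in> x None - {0} \<and> G + sq h \<in> x (Some i) - {0}"
    using B25_iff_separate by auto
  then have P: "x i \<in> P9" for i by (auto simp: wide_def points_def)
  define G where "G = rep x None"
  have G: "G \<in> x None - {0}" unfolding G_def using rep_in[of x None] P by blast
  have "\<exists>h. G + sq h \<in> x (Some i) - {0}" for i
  proof -
    obtain G' h where G': "G' \<in> x None - {0}" "G' + sq h \<in> x (Some i) - {0}" using ex by blast
    obtain k where k: "k \<noteq> 0" "G = smul k G'" using P9_proportional[OF P G'(1) G] by blast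
    have "smul k (G' + sq h) = G + sq (csqrt k *s h)"
      unfolding outer_csqrt k(2) by (simp add: vec_eq_iff algebra_simps)
    then show ?thesis using P9_smul[OF P G'(2) k(1)] by metis
  qed
  then obtain h where "\<And>i. G + sq (h i) \<in> x (Some i) - {0}" by metis
  then show "x \<in> wide \<and> (\<exists>G h. G \<in> x None - {0} \<and> (\<forall>i. G + sq (h i) \<in> x (Some i) - {0}))" using w G by blast
next
  assume "x \<in> wide \<and> (\<exists>G h. G \<in> x None - {0} \<and> (\<forall>i. G + sq (h i) \<in> x (Some i) - {0}))"
  then show "x \<in> B25" using B25_iff_separate by blast
qed

section \<open>Openness of the conditions on rank and distinctness\<close>

definition single :: "'i \<Rightarrow> 'i \<Rightarrow> nat" where
  "single i j = (if j = i then 1 else 0)"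

lemma mhom_single: "mhom (single i) (\<lambda>A. A i $ r $ s)"
  unfolding single_def by (rule mhom_entry)

lemma mhom_bil: "mhom (single i) (\<lambda>A. bil (A i) u v)"
proof -
  have "mhom (single i) (\<lambda>A. \<Sum>r\<in>UNIV. \<Sum>s\<in>UNIV. (u $ r * v $ s) * A i $ r $ s)"
    by (intro mhom_sum mhom_cmult mhom_single)
  then show ?thesis by (simp add: bil_def algebra_simps)
qed

lemma mhom_minor3: "(\<lambda>A. minor3 (A i) u v) \<in> multihom_polys"
proof -
  let ?d = "\<lambda>j. single i j + single i j + single i j"
  have "mhom ?d (\<lambda>A. minor3 (A i) u v)"
    unfolding minor3_def det_3 by (simp, intro mhom_add mhom_diff mhom_mult mhom_bil)
  then show ?thesis using multihom_polys_iff by blast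
qed

lemma mhom_cross: "(\<lambda>A. A i $ r $ s * A j $ u $ v - A i $ u $ v * A j $ r $ s) \<in> multihom_polys"
  using mhom_diff[OF mhom_mult[OF mhom_single mhom_single] mhom_mult[OF mhom_single mhom_single]]
  multihom_polys_iff by blast

lemma P9_neq_iff:
  assumes "p i \<in> P9" "p j \<in> P9"
  shows "p i \<noteq> p j \<longleftrightarrow> (\<exists>r s u v. rep p i $ r $ s * rep p j $ u $ v - rep p i $ u $ v * rep p j $ r $ s \<noteq> 0)"
proof
  assume ne: "p i \<noteq> p j"
  show "\<exists>r s u v. rep p i $ r $ s * rep p j $ u $ v - rep p i $ u $ v * rep p j $ r $ s \<noteq> 0"
  proof (rule ccontr)
    assume "\<not> ?thesis"
    then have z: "rep p i $ r $ s * rep p j $ u $ v = rep p i $ u $ v * rep p j $ r $ s" for r s u v by simp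
    note R = rep_in[of p i, OF assms(1)] rep_in[of p j, OF assms(2)]
    obtain r s where rs: "rep p i $ r $ s \<noteq> 0" using R(1) by (auto simp: vec_eq_iff)
    have "rep p j = smul (rep p j $ r $ s / rep p i $ r $ s) (rep p i)"
      using z[of r s] rs by (simp add: vec_eq_iff field_simps)
    then have "rep p j \<in> mat.span {rep p i}" by (metis mat.span_base mat.span_scale singletonI)
    then have "rep p j \<in> p i" using rep_span[of p i, OF assms(1)] by simp
    then show False using P9_eqI[OF assms, of "rep p j"] R ne by blast
  qed
next
  assume "\<exists>r s u v. rep p i $ r $ s * rep p j $ u $ v - rep p i $ u $ v * rep p j $ r $ s \<noteq> 0"
  then obtain r s u v where ne: "rep p i $ r $ s * rep p j $ u $ v \<noteq> rep p i $ u $ v * rep p j $ r $ s" by auto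
  show "p i \<noteq> p j"
  proof
    assume "p i = p j"
    then obtain k where "rep p j = smul k (rep p i)"
      using P9_proportional[OF assms(1) rep_in[of p i, OF assms(1)], of "rep p j"] rep_in[of p j, OF assms(2)] by auto
    then show False using ne by simp
  qed
qed

text \<open>Rank at least three means a nonzero minor of order three; distinctness of two points
  means a nonzero minor of order two of their coordinate vectors.\<close>

lemma open_wide: "openin zariski (wide :: ('i::finite \<Rightarrow> mat4 set) set)"
proof -
  define R where "R = (\<lambda>i::'i. \<Union>u. \<Union>v. nonvanishing (\<lambda>A. minor3 (A i) u v))"
  define N where "N = (\<lambda>(i::'i) j. \<Union>r. \<Union>s. \<Union>u. \<Union>v. nonvanishing (\<lambda>A. A i $ r $ s * A j $ u $ v - A i $ u $ v * A j $ r $ s))"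
  have oR: "openin zariski (R i)" for i
    unfolding R_def by (intro openin_Union ballI) (auto intro!: openin_Union openin_nonvanishing mhom_minor3)
  have oN: "openin zariski (N i j)" for i j
    unfolding N_def by (intro openin_Union ballI) (auto intro!: openin_Union openin_nonvanishing mhom_cross)
  have R: "x \<in> R i \<longleftrightarrow> x \<in> points \<and> qrank (x i) \<ge> 3" for x i
  proof (cases "x \<in> points")
    case True
    then have P: "x i \<in> P9" by (auto simp: points_def)
    have "qrank (x i) = rank (rep x i)" using qrank_eq[OF P] rep_in[of x i, OF P] by blast
    moreover have "rep x i \<in> Sym4" using P9_memD(2)[OF P] rep_in[of x i, OF P] by blast
    ultimately show ?thesis using True rank_ge_3_iff[of "rep x i"]
      unfolding R_def by (simp add: nonvanishing_iff[OF mhom_minor3])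
  qed (auto simp: R_def nonvanishing_iff[OF mhom_minor3])
  have N: "x \<in> N i j \<longleftrightarrow> x \<in> points \<and> x i \<noteq> x j" for x i j
  proof (cases "x \<in> points")
    case True
    then have "x i \<in> P9" "x j \<in> P9" by (auto simp: points_def)
    then show ?thesis using True P9_neq_iff[of x i j] unfolding N_def by (simp add: nonvanishing_iff[OF mhom_cross])
  qed (auto simp: N_def nonvanishing_iff[OF mhom_cross])
  have "wide = (\<Inter>(R ` UNIV)) \<inter> (\<Inter>((\<lambda>(i, j). N i j) ` {(i, j). i \<noteq> j}) \<inter> points)"
    unfolding wide_def inj_def using R N by auto
  moreover have "openin zariski (\<Inter>(R ` UNIV))" using oR by (intro openin_INT2) auto
  moreover have "openin zariski (\<Inter>((\<lambda>(i, j). N i j) ` {(i, j). i \<noteq> j}) \<inter> points)"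
  proof (cases "{(i::'i, j). i \<noteq> j} = {}")
    case True
    then show ?thesis using openin_topspace[of "zariski :: ('i \<Rightarrow> mat4 set) topology"] by simp
  next
    case False
    then have "openin zariski (\<Inter>((\<lambda>(i, j). N i j) ` {(i, j). i \<noteq> j}))" using oN by (intro openin_INT2) auto
    then show ?thesis using openin_topspace[of "zariski :: ('i \<Rightarrow> mat4 set) topology"] by (intro openin_Int) auto
  qed
  ultimately show ?thesis by (metis openin_Int)
qed

section \<open>The basket relation as a closed condition\<close>

lemma closed_zero_set:
  assumes "\<And>f. f \<in> Fs \<Longrightarrow> f \<in> multihom_polys"
  shows "closedin zariski {x \<in> points. \<forall>f\<in>Fs. f (rep x) = 0}"
proof -
  have "points - {x \<in> points. \<forall>f\<in>Fs. f (rep x) = 0} = (\<Union>f\<in>Fs. nonvanishing f)"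
    using assms nonvanishing_iff by blast
  moreover have "openin zariski (\<Union>f\<in>Fs. nonvanishing f)" using assms by (auto intro!: openin_Union openin_nonvanishing)
  ultimately show ?thesis by (auto simp: closedin_def)
qed

text \<open>Polarised minors: ordinary minors of order two for \<open>A = B\<close>, while two
  different arguments give the coefficients of the minors along a pencil.\<close>

definition minor2 :: "(4 \<times> 4 \<times> 4 \<times> 4) \<Rightarrow> mat4 \<Rightarrow> mat4 \<Rightarrow> complex" where
  "minor2 = (\<lambda>(r, s, u, v) A B. A $ r $ u * B $ s $ v - A $ r $ v * B $ s $ u)"

lemma minors2_vanish:
  assumes "A \<in> Sym4" "\<And>m. minor2 m A A = 0"
  shows "\<exists>h. A = sq h"
proof (cases "A = 0")
  case True
  then show ?thesis by (intro exI[of _ 0]) (simp add: vec_eq_iff)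
next
  case False
  then obtain r s where rs: "A $ r $ s \<noteq> 0" by (auto simp: vec_eq_iff)
  have m: "A $ r $ u * A $ s $ v = A $ r $ v * A $ s $ u" for r s u v
    using assms(2)[of "(r, s, u, v)"] by (simp add: minor2_def)
  have sym: "A $ i $ j = A $ j $ i" for i j using assms(1) by (simp add: Sym4_iff)
  have "A $ r $ r * A $ s $ s = A $ r $ s * A $ r $ s" using m[of r r s s] sym[of s r] by simp
  then have rr: "A $ r $ r \<noteq> 0" using rs by auto
  define c where "c = csqrt (A $ r $ r)"
  have c: "c * c = A $ r $ r" "c \<noteq> 0" using rr by (auto simp: c_def power2_eq_square[symmetric])
  have "A = sq ((1 / c) *s (\<chi> j. A $ r $ j))"
  proof -
    have "A $ i $ j * (c * c) = A $ r $ i * A $ r $ j" for i j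
      using m[of r j i r] sym[of i r] c(1) by (simp add: mult.commute)
    then show ?thesis using c(2) by (simp add: vec_eq_iff field_simps)
  qed
  then show ?thesis by blast
qed

text \<open>The binary quadratic forms \<open>t \<mapsto> minor2 m (Q + t G) (Q + t G)\<close> have a common root iff every two
  of their linear combinations do; the latter is expressed by resultants.\<close>

definition comb2 :: "((4 \<times> 4 \<times> 4 \<times> 4) \<Rightarrow> complex) \<Rightarrow> mat4 \<Rightarrow> mat4 \<Rightarrow> complex" where
  "comb2 \<mu> A B = (\<Sum>m\<in>UNIV. \<mu> m * minor2 m A B)"

text \<open>The resultant of two quadratic polynomials, up to sign the determinant of their Bezout
  matrix.\<close>

definition res2 :: "complex \<Rightarrow> complex \<Rightarrow> complex \<Rightarrow> complex \<Rightarrow> complex \<Rightarrow> complex \<Rightarrow> complex" where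
  "res2 a b c a' b' c' = (a * c' - a' * c) * (a * c' - a' * c) - (a * b' - a' * b) * (b * c' - b' * c)"

definition basket_res ::
    "((4 \<times> 4 \<times> 4 \<times> 4) \<Rightarrow> complex) \<Rightarrow> ((4 \<times> 4 \<times> 4 \<times> 4) \<Rightarrow> complex) \<Rightarrow> mat4 \<Rightarrow> mat4 \<Rightarrow> complex" where
  "basket_res \<mu> \<nu> G Q = res2 (comb2 \<mu> G G) (comb2 \<mu> G Q + comb2 \<mu> Q G) (comb2 \<mu> Q Q)
     (comb2 \<nu> G G) (comb2 \<nu> G Q + comb2 \<nu> Q G) (comb2 \<nu> Q Q)"

lemma comb2_pencil: "comb2 \<mu> (Q + smul t G) (Q + smul t G) =
    comb2 \<mu> G G * t\<^sup>2 + (comb2 \<mu> G Q + comb2 \<mu> Q G) * t + comb2 \<mu> Q Q"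
proof -
  have "minor2 m (Q + smul t G) (Q + smul t G) =
    minor2 m G G * t\<^sup>2 + (minor2 m G Q + minor2 m Q G) * t + minor2 m Q Q" for m
    by (simp add: minor2_def split_def power2_eq_square algebra_simps)
  then show ?thesis
    by (simp add: comb2_def sum.distrib sum_distrib_left sum_distrib_right algebra_simps)
qed

lemma res2_common_root:
  assumes "a * t\<^sup>2 + b * t + c = 0" "a' * t\<^sup>2 + b' * t + c' = (0::complex)"
  shows "res2 a b c a' b' c' = 0"
proof -
  have c: "c = - a * t\<^sup>2 - b * t" "c' = - a' * t\<^sup>2 - b' * t" using assms by algebra+
  show ?thesis unfolding res2_def c by algebra
qed

text \<open>One minor has a nonzero leading coefficient, hence two roots t1, t2, and each
  combination of minors vanishes at one of them. If neither root were common to all minors, a sum of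
  two minors nonzero at t1 and at t2 respectively would vanish at neither.\<close>

lemma common_root:
  assumes nz: "\<not> (\<forall>m. minor2 m G G = 0)" and R: "\<And>\<mu> \<nu>. basket_res \<mu> \<nu> G Q = 0"
  shows "\<exists>t. \<forall>m. minor2 m (Q + smul t G) (Q + smul t G) = 0"
proof -
  define e where "e = (\<lambda>m m' :: 4 \<times> 4 \<times> 4 \<times> 4. if m' = m then 1 else (0::complex))"
  have e: "comb2 (e m) A B = minor2 m A B" for m A B
  proof -
    have "comb2 (e m) A B = (\<Sum>m'\<in>UNIV. if m' = m then minor2 m A B else 0)"
      unfolding comb2_def e_def by (intro sum.cong) auto
    then show ?thesis by simp
  qed
  obtain m0 where a0: "minor2 m0 G G \<noteq> 0" using nz by blast
  define a where "a = minor2 m0 G G"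
  define b where "b = minor2 m0 G Q + minor2 m0 Q G"
  define c where "c = minor2 m0 Q Q"
  define s where "s = csqrt (b\<^sup>2 - 4 * a * c)"
  have s: "s\<^sup>2 = b\<^sup>2 - 4 * a * c" by (simp add: s_def)
  have a: "a \<noteq> 0" using a0 by (simp add: a_def)
  define t1 where "t1 = (- b + s) / (2 * a)"
  define t2 where "t2 = (- b - s) / (2 * a)"
  have bt: "b = - a * (t1 + t2)" using a by (simp add: t1_def t2_def field_simps)
  have "a * (t1 * t2) = (b\<^sup>2 - s\<^sup>2) / (4 * a)" using a by (simp add: t1_def t2_def field_simps power2_eq_square)
  then have ct: "c = a * (t1 * t2)" using a s by simp
  define g where "g = (\<lambda>\<nu> t. comb2 \<nu> (Q + smul t G) (Q + smul t G))"
  have root: "g \<nu> t1 = 0 \<or> g \<nu> t2 = 0" for \<nu>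
  proof -
    define a' where "a' = comb2 \<nu> G G"
    define b' where "b' = comb2 \<nu> G Q + comb2 \<nu> Q G"
    define c' where "c' = comb2 \<nu> Q Q"
    have "res2 a b c a' b' c' = 0"
      using R[of "e m0" \<nu>] by (simp add: basket_res_def e a_def b_def c_def a'_def b'_def c'_def)
    moreover have "res2 a b c a' b' c' = a\<^sup>2 * ((a' * t1\<^sup>2 + b' * t1 + c') * (a' * t2\<^sup>2 + b' * t2 + c'))"
      unfolding res2_def bt ct by algebra
    ultimately show ?thesis using a by (simp add: g_def comb2_pencil a'_def b'_def c'_def)
  qed
  have gm: "g (e m) t = minor2 m (Q + smul t G) (Q + smul t G)" for m t by (simp add: g_def e)
  have gsum: "g (\<lambda>x. e m x + e m' x) t = g (e m) t + g (e m') t" for m m' t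
    by (simp add: g_def comb2_def sum.distrib algebra_simps)
  show ?thesis
  proof (rule ccontr)
    assume no: "\<not> ?thesis"
    then obtain m1 where m1: "g (e m1) t1 \<noteq> 0" using gm by metis
    obtain m2 where m2: "g (e m2) t2 \<noteq> 0" using no gm by metis
    have "g (e m1) t2 = 0" "g (e m2) t1 = 0" using root[of "e m1"] root[of "e m2"] m1 m2 by auto
    then show False using root[of "\<lambda>x. e m1 x + e m2 x"] m1 m2 by (simp add: gsum)
  qed
qed

lemma mhom_basket_res: "(\<lambda>A. basket_res \<mu> \<nu> (A i) (A j)) \<in> multihom_polys"
proof -
  have m2: "mhom (\<lambda>k. single i k + single j k) (\<lambda>A. minor2 m (A i) (A j))" for i j m
    unfolding minor2_def split_def by (intro mhom_diff mhom_mult mhom_single)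
  have c: "mhom (\<lambda>k. single i k + single j k) (\<lambda>A. comb2 \<mu> (A i) (A j))" for i j \<mu>
    unfolding comb2_def by (intro mhom_sum mhom_cmult m2)
  have c': "mhom (\<lambda>k. single i k + single j k) (\<lambda>A. comb2 \<mu> (A j) (A i))" for \<mu>
    using c[of j i \<mu>] by (simp add: add.commute)
  have b: "mhom (\<lambda>k. single i k + single j k) (\<lambda>A. comb2 \<mu> (A i) (A j) + comb2 \<mu> (A j) (A i))" for \<mu>
    by (intro mhom_add c c')
  \<comment> \<open>The coefficients of t^2, t and 1 have bidegrees (2,0), (1,1) and (0,2) in the
    two matrices, so both terms of the resultant have bidegree (4,4).\<close>
  let ?d = "\<lambda>k. 4 * single i k + 4 * single j k"
  have ac: "mhom (\<lambda>k. 2 * single i k + 2 * single j k)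
    (\<lambda>A. comb2 \<mu> (A i) (A i) * comb2 \<nu> (A j) (A j) - comb2 \<nu> (A i) (A i) * comb2 \<mu> (A j) (A j))"
    using mhom_diff[OF mhom_mult[OF c[of i i \<mu>] c[of j j \<nu>]] mhom_mult[OF c[of i i \<nu>] c[of j j \<mu>]]]
    by (simp add: mult_2)
  note ab = mhom_diff[OF mhom_mult[OF c[of i i \<mu>] b[of \<nu>]] mhom_mult[OF c[of i i \<nu>] b[of \<mu>]]]
  have bc: "mhom (\<lambda>k. single i k + single j k + (single j k + single j k))
    (\<lambda>A. (comb2 \<mu> (A i) (A j) + comb2 \<mu> (A j) (A i)) * comb2 \<nu> (A j) (A j) -
      (comb2 \<nu> (A i) (A j) + comb2 \<nu> (A j) (A i)) * comb2 \<mu> (A j) (A j))"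
    by (intro mhom_diff mhom_mult b c)
  have e1: "(\<lambda>k. 2 * single i k + 2 * single j k + (2 * single i k + 2 * single j k)) = ?d" by auto
  have e2: "(\<lambda>k. single i k + single i k + (single i k + single j k) + (single i k + single j k + (single j k + single j k))) = ?d"
    by auto
  have "mhom ?d (\<lambda>A. basket_res \<mu> \<nu> (A i) (A j))"
    unfolding basket_res_def res2_def
    by (rule mhom_diff[OF mhom_mult[OF ac ac, unfolded e1] mhom_mult[OF ab bc, unfolded e2]])
  then show ?thesis using multihom_polys_iff by blast
qed

text \<open>The basket condition says that Q + t G is a square for some t, that is, that its minors
  of order two have a common root.\<close>

lemma basket_res_iff:
  assumes w: "x \<in> wide" and ij: "i \<noteq> j"
  shows "(\<exists>G h. G \<in> x i - {0} \<and> G + sq h \<in> x j - {0}) \<longleftrightarrow> (\<forall>\<mu> \<nu>. basket_res \<mu> \<nu> (rep x i) (rep x j) = 0)"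
proof -
  have P: "x i \<in> P9" "x j \<in> P9" using w by (auto simp: wide_def points_def)
  define G where "G = rep x i"
  define Q where "Q = rep x j"
  have G: "G \<in> x i - {0}" "Q \<in> x j - {0}" unfolding G_def Q_def using rep_in[of x i] rep_in[of x j] P by blast+
  have S: "G \<in> Sym4" "Q \<in> Sym4" using P9_memD(2) P G by blast+
  have r: "rank G \<ge> 3" "rank Q \<ge> 3" using w unfolding qrank_eq[OF P(1) G(1), symmetric] qrank_eq[OF P(2) G(2), symmetric]
    by (simp_all add: wide_def)
  show ?thesis unfolding G_def[symmetric] Q_def[symmetric]
  proof
    assume "\<exists>G h. G \<in> x i - {0} \<and> G + sq h \<in> x j - {0}"
    then obtain G' h where G': "G' \<in> x i - {0}" "G' + sq h \<in> x j - {0}" by blast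
    obtain k where k: "G' = smul k G" using P9_proportional[OF P(1) G(1) G'(1)] by blast
    obtain l where l: "Q = smul l (G' + sq h)" using P9_proportional[OF P(2) G'(2) G(2)] by blast
    have eq: "Q + smul (- l * k) G = sq (csqrt l *s h)" unfolding l k outer_csqrt by (simp add: vec_eq_iff algebra_simps)
    have "comb2 \<mu> (Q + smul (- l * k) G) (Q + smul (- l * k) G) = 0" for \<mu>
      unfolding eq comb2_def by (intro sum.neutral) (auto simp: minor2_def)
    then show "\<forall>\<mu> \<nu>. basket_res \<mu> \<nu> G Q = 0"
      unfolding basket_res_def comb2_pencil by (intro allI res2_common_root[of _ "- l * k"]) auto
  next
    assume R: "\<forall>\<mu> \<nu>. basket_res \<mu> \<nu> G Q = 0"
    have "\<not> (\<forall>m. minor2 m G G = 0)"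
    proof
      assume "\<forall>m. minor2 m G G = 0"
      then obtain h where "G = sq h" using minors2_vanish[OF S(1)] by blast
      then show False using r(1) rank_sq_le[of h] by simp
    qed
    then obtain t where "\<forall>m. minor2 m (Q + smul t G) (Q + smul t G) = 0" using common_root R by blast
    then obtain h where h: "Q + smul t G = sq h" using minors2_vanish Sym4_add Sym4_smul S by metis
    have "t \<noteq> 0" 
    proof
      assume "t = 0"
      then show False using h r(2) rank_sq_le[of h] by simp
    qed
    then have "smul (- t) G \<in> x i - {0}" by (intro P9_smul P G) auto
    moreover have "smul (- t) G + sq h = Q" unfolding h[symmetric] by (simp add: vec_eq_iff)
    ultimately show "\<exists>G h. G \<in> x i - {0} \<and> G + sq h \<in> x j - {0}" using G(2) by metis
  qed
qed

lemma quasi_projective_B25: "quasi_projective B25"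
proof -
  define Fs where "Fs = {(\<lambda>A. basket_res \<mu> \<nu> (A None) (A (Some i))) | \<mu> \<nu> (i :: 4). True}"
  define C where "C = {x \<in> points. \<forall>f\<in>Fs. f (rep x) = 0}"
  have "closedin zariski C" unfolding C_def
    by (rule closed_zero_set) (auto simp: Fs_def mhom_basket_res)
  moreover have "x \<in> B25 \<longleftrightarrow> x \<in> wide \<and> x \<in> C" for x
  proof (cases "x \<in> wide")
    case True
    then have "x \<in> points" by (auto simp: wide_def)
    then have "x \<in> C \<longleftrightarrow> (\<forall>i \<mu> \<nu>. basket_res \<mu> \<nu> (rep x None) (rep x (Some i)) = 0)"
      by (auto simp: C_def Fs_def)
    then show ?thesis using True B25_iff_separate[of x] basket_res_iff[OF True, of None] by auto
  qed (use B25_iff in blast)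
  then have "B25 = wide \<inter> C" by blast
  ultimately show ?thesis unfolding quasi_projective_def using open_wide by blast
qed

section \<open>Quadrilaterals\<close>

definition mcomb :: "('j::finite \<Rightarrow> mat4) \<Rightarrow> ('j \<Rightarrow> complex) \<Rightarrow> mat4" where
  "mcomb Q a = (\<Sum>i\<in>UNIV. smul (a i) (Q i))"

definition mindep :: "('j::finite \<Rightarrow> mat4) \<Rightarrow> bool" where
  "mindep Q \<longleftrightarrow> (\<forall>a. mcomb Q a = 0 \<longrightarrow> (\<forall>i. a i = 0))"

lemma mindepD: "mindep Q \<Longrightarrow> mcomb Q a = 0 \<Longrightarrow> a i = 0"
  by (simp add: mindep_def)

lemma P9_nonempty: "p \<in> P9 \<Longrightarrow> \<exists>A. A \<in> p - {0}"
  using rep_in[of "\<lambda>_. p" undefined] by auto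

lemma mcomb_add: "mcomb Q (\<lambda>i. a i + b i) = mcomb Q a + mcomb Q b"
  by (simp add: mcomb_def mat.scale_left_distrib sum.distrib)

lemma mcomb_scale: "mcomb Q (\<lambda>i. c * a i) = smul c (mcomb Q a)"
  by (simp add: mcomb_def mat.scale_sum_right)

lemma mcomb_diff: "mcomb Q (\<lambda>i. a i - b i) = mcomb Q a - mcomb Q b"
  using mcomb_add[of Q a "\<lambda>i. (-1) * b i"] mcomb_scale[of Q "-1" b] by simp

lemma mcomb_unit: "mcomb Q (\<lambda>i. if i = j then c else 0) = smul c (Q j)"
proof -
  have "mcomb Q (\<lambda>i. if i = j then c else 0) = (\<Sum>i\<in>UNIV. if i = j then smul c (Q i) else 0)"
    unfolding mcomb_def by (intro sum.cong) auto
  then show ?thesis by simp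
qed

lemma mcomb_inj: "mindep Q \<Longrightarrow> mcomb Q a = mcomb Q b \<Longrightarrow> a = b"
  using mcomb_diff[of Q a b] by (auto simp: mindep_def fun_eq_iff)

lemma mcomb_Sym4: "(\<And>i. Q i \<in> Sym4) \<Longrightarrow> mcomb Q a \<in> Sym4"
  unfolding mcomb_def by (intro mat.subspace_sum subspace_Sym4 Sym4_smul)

lemma mcomb_in_span: "(\<And>i. a i \<noteq> 0 \<Longrightarrow> Q i \<in> mat.span S) \<Longrightarrow> mcomb Q a \<in> mat.span S"
  unfolding mcomb_def
proof (rule mat.span_sum)
  fix i assume "\<And>i. a i \<noteq> 0 \<Longrightarrow> Q i \<in> mat.span S"
  then show "smul (a i) (Q i) \<in> mat.span S" by (cases "a i = 0") (auto intro: mat.span_scale mat.span_zero)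
qed

lemma mat_span_range: "mat.span (range Q) = range (mcomb Q)"
proof
  have "mat.subspace (range (mcomb Q))"
  proof (rule mat.subspaceI)
    show "0 \<in> range (mcomb Q)" by (rule range_eqI[of _ _ "\<lambda>_. 0"]) (simp add: mcomb_def)
    fix x y c assume "x \<in> range (mcomb Q)" "y \<in> range (mcomb Q)"
    then obtain a b where ab: "x = mcomb Q a" "y = mcomb Q b" by auto
    show "x + y \<in> range (mcomb Q)" unfolding ab mcomb_add[symmetric] by blast
    show "smul c x \<in> range (mcomb Q)" unfolding ab mcomb_scale[symmetric] by blast
  qed
  moreover have "range Q \<subseteq> range (mcomb Q)"
  proof
    fix x assume "x \<in> range Q"
    then obtain j where "x = mcomb Q (\<lambda>i. if i = j then 1 else 0)" by (auto simp: mcomb_unit)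
    then show "x \<in> range (mcomb Q)" by blast
  qed
  ultimately show "mat.span (range Q) \<subseteq> range (mcomb Q)" by (rule mat.span_minimal[rotated])
  show "range (mcomb Q) \<subseteq> mat.span (range Q)" by (auto intro: mcomb_in_span mat.span_base)
qed

text \<open>For four suitably scaled quadrics \<open>Q\<close>, the sides of the quadrilateral are the \<open>Lc Q J\<close> with three
  elements in \<open>J\<close>, and its vertices those with two.\<close>

definition Lc :: "('j::finite \<Rightarrow> mat4) \<Rightarrow> 'j set \<Rightarrow> mat4 set" where
  "Lc Q J = mcomb Q ` {a. (\<forall>i. i \<notin> J \<longrightarrow> a i = 0) \<and> sum a UNIV = 0}"

lemma LcE:
  assumes "x \<in> Lc Q J"
  obtains a where "x = mcomb Q a" "\<forall>i. i \<notin> J \<longrightarrow> a i = 0" "sum a UNIV = 0"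
  using assms by (auto simp: Lc_def)

lemma Lc_mono: "J \<subseteq> J' \<Longrightarrow> Lc Q J \<subseteq> Lc Q J'"
  unfolding Lc_def by (intro image_mono) auto

lemma Lc_Int:
  assumes "mindep Q"
  shows "Lc Q J \<inter> Lc Q J' = Lc Q (J \<inter> J')"
proof
  show "Lc Q J \<inter> Lc Q J' \<subseteq> Lc Q (J \<inter> J')"
  proof
    fix x assume "x \<in> Lc Q J \<inter> Lc Q J'"
    then have x: "x \<in> Lc Q J" "x \<in> Lc Q J'" by auto
    obtain a where a: "x = mcomb Q a" "\<forall>i. i \<notin> J \<longrightarrow> a i = 0" "sum a UNIV = 0" by (rule LcE[OF x(1)])
    obtain b where b: "x = mcomb Q b" "\<forall>i. i \<notin> J' \<longrightarrow> b i = 0" by (rule LcE[OF x(2)])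
    have "a = b" using mcomb_inj[OF assms] a(1) b(1) by simp
    then show "x \<in> Lc Q (J \<inter> J')" using a b by (auto simp: Lc_def)
  qed
  show "Lc Q (J \<inter> J') \<subseteq> Lc Q J \<inter> Lc Q J'" using Lc_mono by blast
qed

lemma Lc_subspace: "mat.subspace (Lc Q J)"
proof (rule mat.subspaceI)
  show "0 \<in> Lc Q J" unfolding Lc_def by (rule image_eqI[of _ _ "\<lambda>_. 0"]) (auto simp: mcomb_def)
  fix x y c assume "x \<in> Lc Q J" "y \<in> Lc Q J"
  then obtain a b where a: "x = mcomb Q a" "\<forall>i. i \<notin> J \<longrightarrow> a i = 0" "sum a UNIV = 0"
    and b: "y = mcomb Q b" "\<forall>i. i \<notin> J \<longrightarrow> b i = 0" "sum b UNIV = 0" by (auto simp: Lc_def)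
  show "x + y \<in> Lc Q J" unfolding a(1) b(1) mcomb_add[symmetric] Lc_def
    using a b by (intro imageI) (auto simp: sum.distrib)
  show "smul c x \<in> Lc Q J" unfolding a(1) mcomb_scale[symmetric] Lc_def
    using a by (intro imageI) (auto simp: sum_distrib_left[symmetric])
qed

lemma Lc_Sym4: "(\<And>i. Q i \<in> Sym4) \<Longrightarrow> Lc Q J \<subseteq> Sym4"
  unfolding Lc_def using mcomb_Sym4 by blast

lemma dim_Lc:
  assumes Q: "mindep Q" and m: "m \<in> J"
  shows "mat.dim (Lc Q J) = card J - 1"
proof -
  let ?f = "\<lambda>i. Q i - Q m"
  have fin: "finite (J - {m})" by simp
  have expr: "mcomb Q (\<lambda>i. if i = m then - sum c (J - {m}) else if i \<in> J then c i else 0) = (\<Sum>i\<in>J - {m}. smul (c i) (?f i))" for c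
  proof -
    have "mcomb Q (\<lambda>i. if i = m then - sum c (J - {m}) else if i \<in> J then c i else 0)
      = smul (- sum c (J - {m})) (Q m) + (\<Sum>i\<in>UNIV - {m}. smul (if i \<in> J then c i else 0) (Q i))"
      unfolding mcomb_def by (subst sum.remove[of UNIV m]) auto
    also have "(\<Sum>i\<in>UNIV - {m}. smul (if i \<in> J then c i else 0) (Q i)) = (\<Sum>i\<in>J - {m}. smul (c i) (Q i))"
      by (rule sum.mono_neutral_cong_right) auto
    finally show ?thesis by (simp add: mat.scale_right_diff_distrib sum_subtractf mat.scale_sum_left sum_negf mat.scale_minus_left)
  qed
  have rel: "c i = 0" if c: "(\<Sum>i\<in>J - {m}. smul (c i) (?f i)) = 0" and i: "i \<in> J - {m}" for c i
  proof -
    have "(if i = m then - sum c (J - {m}) else if i \<in> J then c i else 0) = 0"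
      using Q c unfolding mindep_def expr[symmetric] by blast
    then show ?thesis using i by simp
  qed
  have inj: "inj_on ?f (J - {m})"
  proof (rule inj_onI, rule ccontr)
    fix i j assume ij: "i \<in> J - {m}" "j \<in> J - {m}" "?f i = ?f j" "i \<noteq> j"
    have "mcomb Q (\<lambda>k. (if k = i then 1 else 0) - (if k = j then 1 else 0)) = Q i - Q j"
      unfolding mcomb_diff mcomb_unit by simp
    also have "\<dots> = 0" using ij(3) by simp
    finally have z: "mcomb Q (\<lambda>k. (if k = i then 1 else 0) - (if k = j then 1 else 0)) = 0" .
    from mindepD[OF Q z, of i] show False using ij(4) by simp
  qed
  have ind: "mat.independent (?f ` (J - {m}))"
  proof
    assume "mat.dependent (?f ` (J - {m}))"
    then obtain u where u: "\<exists>v\<in>?f ` (J - {m}). u v \<noteq> 0" "(\<Sum>v\<in>?f ` (J - {m}). smul (u v) v) = 0"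
      using mat.dependent_finite[of "?f ` (J - {m})"] fin by auto
    then have "(\<Sum>i\<in>J - {m}. smul (u (?f i)) (?f i)) = 0" using inj by (simp add: sum.reindex)
    then have "\<forall>i\<in>J - {m}. u (?f i) = 0" using rel[of "\<lambda>i. u (?f i)"] by simp
    then show False using u(1) by auto
  qed
  have "mat.span (?f ` (J - {m})) = Lc Q J"
  proof
    have "?f i \<in> Lc Q J" if "i \<in> J - {m}" for i
    proof -
      have "mcomb Q (\<lambda>k. (if k = i then 1 else 0) - (if k = m then 1 else 0)) = ?f i"
        unfolding mcomb_diff mcomb_unit by simp
      moreover have "sum (\<lambda>k. (if k = i then 1 else 0) - (if k = m then 1 else (0::complex))) UNIV = 0"
        by (simp add: sum_subtractf)
      ultimately show ?thesis unfolding Lc_def using that m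
        by (intro image_eqI[of _ _ "\<lambda>k. (if k = i then 1 else 0) - (if k = m then 1 else 0)"]) auto
    qed
    then show "mat.span (?f ` (J - {m})) \<subseteq> Lc Q J" by (intro mat.span_minimal Lc_subspace) auto
    show "Lc Q J \<subseteq> mat.span (?f ` (J - {m}))"
    proof
      fix x assume "x \<in> Lc Q J"
      then obtain a where a: "x = mcomb Q a" "\<forall>i. i \<notin> J \<longrightarrow> a i = 0" "sum a UNIV = 0" by (auto simp: Lc_def)
      have "sum a UNIV = a m + sum a (UNIV - {m})" by (rule sum.remove) auto
      also have "sum a (UNIV - {m}) = sum a (J - {m})" using a(2) by (intro sum.mono_neutral_right) auto
      finally have "a m = - sum a (J - {m})" using a(3) by (simp add: eq_neg_iff_add_eq_0)
      then have "a = (\<lambda>i. if i = m then - sum a (J - {m}) else if i \<in> J then a i else 0)" using a(2) by auto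
      then have "x = (\<Sum>i\<in>J - {m}. smul (a i) (?f i))" using a(1) expr[of a] by simp
      then show "x \<in> mat.span (?f ` (J - {m}))" by (auto intro!: mat.span_sum mat.span_scale intro: mat.span_base)
    qed
  qed
  then have "mat.dim (Lc Q J) = card (?f ` (J - {m}))" using mat.dim_span_eq_card_independent[OF ind] by simp
  then show ?thesis using inj m by (simp add: card_image)
qed

lemma proj_subspace_Lc:
  assumes "mindep Q" "\<And>i. Q i \<in> Sym4" "card J = d + 2"
  shows "proj_subspace d (Lc Q J)"
proof -
  obtain m where "m \<in> J" using assms(3) by fastforce
  then show ?thesis using dim_Lc[OF assms(1), of m J] assms(3) Lc_subspace[of Q J] Lc_Sym4[of Q J, OF assms(2)]
    by (simp add: proj_subspace_def)
qed

lemma dim_span_range: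
  assumes "mindep Q"
  shows "mat.dim (mat.span (range (Q :: 'j::finite \<Rightarrow> mat4))) = CARD('j)"
proof -
  have inj: "inj Q"
  proof (rule injI, rule ccontr)
    fix i j assume ij: "Q i = Q j" "i \<noteq> j"
    have "mcomb Q (\<lambda>k. (if k = i then 1 else 0) - (if k = j then 1 else 0)) = 0"
      unfolding mcomb_diff mcomb_unit using ij by simp
    from mindepD[OF assms this, of i] show False using ij(2) by simp
  qed
  have "mat.independent (range Q)"
  proof
    assume "mat.dependent (range Q)"
    then obtain u where u: "\<exists>v\<in>range Q. u v \<noteq> 0" "(\<Sum>v\<in>range Q. smul (u v) v) = 0"
      using mat.dependent_finite[of "range Q"] by auto
    then have "mcomb Q (\<lambda>i. u (Q i)) = 0" using inj by (simp add: sum.reindex mcomb_def)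
    then have "\<forall>i. u (Q i) = 0" using assms unfolding mindep_def by blast
    then show False using u(1) by auto
  qed
  then show ?thesis using mat.dim_span_eq_card_independent[of "range Q"] inj by (simp add: card_image)
qed

lemma proj_span_eq:
  assumes "\<And>i. i \<in> I \<Longrightarrow> q i \<in> P9" "\<And>i. i \<in> I \<Longrightarrow> Q i \<in> q i - {0}"
  shows "proj_span (q ` I) = mat.span (Q ` I)"
  unfolding proj_span_def
proof
  have "q i = mat.span {Q i}" if "i \<in> I" for i using P9_memD(1)[OF assms(1)[OF that] assms(2)[OF that]] .
  then have "\<Union>(q ` I) \<subseteq> mat.span (Q ` I)" using mat.span_mono[of "{Q _}" "Q ` I"] by blast
  then show "mat.span (\<Union>(q ` I)) \<subseteq> mat.span (Q ` I)" by (rule mat.span_minimal) auto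
  show "mat.span (Q ` I) \<subseteq> mat.span (\<Union>(q ` I))" using assms(2) by (intro mat.span_mono) auto
qed

lemma proj_subspace_0: "proj_subspace 0 p \<longleftrightarrow> p \<in> P9"
  by (simp add: P9_def)

text \<open>For coefficient sum zero the common summand \<open>G\<close> cancels and the independent
  squares remain. This is why the sides consist of cones and the vertices have rank two.\<close>

lemma rank_mcomb_squares:
  assumes h: "indepf UNIV h" and Q: "\<And>i. Q i = G + sq (h i)" and a: "sum a UNIV = 0"
  shows "rank (mcomb Q a) = card {i :: 4. a i \<noteq> 0}"
proof (rule rank_squares[where h = h and a = a])
  show "indepf {i. a i \<noteq> 0} h"
  proof -
    obtain k where k: "\<And>i j. dot (h i) (k j) = (if i = j then 1 else 0)"
      using indepf_dual[of UNIV h] h by auto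
    then show ?thesis by (intro dual_indepf[where k = k]) auto
  qed
  fix r s
  have "mcomb Q a $ r $ s = (\<Sum>i\<in>UNIV. a i * (G $ r $ s + h i $ r * h i $ s))"
    unfolding mcomb_def Q by (simp add: sum_component)
  also have "\<dots> = sum a UNIV * G $ r $ s + (\<Sum>i\<in>UNIV. a i * h i $ r * h i $ s)"
    by (simp add: sum_distrib_right sum.distrib algebra_simps)
  also have "\<dots> = (\<Sum>i\<in>UNIV. a i * h i $ r * h i $ s)" using a by simp
  also have "\<dots> = (\<Sum>i | a i \<noteq> 0. a i * h i $ r * h i $ s)" by (rule sum.mono_neutral_right) auto
  finally show "mcomb Q a $ r $ s = (\<Sum>i | a i \<noteq> 0. a i * h i $ r * h i $ s)" .
qed auto

lemma card4: "card (UNIV :: 4 set) = 4"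
  by simp

text \<open>A nonzero combination of sum zero has at least two nonzero coefficients. On the side
  omitting \<open>k\<close> there are at most three, and rank two means that a further one vanishes,
  which places the point on a second side.\<close>

lemma property_P_common_basket:
  fixes q :: "4 \<Rightarrow> mat4 set"
  assumes q: "\<And>i. q i \<in> P9" and QS: "\<And>i. Q i \<in> q i - {0}" and h: "indepf UNIV h"
    and Q: "\<And>i. Q i = G + sq (h i)" and ind: "mindep Q"
  shows "property_P q"
proof -
  have S: "Q i \<in> Sym4" for i using P9_memD(2)[OF q QS] .
  define L where "L = (\<lambda>k. Lc Q (UNIV - {k}))"
  have span: "proj_span (range q) = range (mcomb Q)"
    using proj_span_eq[of UNIV q Q] q QS by (simp add: mat_span_range)
  have c1: "card (UNIV - {k :: 4}) = 3" for k using card4 by (simp add: card_Diff_singleton)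
  have c2: "card (UNIV - {k, l :: 4}) = 2" if "k \<noteq> l" for k l
    using card4 that by (simp add: card_Diff_subset)
  have c3: "card (UNIV - {k, l, m :: 4}) = 1" if "k \<noteq> l" "k \<noteq> m" "l \<noteq> m" for k l m
    using card4 that by (simp add: card_Diff_subset)
  have LL: "L k \<inter> L l = Lc Q (UNIV - {k, l})" for k l
    unfolding L_def Lc_Int[OF ind] by (intro arg_cong[of _ _ "Lc Q"]) auto
  have L1: "proj_subspace 1 (L k)" for k unfolding L_def
    by (rule proj_subspace_Lc[OF ind S]) (simp add: c1)
  have LL0: "L k \<inter> L l \<in> P9" if "k \<noteq> l" for k l
    unfolding LL proj_subspace_0[symmetric] by (rule proj_subspace_Lc[OF ind S]) (simp add: c2[OF that])
  have cq: "complete_quadrilateral L"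
    unfolding complete_quadrilateral_def
  proof (intro conjI allI impI)
    show "inj L"
    proof (rule injI, rule ccontr)
      fix k l assume kl: "L k = L l" "k \<noteq> l"
      then have "L k \<in> P9" using LL0[OF kl(2)] by simp
      then show False using L1[of k] by (simp add: P9_def proj_subspace_def)
    qed
    show "\<exists>E. proj_subspace 2 E \<and> (\<forall>k. L k \<subseteq> E)"
      by (intro exI[of _ "Lc Q UNIV"] conjI allI proj_subspace_Lc[OF ind S])
        (auto simp: L_def intro: subsetD[OF Lc_mono, rotated])
    fix i j k :: 4 assume d: "i \<noteq> j \<and> i \<noteq> k \<and> j \<noteq> k"
    have "L i \<inter> L j \<inter> L k = Lc Q (UNIV - {i, j, k})"
      unfolding LL L_def Lc_Int[OF ind] by (intro arg_cong[of _ _ "Lc Q"]) auto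
    also have "\<dots> = {0}"
    proof -
      obtain m where m: "UNIV - {i, j, k} = {m}" using c3[of i j k] d card_1_singletonE by blast
      show ?thesis unfolding m
      proof
        show "{0} \<subseteq> Lc Q {m}" using mat.subspace_0[OF Lc_subspace] by auto
        show "Lc Q {m} \<subseteq> {0}"
        proof
          fix x assume "x \<in> Lc Q {m}"
          then obtain a where a: "x = mcomb Q a" "\<forall>i. i \<noteq> m \<longrightarrow> a i = 0" "sum a UNIV = 0" by (auto simp: Lc_def)
          have "sum a UNIV = (\<Sum>i\<in>{m}. a i)" using a(2) by (intro sum.mono_neutral_right) auto
          then have "a = (\<lambda>_. 0)" using a by (auto simp: fun_eq_iff)
          then show "x \<in> {0}" using a(1) by (simp add: mcomb_def)
        qed
      qed
    qed
    finally show "L i \<inter> L j \<inter> L k = {0}" .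
  qed (rule L1)
  have elem: thesis
    if AL: "A \<in> Lc Q J" and th: "\<And>a. A = mcomb Q a \<Longrightarrow> \<forall>i. i \<notin> J \<longrightarrow> a i = 0 \<Longrightarrow> rank A = card {i. a i \<noteq> 0} \<Longrightarrow> sum a UNIV = 0 \<Longrightarrow> thesis"
    for A J thesis
  proof -
    obtain a where a: "A = mcomb Q a" "\<forall>i. i \<notin> J \<longrightarrow> a i = 0" "sum a UNIV = 0" by (rule LcE[OF AL])
    then have "rank A = card {i. a i \<noteq> 0}" using rank_mcomb_squares[OF h Q a(3)] by simp
    then show thesis using th a by blast
  qed
  have poc: "pencil_of_cones (L k)" for k
    unfolding pencil_of_cones_def
  proof (intro conjI ballI impI L1)
    fix p assume p: "p \<in> P9" "p \<subseteq> L k"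
    obtain A where A: "A \<in> p - {0}" using P9_nonempty[OF p(1)] by blast
    then have "A \<in> Lc Q (UNIV - {k})" using p(2) by (auto simp: L_def)
    then obtain a where "A = mcomb Q a" and a: "\<forall>i. i \<notin> UNIV - {k} \<longrightarrow> a i = 0" "rank A = card {i. a i \<noteq> 0}"
      and "sum a UNIV = 0" by (rule elem)
    have "card {i. a i \<noteq> 0} \<le> card (UNIV - {k})" using a(1) by (intro card_mono) auto
    then show "qrank p \<le> 3" using qrank_eq[OF p(1) A] a(2) c1 by simp
  qed
  have vert: "L k \<inter> L l \<subseteq> proj_span {q i, q j}" if u: "{i, j, k, l} = UNIV" for i j k l
  proof
    fix A assume "A \<in> L k \<inter> L l"
    then obtain a where a: "A = mcomb Q a" "\<forall>i. i \<notin> UNIV - {k, l} \<longrightarrow> a i = 0"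
      unfolding LL by (rule LcE)
    have "proj_span {q i, q j} = mat.span (Q ` {i, j})" using proj_span_eq[of "{i, j}" q Q] q QS by simp
    moreover have "A \<in> mat.span (Q ` {i, j})" unfolding a(1)
    proof (rule mcomb_in_span)
      fix m assume "a m \<noteq> 0"
      then have "m \<noteq> k" "m \<noteq> l" using a(2) by auto
      then have "m \<in> {i, j}" using u by blast
      then show "Q m \<in> mat.span (Q ` {i, j})" by (auto intro: mat.span_base)
    qed
    ultimately show "A \<in> proj_span {q i, q j}" by simp
  qed
  have rk2: "{p \<in> P9. (\<exists>k. p \<subseteq> L k) \<and> qrank p = 2} = {L k \<inter> L l | k l. k \<noteq> l}"
  proof (intro set_eqI iffI)
    fix p assume "p \<in> {p \<in> P9. (\<exists>k. p \<subseteq> L k) \<and> qrank p = 2}"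
    then obtain k where p: "p \<in> P9" "p \<subseteq> L k" "qrank p = 2" by auto
    obtain A where A: "A \<in> p - {0}" using P9_nonempty[OF p(1)] by blast
    then have "A \<in> Lc Q (UNIV - {k})" using p(2) by (auto simp: L_def)
    then obtain a where a: "A = mcomb Q a" "\<forall>i. i \<notin> UNIV - {k} \<longrightarrow> a i = 0" "rank A = card {i. a i \<noteq> 0}" "sum a UNIV = 0"
      by (rule elem)
    have c: "card {i. a i \<noteq> 0} = 2" using qrank_eq[OF p(1) A] a(3) p(3) by simp
    have "\<exists>l. l \<noteq> k \<and> a l = 0"
    proof (rule ccontr)
      assume "\<not> ?thesis"
      then have "{i. a i \<noteq> 0} = UNIV - {k}" using a(2) by auto
      then show False using c c1[of k] by simp
    qed
    then obtain l where l: "l \<noteq> k" "a l = 0" by blast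
    have "A \<in> L k \<inter> L l" unfolding LL Lc_def a(1) using a(2,4) l by (intro imageI) auto
    then have "p = L k \<inter> L l" using P9_eqI[OF p(1) LL0[of k l]] A l(1) by blast
    then show "p \<in> {L k \<inter> L l | k l. k \<noteq> l}" using l(1) by blast
  next
    fix p assume "p \<in> {L k \<inter> L l | k l. k \<noteq> l}"
    then obtain k l where kl: "p = L k \<inter> L l" "k \<noteq> l" by blast
    have p: "p \<in> P9" using LL0[OF kl(2)] kl(1) by simp
    obtain A where A: "A \<in> p - {0}" using P9_nonempty[OF p] by blast
    then have "A \<in> Lc Q (UNIV - {k, l})" unfolding kl(1) LL by blast
    then obtain a where a: "A = mcomb Q a" "\<forall>i. i \<notin> UNIV - {k, l} \<longrightarrow> a i = 0" "rank A = card {i. a i \<noteq> 0}" "sum a UNIV = 0"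
      by (rule elem)
    have "card {i. a i \<noteq> 0} \<le> card (UNIV - {k, l})" using a(2) by (intro card_mono) auto
    moreover have "card {i. a i \<noteq> 0} \<noteq> 0"
    proof
      assume "card {i. a i \<noteq> 0} = 0"
      then have "a = (\<lambda>_. 0)" by (auto simp: fun_eq_iff)
      then show False using A a(1) by (simp add: mcomb_def)
    qed
    moreover have "card {i. a i \<noteq> 0} \<noteq> 1"
    proof
      assume "card {i. a i \<noteq> 0} = 1"
      then obtain m where m: "{i. a i \<noteq> 0} = {m}" using card_1_singletonE by blast
      then have "sum a UNIV = (\<Sum>i\<in>{m}. a i)" by (intro sum.mono_neutral_right) auto
      then show False using a(4) m by auto
    qed
    ultimately have "rank A = 2" using c2[OF kl(2)] a(3) by linarith
    then show "p \<in> {p \<in> P9. (\<exists>k. p \<subseteq> L k) \<and> qrank p = 2}"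
      using qrank_eq[OF p A] p kl(1) by auto
  qed
  show ?thesis unfolding property_P_def
  proof (intro conjI exI[of _ L] allI impI)
    show "proj_subspace 3 (proj_span (range q))"
    proof -
      have "mat.subspace (range (mcomb Q))" using mat.subspace_span[of "range Q"] by (simp only: mat_span_range)
      moreover have "mat.dim (range (mcomb Q)) = 4" using dim_span_range[OF ind] by (simp add: mat_span_range)
      ultimately show ?thesis
        unfolding span proj_subspace_def using mcomb_Sym4[of Q, OF S] by auto
    qed
    show "L k \<subseteq> proj_span (range q)" for k unfolding span L_def Lc_def by blast
  qed (use cq poc vert rk2 in auto)
qed

section \<open>From the quadrilateral to representatives of the quadrics\<close>

lemma dim_relation:
  assumes "mat.dim L < card J" "mat.dim L \<noteq> 0" "finite J" "\<And>j. j \<in> J \<Longrightarrow> f j \<in> L"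
  shows "\<exists>c. (\<exists>j\<in>J. c j \<noteq> 0) \<and> (\<Sum>j\<in>J. smul (c j) (f j)) = 0"
proof (cases "inj_on f J")
  case True
  obtain B where B: "B \<subseteq> L" "mat.independent B" "L \<subseteq> mat.span B" "card B = mat.dim L"
    using mat.basis_exists by blast
  \<comment> \<open>An infinite basis would have cardinality 0; this is where the nonzero dimension
    enters.\<close>
  have "finite B" using B(4) assms(2) card.infinite by fastforce
  have "\<not> mat.independent (f ` J)"
  proof
    assume "mat.independent (f ` J)"
    then have "card (f ` J) \<le> card B"
      using mat.independent_span_bound[OF \<open>finite B\<close>] assms(4) B(3) by blast
    then show False using assms(1) B(4) True by (simp add: card_image)
  qed
  then obtain u where "\<exists>v\<in>f ` J. u v \<noteq> 0" "(\<Sum>v\<in>f ` J. smul (u v) v) = 0"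
    using mat.dependent_finite[of "f ` J"] assms(3) by auto
  then show ?thesis using True by (intro exI[of _ "\<lambda>j. u (f j)"]) (auto simp: sum.reindex)
next
  case False
  then obtain i j where ij: "i \<in> J" "j \<in> J" "i \<noteq> j" "f i = f j" by (auto simp: inj_on_def)
  define c where "c = (\<lambda>k. if k = i then 1 else if k = j then -1 else (0::complex))"
  have "(\<Sum>k\<in>J. smul (c k) (f k)) = (\<Sum>k\<in>{i,j}. smul (c k) (f k))"
    by (rule sum.mono_neutral_right) (use assms ij in \<open>auto simp: c_def\<close>)
  also have "\<dots> = 0" using ij by (simp add: c_def)
  finally show ?thesis using ij by (intro exI[of _ c]) (auto simp: c_def)
qed

lemma mindep_dim:
  fixes A :: "4 \<Rightarrow> mat4"
  assumes "mat.dim (mat.span (range A)) = 4"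
  shows "mindep A"
  unfolding mindep_def
proof (intro allI impI, rule ccontr)
  fix a j assume a: "mcomb A a = 0" "a j \<noteq> 0"
  let ?B = "A ` (UNIV - {j})"
  have "smul (a j) (A j) + (\<Sum>i\<in>UNIV - {j}. smul (a i) (A i)) = 0"
    using a(1) unfolding mcomb_def by (subst (asm) sum.remove[of UNIV j]) auto
  then have "smul (a j) (A j) = - (\<Sum>i\<in>UNIV - {j}. smul (a i) (A i))" by (simp add: eq_neg_iff_add_eq_0)
  also have "\<dots> \<in> mat.span ?B" by (intro mat.span_neg mat.span_sum mat.span_scale) (auto intro: mat.span_base)
  finally have "smul (1 / a j) (smul (a j) (A j)) \<in> mat.span ?B" by (rule mat.span_scale)
  then have "A j \<in> mat.span ?B" using a(2) by simp
  then have "A i \<in> mat.span ?B" for i by (cases "i = j") (auto intro: mat.span_base)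
  then have "mat.span (range A) \<subseteq> mat.span ?B" by (intro mat.span_minimal) auto
  then have "4 \<le> card ?B" using mat.dim_le_card[of "mat.span (range A)" ?B] assms by simp
  also have "\<dots> \<le> card (UNIV - {j})" by (intro card_image_le) auto
  also have "\<dots> = 3" using card4 by (simp add: card_Diff_singleton)
  finally show False by simp
qed

lemma fourth_index:
  assumes "i \<noteq> j" "i \<noteq> k" "j \<noteq> (k :: 4)"
  shows "\<exists>l. {i, j, k, l} = UNIV \<and> l \<noteq> i \<and> l \<noteq> j \<and> l \<noteq> k"
proof -
  have "card (UNIV - {i, j, k}) = 1" using card4 assms by (simp add: card_Diff_subset)
  then obtain l where "UNIV - {i, j, k} = {l}" using card_1_singletonE by blast
  then show ?thesis by blast
qed

lemma two_other_indices:
  assumes "i \<noteq> (j :: 4)"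
  shows "\<exists>k l. {i, j, k, l} = UNIV \<and> k \<noteq> l \<and> k \<noteq> i \<and> k \<noteq> j \<and> l \<noteq> i \<and> l \<noteq> j"
proof -
  have "card (UNIV - {i, j}) = 2" using card4 assms by (simp add: card_Diff_subset)
  then have "UNIV - {i, j} \<noteq> {}" by (metis card.empty zero_neq_numeral)
  then obtain k where "k \<noteq> i" "k \<noteq> j" by blast
  then show ?thesis using fourth_index[of i j k] assms by auto
qed

text \<open>The vertices of the quadrilateral determine scalings of the four quadrics, consistent by the
  collinearity of the vertices, for which the vertices become the differences.\<close>

lemma property_P_representatives:
  assumes "q \<in> quadruples_with_P"
  shows "\<exists>Q. (\<forall>i. Q i \<in> q i - {0}) \<and> (\<forall>i. Q i \<in> Sym4) \<and> (\<forall>i j. i \<noteq> j \<longrightarrow> rank (Q i - Q j) = 2) \<and>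
    (\<forall>i j k s t. i \<noteq> j \<longrightarrow> i \<noteq> k \<longrightarrow> j \<noteq> k \<longrightarrow>
      rank (smul s (Q i - Q k) + smul t (Q j - Q k)) \<le> 3 \<and>
      (s \<noteq> 0 \<longrightarrow> t \<noteq> 0 \<longrightarrow> s + t \<noteq> 0 \<longrightarrow> rank (smul s (Q i - Q k) + smul t (Q j - Q k)) \<noteq> 2))"
proof -
  have P: "q i \<in> P9" and r3: "qrank (q i) \<ge> 3" for i using assms by (auto simp: quadruples_with_P_def)
  have "property_P q" using assms by (auto simp: quadruples_with_P_def)
  then obtain L where dim: "mat.dim (proj_span (range q)) = 4" and cq: "complete_quadrilateral L"
    and poc: "\<And>k. pencil_of_cones (L k)"
    and vert: "\<And>i j k l. {i, j, k, l} = UNIV \<Longrightarrow> L k \<inter> L l \<subseteq> proj_span {q i, q j}"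
    and rk2: "{p \<in> P9. (\<exists>k. p \<subseteq> L k) \<and> qrank p = 2} = {L k \<inter> L l | k l. k \<noteq> l}"
    unfolding property_P_def by (auto simp: proj_subspace_def)
  have L1: "mat.subspace (L k)" "L k \<subseteq> Sym4" "mat.dim (L k) = 2" for k
    using cq by (auto simp: complete_quadrilateral_def proj_subspace_def)
  define A where "A = rep q"
  have A: "A i \<in> q i - {0}" for i unfolding A_def using rep_in[of q] P by blast
  have AS: "A i \<in> Sym4" for i using P9_memD(2)[OF P A] .
  have Ar: "rank (A i) \<ge> 3" for i using qrank_eq[OF P A] r3[of i] by simp
  have ind: "mindep A" using dim proj_span_eq[of UNIV q A] P A by (intro mindep_dim) auto
  have pair: "proj_span {q i, q j} = mat.span (A ` {i, j})" for i j using proj_span_eq[of "{i, j}" q A] P A by simp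
  have span2: "\<exists>a b. x = smul a (A i) + smul b (A j)" if "x \<in> proj_span {q i, q j}" for x i j
  proof -
    have "x \<in> mat.span {A i, A j}" using that pair by simp
    then obtain k where "x - smul k (A i) \<in> mat.span {A j}" using mat.span_breakdown_eq by blast
    then obtain l where "x - smul k (A i) = smul l (A j)" by (auto simp: mat.span_singleton)
    then show ?thesis by (metis add.commute diff_add_cancel)
  qed
  \<comment> \<open>The vertex on the line through \<open>q i\<close> and \<open>q j\<close> is
    neither end point, as it has rank two and they have rank at least three; so it can be scaled to
    A_i - r A_j with r nonzero.\<close>
  have V: "\<exists>r. r \<noteq> 0 \<and> rank (A i - smul r (A j)) = 2 \<and> (\<forall>k. k \<noteq> i \<longrightarrow> k \<noteq> j \<longrightarrow> A i - smul r (A j) \<in> L k)"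
    if ij: "i \<noteq> j" for i j
  proof -
    obtain k l where kl: "{i, j, k, l} = UNIV" "k \<noteq> l" "k \<noteq> i" "k \<noteq> j" "l \<noteq> i" "l \<noteq> j"
      using two_other_indices[OF ij] by blast
    have "L k \<inter> L l \<in> {p \<in> P9. (\<exists>k. p \<subseteq> L k) \<and> qrank p = 2}" unfolding rk2 using kl(2) by blast
    then have p: "L k \<inter> L l \<in> P9" "qrank (L k \<inter> L l) = 2" by auto
    obtain N where N: "N \<in> L k \<inter> L l - {0}" using P9_nonempty[OF p(1)] by blast
    have Nr: "rank N = 2" using qrank_eq[OF p(1) N] p(2) by simp
    have "N \<in> proj_span {q i, q j}" using vert[OF kl(1)] N by blast
    then obtain a b where ab: "N = smul a (A i) + smul b (A j)" using span2 by blast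
    have a0: "a \<noteq> 0"
    proof
      assume "a = 0"
      then have "N = smul b (A j)" "b \<noteq> 0" using ab N by auto
      then show False using Nr Ar[of j] by (simp add: rank_smul)
    qed
    have b0: "b \<noteq> 0"
    proof
      assume "b = 0"
      then have "N = smul a (A i)" using ab by auto
      then show False using Nr Ar[of i] a0 by (simp add: rank_smul)
    qed
    have eq: "smul (1 / a) N = A i - smul (- b / a) (A j)" using a0 unfolding ab by (simp add: vec_eq_iff field_simps)
    show ?thesis
    proof (intro exI[of _ "- b / a"] conjI allI impI)
      show "rank (A i - smul (- b / a) (A j)) = 2" unfolding eq[symmetric] using a0 Nr by (simp add: rank_smul)
      fix m assume "m \<noteq> i" "m \<noteq> j"
      then have "m \<in> {k, l}" using kl(1) by blast
      then have "N \<in> L m" using N by blast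
      then show "A i - smul (- b / a) (A j) \<in> L m" unfolding eq[symmetric] using L1(1) mat.subspace_scale by blast
    qed (use a0 b0 in auto)
  qed
  then have "\<forall>i j. \<exists>r. i \<noteq> j \<longrightarrow> r \<noteq> 0 \<and> rank (A i - smul r (A j)) = 2 \<and> (\<forall>k. k \<noteq> i \<longrightarrow> k \<noteq> j \<longrightarrow> A i - smul r (A j) \<in> L k)"
    by blast
  then obtain r where r: "\<And>i j. i \<noteq> j \<Longrightarrow> r i j \<noteq> 0" "\<And>i j. i \<noteq> j \<Longrightarrow> rank (A i - smul (r i j) (A j)) = 2"
    "\<And>i j k. i \<noteq> j \<Longrightarrow> k \<noteq> i \<Longrightarrow> k \<noteq> j \<Longrightarrow> A i - smul (r i j) (A j) \<in> L k" by metis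
  \<comment> \<open>The three vertices on the lines joining \<open>q i\<close>, \<open>q j\<close>,
    \<open>q k\<close> lie on the side of the fourth index, a space of linear dimension two. The
    resulting relation, compared at the independent \<open>A\<close>, yields the equation.\<close>
  have cocycle: "r i j * r j k = r i k" if d: "i \<noteq> j" "i \<noteq> k" "j \<noteq> k" for i j k
  proof -
    obtain l where l: "l \<noteq> i" "l \<noteq> j" "l \<noteq> k" using fourth_index[OF d] by blast
    define f where "f = (\<lambda>n::nat. if n = 0 then A i - smul (r i j) (A j) else if n = 1 then A j - smul (r j k) (A k)
      else A i - smul (r i k) (A k))"
    have fL: "f n \<in> L l" for n using r(3) d l by (auto simp: f_def)
    obtain c where c: "\<exists>n\<in>{..<3}. c n \<noteq> 0" "(\<Sum>n<3. smul (c n) (f n)) = 0"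
      using dim_relation[of "L l" "{..<3}" f] L1(3)[of l] fL by auto
    define a where "a = (\<lambda>m. if m = i then c 0 + c 2 else if m = j then c 1 - c 0 * r i j
      else if m = k then - c 1 * r j k - c 2 * r i k else (0::complex))"
    have a_eq: "a = (\<lambda>m. (if m = i then c 0 + c 2 else 0) + ((if m = j then c 1 - c 0 * r i j else 0)
      + (if m = k then - c 1 * r j k - c 2 * r i k else 0)))" using d by (auto simp: a_def fun_eq_iff)
    have "mcomb A a = (\<Sum>n<3. smul (c n) (f n))"
      unfolding a_eq mcomb_add mcomb_unit using d
      by (simp add: numeral_3_eq_3 f_def vec_eq_iff algebra_simps numeral_2_eq_2)
    then have "\<forall>m. a m = 0" using ind c(2) unfolding mindep_def by simp
    then have "a i = 0" "a j = 0" "a k = 0" by auto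
    then have e: "c 2 = - c 0" "c 1 = c 0 * r i j" "c 1 * r j k + c 2 * r i k = 0"
      using d by (auto simp: a_def eq_neg_iff_add_eq_0 add.commute neg_eq_iff_add_eq_0)
    have "c 0 \<noteq> 0"
    proof
      assume "c 0 = 0"
      then have "c n = 0" if "n < 3" for n using e that by (auto simp: numeral_3_eq_3 less_Suc_eq numeral_2_eq_2)
      then show False using c(1) by auto
    qed
    moreover have "c 0 * (r i j * r j k - r i k) = 0" using e by (simp add: algebra_simps)
    ultimately show ?thesis by simp
  qed
  \<comment> \<open>With \<open>Q 4 = A 4\<close>, each other matrix is scaled so that
    \<open>Q 4 - Q i\<close> represents the vertex on its line; the cocycle relation extends this to
    all differences.\<close>
  define \<rho> where "\<rho> = (\<lambda>i. if i = 4 then 1 else r 4 i)"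
  define Q where "Q = (\<lambda>i. smul (\<rho> i) (A i))"
  have \<rho>0: "\<rho> i \<noteq> 0" for i using r(1)[of 4 i] by (auto simp: \<rho>_def)
  have QA: "Q i - Q j = smul (\<rho> i) (A i - smul (r i j) (A j))" if "i \<noteq> j" "j \<noteq> 4" for i j
  proof -
    have "\<rho> i * r i j = \<rho> j" using that cocycle[of 4 i j] by (auto simp: \<rho>_def)
    then show ?thesis by (simp add: Q_def vec_eq_iff algebra_simps)
  qed
  have diff: "Q i - Q j = smul c (A i' - smul (r i' j') (A j')) \<Longrightarrow> i' \<noteq> j' \<Longrightarrow> {i', j'} = {i, j} \<Longrightarrow> c \<noteq> 0 \<Longrightarrow>
      rank (Q i - Q j) = 2 \<and> (\<forall>k. k \<noteq> i \<longrightarrow> k \<noteq> j \<longrightarrow> Q i - Q j \<in> L k)" for i j i' j' c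
    using r(2,3)[of i' j'] L1(1) by (auto simp: rank_smul mat.subspace_scale doubleton_eq_iff)
  have D: "rank (Q i - Q j) = 2 \<and> (\<forall>k. k \<noteq> i \<longrightarrow> k \<noteq> j \<longrightarrow> Q i - Q j \<in> L k)" if ij: "i \<noteq> j" for i j
  proof (cases "j = 4")
    case False
    then show ?thesis using diff[OF QA[OF ij False] ij] \<rho>0 by blast
  next
    case True
    then have "i \<noteq> 4" using ij by auto
    then have "Q j - Q i = smul (\<rho> j) (A j - smul (r j i) (A i))" using QA[of j i] ij by auto
    then have "Q i - Q j = smul (- \<rho> j) (A j - smul (r j i) (A i))" by (simp add: vec_eq_iff algebra_simps)
    then show ?thesis using diff[of i j "- \<rho> j" j i] ij \<rho>0[of j] by (auto simp: insert_commute)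
  qed
  have QS: "Q i \<in> Sym4" for i unfolding Q_def using AS by (rule Sym4_smul)
  have Qind: "mindep Q" unfolding mindep_def
  proof (intro allI impI)
    fix a i assume "mcomb Q a = 0"
    then have "mcomb A (\<lambda>i. a i * \<rho> i) = 0" by (simp add: mcomb_def Q_def)
    then have "a i * \<rho> i = 0" using ind unfolding mindep_def by blast
    then show "a i = 0" using \<rho>0 by simp
  qed
  have T: "rank (smul s (Q i - Q k) + smul t (Q j - Q k)) \<le> 3 \<and>
      (s \<noteq> 0 \<longrightarrow> t \<noteq> 0 \<longrightarrow> s + t \<noteq> 0 \<longrightarrow> rank (smul s (Q i - Q k) + smul t (Q j - Q k)) \<noteq> 2)"
    if d: "i \<noteq> j" "i \<noteq> k" "j \<noteq> k" for i j k s t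
  proof -
    define X where "X = smul s (Q i - Q k) + smul t (Q j - Q k)"
    obtain l where l: "l \<noteq> i" "l \<noteq> j" "l \<noteq> k" using fourth_index[OF d] by blast
    have XL: "X \<in> L l" unfolding X_def using D[OF d(2)] D[OF d(3)] l L1(1)[of l]
      by (auto intro!: mat.subspace_add mat.subspace_scale)
    then have XS: "X \<in> Sym4" using L1(2) by blast
    have pX: "mat.span {X} \<in> P9" "X \<in> mat.span {X} - {0}" "mat.span {X} \<subseteq> L l" if "X \<noteq> 0"
      using XS XL that L1(1)[of l] mat.span_minimal[of "{X}" "L l"] by (auto simp: mat.span_base)
    have le: "rank X \<le> 3"
    proof (cases "X = 0")
      case True
      then show ?thesis using rank_zero_iff[of X] by simp
    next
      case False
      then have "qrank (mat.span {X}) \<le> 3" using pX[OF False] poc[of l] by (simp add: pencil_of_cones_def)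
      then show ?thesis using qrank_eq[OF pX(1,2)[OF False]] by simp
    qed
    \<comment> \<open>A member of rank two would be a vertex, hence a combination of two of the
      \<open>A\<close>, whereas \<open>X\<close> has three nonzero coefficients.\<close>
    have "rank X \<noteq> 2" if st: "s \<noteq> 0" "t \<noteq> 0" "s + t \<noteq> 0"
    proof
      assume r2: "rank X = 2"
      then have X0: "X \<noteq> 0" using rank_zero_iff[of X] by auto
      have "qrank (mat.span {X}) = 2" using qrank_eq[OF pX(1,2)[OF X0]] r2 by simp
      then have "mat.span {X} \<in> {p \<in> P9. (\<exists>k. p \<subseteq> L k) \<and> qrank p = 2}" using pX[OF X0] by blast
      then obtain m n where mn: "mat.span {X} = L m \<inter> L n" "m \<noteq> n" unfolding rk2 by blast
      obtain g h where gh: "{m, n, g, h} = UNIV" using two_other_indices[OF mn(2)] by blast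
      then have "{g, h, m, n} = UNIV" by blast
      then have "X \<in> proj_span {q g, q h}" using vert[of g h m n] mn(1) pX(2)[OF X0] by blast
      then obtain a b where ab: "X = smul a (A g) + smul b (A h)" using span2 by blast
      define u where "u = (\<lambda>x. (if x = i then s * \<rho> i else 0) + ((if x = j then t * \<rho> j else 0) + (if x = k then - (s + t) * \<rho> k else 0)))"
      have "mcomb A u = X" unfolding u_def mcomb_add mcomb_unit X_def Q_def by (simp add: vec_eq_iff algebra_simps)
      moreover have "mcomb A (\<lambda>x. (if x = g then a else 0) + (if x = h then b else 0)) = X"
        unfolding mcomb_add mcomb_unit ab by simp
      ultimately have u: "u x = (if x = g then a else 0) + (if x = h then b else 0)" for x
        using mcomb_inj[OF ind, of u "\<lambda>x. (if x = g then a else 0) + (if x = h then b else 0)"] by (auto simp: fun_eq_iff)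
      have "u i \<noteq> 0" "u j \<noteq> 0" "u k \<noteq> 0" using d st \<rho>0 by (auto simp: u_def add_eq_0_iff)
      then have "i \<in> {g, h}" "j \<in> {g, h}" "k \<in> {g, h}" using u[of i] u[of j] u[of k] by (auto split: if_splits)
      then show False using d by auto
    qed
    then show ?thesis using le unfolding X_def by blast
  qed
  have "Q i \<in> q i - {0}" for i unfolding Q_def using P9_smul[OF P A \<rho>0] .
  then show ?thesis using QS D T by (intro exI[of _ Q]) simp
qed

lemma quadruple_dichotomy:
  assumes "q \<in> quadruples_with_P" "\<not> admits_common_basket q"
  shows "\<exists>Q. (\<forall>i. Q i \<in> q i - {0}) \<and> (\<forall>i. Q i \<in> Sym4) \<and>
    ((\<exists>u v h. \<forall>i. Q i = sq u + sq v + sq (h i)) \<or> exceptional Q)"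
proof -
  have P: "q i \<in> P9" and r3: "qrank (q i) \<ge> 3" for i using assms by (auto simp: quadruples_with_P_def)
  have inj: "inj q" using assms by (auto simp: quadruples_with_P_def)
  from property_P_representatives[OF assms(1)] obtain Q where QT:
    "(\<forall>i. Q i \<in> q i - {0}) \<and> (\<forall>i. Q i \<in> Sym4) \<and> (\<forall>i j. i \<noteq> j \<longrightarrow> rank (Q i - Q j) = 2) \<and>
    (\<forall>i j k s t. i \<noteq> j \<longrightarrow> i \<noteq> k \<longrightarrow> j \<noteq> k \<longrightarrow>
      rank (smul s (Q i - Q k) + smul t (Q j - Q k)) \<le> 3 \<and>
      (s \<noteq> 0 \<longrightarrow> t \<noteq> 0 \<longrightarrow> s + t \<noteq> 0 \<longrightarrow> rank (smul s (Q i - Q k) + smul t (Q j - Q k)) \<noteq> 2))"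
    by (rule exE)
  then have Q: "\<And>i. Q i \<in> q i - {0}" "\<And>i. Q i \<in> Sym4" "\<And>i j. i \<noteq> j \<Longrightarrow> rank (Q i - Q j) = 2"
    by simp_all
  have T: "\<And>i j k s t. i \<noteq> j \<Longrightarrow> i \<noteq> k \<Longrightarrow> j \<noteq> k \<Longrightarrow> rank (smul s (Q i - Q k) + smul t (Q j - Q k)) \<le> 3"
      "\<And>i j k s t. i \<noteq> j \<Longrightarrow> i \<noteq> k \<Longrightarrow> j \<noteq> k \<Longrightarrow> s \<noteq> 0 \<Longrightarrow> t \<noteq> 0 \<Longrightarrow> s + t \<noteq> 0 \<Longrightarrow>
        rank (smul s (Q i - Q k) + smul t (Q j - Q k)) \<noteq> 2"
    using QT by simp_all
  have "(\<exists>G h. G \<in> Sym4 \<and> (\<forall>i. Q i = G + sq (h i))) \<or> exceptional Q"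
    by (rule quadruple_classification[of Q, OF Q(2,3) T])
  then consider G h where "G \<in> Sym4" "\<And>i. Q i = G + sq (h i)" | "exceptional Q" by blast
  then show ?thesis
  proof cases
    case (1 G h)
    have "rank G \<le> 2"
    proof (rule ccontr)
      assume "\<not> rank G \<le> 2"
      then have G3: "rank G \<ge> 3" by simp
      then have G0: "G \<noteq> 0" using rank_zero_iff[of G] by auto
      define b where "b = mat.span {G}"
      have b: "b \<in> P9" "G \<in> b - {0}" using 1(1) G0 by (auto simp: b_def mat.span_base)
      have rb: "qrank b \<ge> 3" using qrank_eq[OF b] G3 by simp
      have hn: "sq (h i) \<noteq> 0" for i
      proof
        assume z: "sq (h i) = 0"
        obtain j where "j \<noteq> i" using exhaust_4[of i] by (metis (full_types) zero_neq_one)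
        then have "rank (sq (h j)) = 2" using Q(3)[of j i] unfolding 1(2) z by simp
        then show False using rank_sq_le[of "h j"] by simp
      qed
      \<comment> \<open>If \<open>Q i\<close> were a multiple of \<open>G\<close>, the nonzero
        square \<open>sq (h i)\<close> would be one too, against the rank of
        \<open>G\<close>.\<close>
      have bq: "b \<noteq> q i" for i
      proof
        assume "b = q i"
        then obtain k where k: "Q i = smul k G" using P9_proportional[OF b(1) b(2), of "Q i"] Q(1)[of i] by blast
        then have e: "sq (h i) = smul (k - 1) G" unfolding 1(2) by (simp add: vec_eq_iff algebra_simps)
        then have "k - 1 \<noteq> 0" using hn[of i] by auto
        then have "rank (sq (h i)) = rank G" unfolding e by (rule rank_smul)
        then show False using G3 rank_sq_le[of "h i"] by simp
      qed
      have "case_option b q \<in> wide"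
        unfolding wide_def points_def inj_def
        using P r3 rb b(1) bq inj by (auto split: option.splits simp: inj_def)
      then have "case_option b q \<in> B25"
        unfolding B25_iff using b(2) Q(1) 1(2) by auto
      then show False using assms(2) unfolding admits_common_basket_def by blast
    qed
    then obtain u v where "G = sq u + sq v" using rank_le_2[OF 1(1)] by blast
    then show ?thesis using Q(1,2) 1(2) by (intro exI[of _ Q]) auto
  next
    case 2
    then show ?thesis using Q(1,2) by (intro exI[of _ Q]) auto
  qed
qed

section \<open>Families of bounded dimension\<close>

lemma poly_funs_sum: "(\<And>i. i \<in> I \<Longrightarrow> f i \<in> poly_funs X) \<Longrightarrow> (\<lambda>y. \<Sum>i\<in>I. f i y) \<in> poly_funs X"
  by (induction I rule: infinite_finite_induct) (auto intro: poly_funs.intros)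

lemma poly_funs_prod: "(\<And>i. i \<in> I \<Longrightarrow> f i \<in> poly_funs X) \<Longrightarrow> (\<lambda>y. \<Prod>i\<in>I. f i y) \<in> poly_funs X"
  by (induction I rule: infinite_finite_induct) (auto intro: poly_funs.intros)

lemma poly_funs_diff: "f \<in> poly_funs X \<Longrightarrow> g \<in> poly_funs X \<Longrightarrow> (\<lambda>y. f y - g y) \<in> poly_funs X"
  using poly_funs.add[OF _ poly_funs.mult[OF poly_funs.const[of "-1"]], of f X g] by simp

lemma poly_funs_uminus: "f \<in> poly_funs X \<Longrightarrow> (\<lambda>y. - f y) \<in> poly_funs X"
  using poly_funs.mult[OF poly_funs.const[of "-1"], of f X] by simp

lemma poly_funs_power: "f \<in> poly_funs X \<Longrightarrow> (\<lambda>y. f y ^ n) \<in> poly_funs X"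
  by (induction n) (auto intro: poly_funs.intros)

lemma poly_funs_divide: "f \<in> poly_funs X \<Longrightarrow> (\<lambda>y. f y / c) \<in> poly_funs X"
  using poly_funs.mult[OF poly_funs.const[of "1 / c"], of f X] by simp

lemmas poly_funs_intros = poly_funs.add poly_funs.mult poly_funs.const poly_funs_diff poly_funs_uminus
  poly_funs_sum poly_funs_prod poly_funs_power poly_funs_divide

lemma growth_quadratic':
  assumes "growth Y X m" "P \<in> poly_funs X" "R \<in> poly_funs X" "\<And>y. y \<in> Y \<Longrightarrow> (g y)\<^sup>2 = P y * g y + R y"
  shows "growth Y (insert g X) m"
proof -
  obtain c c' where "pdeg X c P" "pdeg X c' R" using poly_funs_pdeg assms(2,3) by blast
  then have "pdeg X (max c c') P" "pdeg X (max c c') R" by (auto elim!: pdeg_mono)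
  then show ?thesis by (rule growth_quadratic[OF assms(1)]) (rule assms(4))
qed

text \<open>The positions on and above the diagonal, which coordinatise symmetric matrices.\<close>

definition Pairs :: "(4 \<times> 4) set" where
  "Pairs = {(1,1), (2,2), (3,3), (4,4), (1,2), (1,3), (1,4), (2,3), (2,4), (3,4)}"

lemma Pairs_finite: "finite Pairs" by (simp add: Pairs_def)

lemma card_Pairs: "card Pairs = 10" by (simp add: Pairs_def)

lemma Pairs_cover: "(u, v) \<in> Pairs \<or> (v, u) \<in> Pairs"
  using exhaust_4[of u] exhaust_4[of v] by (auto simp: Pairs_def)

definition XM :: "(4 \<times> 4) set \<Rightarrow> ((mat4 \<times> 'z) \<Rightarrow> complex) set" where
  "XM S = (\<lambda>(u, v) y. fst y $ u $ v) ` S"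

lemma XM_poly: "(\<lambda>y :: mat4 \<times> 'z. fst y $ u $ v) \<in> poly_funs (XM UNIV \<union> X)"
proof -
  have "(\<lambda>y :: mat4 \<times> 'z. fst y $ u $ v) \<in> XM UNIV" unfolding XM_def by (rule image_eqI[of _ _ "(u, v)"]) auto
  then show ?thesis by (intro poly_funs.coord) simp
qed

lemma coord_poly:
  assumes "(j, s) \<in> S" "(\<lambda>(j, s) y. g y j $ s) ` S \<subseteq> X"
  shows "(\<lambda>y. g y j $ s) \<in> poly_funs X"
proof -
  have "(\<lambda>y. g y j $ s) \<in> (\<lambda>(j, s) y. g y j $ s) ` S" using assms(1) by (rule image_eqI[rotated]) auto
  then show ?thesis using assms(2) by (intro poly_funs.coord) blast
qed

lemma XM_card:
  assumes "(r, s) \<in> Pairs"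
  shows "finite (XM (Pairs - {(r, s)}))" "card (XM (Pairs - {(r, s)})) \<le> 9"
proof -
  show "finite (XM (Pairs - {(r, s)}))" unfolding XM_def using Pairs_finite by auto
  have "card (XM (Pairs - {(r, s)})) \<le> card (Pairs - {(r, s)})"
    unfolding XM_def using Pairs_finite by (intro card_image_le) auto
  also have "\<dots> = 9" using assms by (simp add: card_Pairs)
  finally show "card (XM (Pairs - {(r, s)})) \<le> 9" .
qed

text \<open>The common scaling factor is used to normalise one entry of the matrix to one, which leaves nine
  parameters for it.\<close>

lemma hgrow_normalised:
  fixes \<phi> :: "mat4 \<Rightarrow> 'z \<Rightarrow> 'i::finite \<Rightarrow> mat4"
  assumes T: "T \<subseteq> points"
    and phi: "\<And>i u v. (\<lambda>y. \<phi> (fst y) (snd y) i $ u $ v) \<in> poly_funs (XM UNIV \<union> X)"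
    and gr: "\<And>r s. (r, s) \<in> Pairs \<Longrightarrow>
      growth {y. fst y \<in> Sym4 \<and> fst y $ r $ s = 1 \<and> snd y \<in> R} (XM (Pairs - {(r, s)}) \<union> X) m"
    and cover: "\<And>p. p \<in> T \<Longrightarrow> \<exists>M. M \<in> Sym4 \<and> M \<noteq> 0 \<and>
      (\<forall>k. k \<noteq> 0 \<longrightarrow> (\<exists>\<zeta>\<in>R. \<forall>i. \<phi> (smul k M) \<zeta> i \<in> p i - {0}))"
  shows "hgrow T m"
proof -
  \<comment> \<open>One chart for each of the ten positions whose entry can be scaled to one; the
    quantifier over \<open>k\<close> in \<open>cover\<close> says that the family absorbs the
    rescaling.\<close>
  define Y where "Y = (\<lambda>(r, s). {y :: mat4 \<times> 'z. fst y \<in> Sym4 \<and> fst y $ r $ s = 1 \<and> snd y \<in> R})"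
  define T' where "T' = (\<lambda>rs. {p \<in> T. \<exists>y\<in>Y rs. \<forall>i. \<phi> (fst y) (snd y) i \<in> p i - {0}})"
  obtain D0 where D0: "\<And>i u v. pdeg (XM UNIV \<union> X) D0 (\<lambda>y. \<phi> (fst y) (snd y) i $ u $ v)"
    using poly_funs_pdeg_uniform[of "\<lambda>y. \<phi> (fst y) (snd y)", OF phi] by auto
  have "hgrow (T' rs) m" if rs: "rs \<in> Pairs" for rs
  proof (rule hgrow_family[where \<phi> = "\<lambda>y. \<phi> (fst y) (snd y)" and Y = "Y rs" and c = "1 * D0" and X = "XM (Pairs - {rs}) \<union> X"])
    show "T' rs \<subseteq> points" using T by (auto simp: T'_def)
    show "growth (Y rs) (XM (Pairs - {rs}) \<union> X) m" using gr[of "fst rs" "snd rs"] rs by (simp add: Y_def split_def)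
    show "\<exists>y\<in>Y rs. \<forall>i. \<phi> (fst y) (snd y) i \<in> p i - {0}" if "p \<in> T' rs" for p using that by (auto simp: T'_def)
    fix i u v
    show "\<exists>g. pdeg (XM (Pairs - {rs}) \<union> X) (1 * D0) g \<and> (\<forall>y\<in>Y rs. \<phi> (fst y) (snd y) i $ u $ v = g y)"
    proof (rule pdeg_subst[OF _ D0, where u = "\<lambda>y. y"])
      fix f assume f: "f \<in> XM UNIV \<union> X"
      show "\<exists>g. pdeg (XM (Pairs - {rs}) \<union> X) 1 g \<and> (\<forall>y\<in>Y rs. f y = g y)"
      proof (cases "f \<in> X")
        case True
        then have "pdeg (XM (Pairs - {rs}) \<union> X) 1 f" using pdeg_coord[of f] by simp
        then show ?thesis by blast
      next
        case False
        then obtain a b where ab: "f = (\<lambda>y. fst y $ a $ b)" using f by (auto simp: XM_def)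
        have "\<exists>c d. (c, d) \<in> Pairs \<and> (\<forall>y\<in>Y rs. f y = fst y $ c $ d)"
          using Pairs_cover[of a b]
        proof
          assume "(b, a) \<in> Pairs"
          moreover have "\<forall>y\<in>Y rs. f y = fst y $ b $ a" unfolding ab Y_def by (auto simp: Sym4_iff split_def)
          ultimately show ?thesis by blast
        qed (use ab in blast)
        then obtain c d where cd: "(c, d) \<in> Pairs" "\<forall>y\<in>Y rs. f y = fst y $ c $ d" by blast
        show ?thesis
        proof (cases "(c, d) = rs")
          case True
          then have "\<forall>y\<in>Y rs. f y = 1" using cd(2) by (auto simp: Y_def)
          then show ?thesis using pdeg.const[of _ 1 1] by (intro exI[of _ "\<lambda>_. 1"]) auto
        next
          case False
          then have "(\<lambda>y. fst y $ c $ d) \<in> XM (Pairs - {rs}) \<union> X" using cd(1) by (force simp: XM_def)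
          from pdeg_coord[OF this] have "pdeg (XM (Pairs - {rs}) \<union> X) 1 (\<lambda>y. fst y $ c $ d)" by simp
          then show ?thesis using cd(2) by blast
        qed
      qed
    qed
  qed
  then have "hgrow (\<Union>rs\<in>Pairs. T' rs) m" by (intro hgrow_UN Pairs_finite)
  moreover have "T \<subseteq> (\<Union>rs\<in>Pairs. T' rs)"
  proof
    fix p assume p: "p \<in> T"
    then obtain M where M: "M \<in> Sym4" "M \<noteq> 0" "\<And>k. k \<noteq> 0 \<Longrightarrow> \<exists>\<zeta>\<in>R. \<forall>i. \<phi> (smul k M) \<zeta> i \<in> p i - {0}"
      using cover by blast
    then obtain a b where ab: "M $ a $ b \<noteq> 0" by (auto simp: vec_eq_iff)
    have "M $ b $ a \<noteq> 0" using M(1) ab by (simp add: Sym4_iff)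
    then obtain r s where rs: "(r, s) \<in> Pairs" "M $ r $ s \<noteq> 0" using ab Pairs_cover[of a b] by blast
    then obtain \<zeta> where z: "\<zeta> \<in> R" "\<forall>i. \<phi> (smul (1 / M $ r $ s) M) \<zeta> i \<in> p i - {0}" using M(3)[of "1 / M $ r $ s"] by auto
    have "(smul (1 / M $ r $ s) M, \<zeta>) \<in> Y (r, s)" using rs(2) z(1) Sym4_smul[OF M(1)] by (simp add: Y_def)
    then have "p \<in> T' (r, s)" unfolding T'_def using p z(2) by force
    then show "p \<in> (\<Union>rs\<in>Pairs. T' rs)" using rs(1) by blast
  qed
  ultimately show ?thesis by (rule hgrow_subset)
qed

lemma growth_XM:
  assumes "(r, s) \<in> Pairs" "finite X" "card X \<le> n" "m = 9 + n"
  shows "growth Y (XM (Pairs - {(r, s)}) \<union> X) m"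
proof (rule growth_card)
  have "card (XM (Pairs - {(r, s)}) \<union> X) \<le> card (XM (Pairs - {(r, s)}) :: ((mat4 \<times> 'a) \<Rightarrow> complex) set) + card X"
    by (rule card_Un_le)
  also have "\<dots> \<le> m" using XM_card(2)[OF assms(1)] assms(3,4) by (metis add_mono)
  finally show "card (XM (Pairs - {(r, s)}) \<union> X) \<le> m" .
qed (use XM_card(1)[OF assms(1)] assms(2) in auto)

section \<open>Parameter counts for quintuples and for the bad loci\<close>

lemma B25_points: "B25 \<subseteq> points"
  using B25_iff by (auto simp: wide_def)

lemma B25E:
  assumes "x \<in> B25"
  obtains G h where "G \<in> x None - {0}" "\<And>i. G + sq (h i) \<in> x (Some i) - {0}" "G \<in> Sym4"
proof -
  obtain G h where Gh: "G \<in> x None - {0}" "\<And>i. G + sq (h i) \<in> x (Some i) - {0}" using assms B25_iff by blast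
  have "x None \<in> P9" using assms B25_points by (auto simp: points_def)
  then show ?thesis using that Gh P9_memD(2) by blast
qed

text \<open>Nine parameters for the normalised basket and sixteen for the linear forms. Scaling the
  basket by \<open>k\<close> is matched by scaling the forms by \<open>csqrt k\<close>.\<close>

lemma hgrow_B25: "hgrow B25 25"
proof (rule hgrow_normalised[OF B25_points, where R = UNIV and
    \<phi> = "\<lambda>M (h :: 4 \<Rightarrow> complex^4) i. case i of None \<Rightarrow> M | Some j \<Rightarrow> M + sq (h j)" and
    X = "(\<lambda>(j, s) y. snd y j $ s) ` UNIV"])
  fix i u v
  show "(\<lambda>y :: mat4 \<times> (4 \<Rightarrow> complex^4). (case i of None \<Rightarrow> fst y | Some j \<Rightarrow> fst y + sq (snd y j)) $ u $ v)
    \<in> poly_funs (XM UNIV \<union> range (\<lambda>(j, s) y. snd y j $ s))"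
    by (cases i) (auto intro!: poly_funs_intros XM_poly coord_poly[of _ _ UNIV])
next
  fix r s :: 4 assume rs: "(r, s) \<in> Pairs"
  have "card (range (\<lambda>(j, s) (y :: mat4 \<times> (4 \<Rightarrow> complex^4)). snd y j $ s)) \<le> 16"
    using card_image_le[of "UNIV :: (4 \<times> 4) set" "\<lambda>(j, s) (y :: mat4 \<times> (4 \<Rightarrow> complex^4)). snd y j $ s"] by simp
  then show "growth {y. fst y \<in> Sym4 \<and> fst y $ r $ s = 1 \<and> snd y \<in> UNIV}
    (XM (Pairs - {(r, s)}) \<union> range (\<lambda>(j, s) (y :: mat4 \<times> (4 \<Rightarrow> complex^4)). snd y j $ s)) 25"
    by (intro growth_XM[OF rs, of _ 16]) auto
next
  fix p :: "4 option \<Rightarrow> mat4 set" assume "p \<in> B25"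
  obtain G h where G: "G \<in> p None - {0}" "\<And>i. G + sq (h i) \<in> p (Some i) - {0}" "G \<in> Sym4"
    using B25E[OF \<open>p \<in> B25\<close>] by blast
  have P: "p i \<in> P9" for i using \<open>p \<in> B25\<close> B25_points by (auto simp: points_def)
  show "\<exists>M. M \<in> Sym4 \<and> M \<noteq> 0 \<and> (\<forall>k. k \<noteq> 0 \<longrightarrow>
     (\<exists>\<zeta>\<in>UNIV. \<forall>i. (case i of None \<Rightarrow> smul k M | Some j \<Rightarrow> smul k M + sq (\<zeta> j)) \<in> p i - {0}))"
  proof (intro exI[of _ G] conjI allI impI)
    fix k :: complex assume k: "k \<noteq> 0"
    have "(case i of None \<Rightarrow> smul k G | Some j \<Rightarrow> smul k G + sq (csqrt k *s h j)) \<in> p i - {0}" for i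
      using P9_smul[OF P G(1) k] P9_smul[OF P G(2) k]
      by (cases i) (auto simp: outer_csqrt mat.scale_right_distrib)
    then show "\<exists>\<zeta>\<in>UNIV. \<forall>i. (case i of None \<Rightarrow> smul k G | Some j \<Rightarrow> smul k G + sq (\<zeta> j)) \<in> p i - {0}"
      by (intro bexI[of _ "\<lambda>j. csqrt k *s h j"]) auto
  qed (use G in auto)
qed

definition dependent_locus :: "4 \<Rightarrow> (4 option \<Rightarrow> mat4 set) set" where
  "dependent_locus m = {x \<in> points. \<exists>G h c. G \<in> x None - {0} \<and> (\<forall>i. G + sq (h i) \<in> x (Some i) - {0}) \<and>
     h m = (\<Sum>j\<in>UNIV - {m}. c j *s h j)}"

text \<open>The form \<open>h m\<close> costs three coefficients in place of four coordinates: 9 +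
  12 + 3.\<close>

lemma hgrow_dependent_locus: "hgrow (dependent_locus m) 24"
proof -
  define H where "H = (\<lambda>\<zeta> :: (4 \<Rightarrow> complex^4) \<times> (4 \<Rightarrow> complex).
    \<lambda>j. if j = m then \<Sum>j\<in>UNIV - {m}. snd \<zeta> j *s fst \<zeta> j else fst \<zeta> j)"
  define \<phi> where "\<phi> = (\<lambda>M \<zeta> i. case i of None \<Rightarrow> M | Some j \<Rightarrow> M + sq (H \<zeta> j))"
  define X where "X = (\<lambda>(j, s) (y :: mat4 \<times> (4 \<Rightarrow> complex^4) \<times> (4 \<Rightarrow> complex)). fst (snd y) j $ s) ` ((UNIV - {m}) \<times> UNIV) \<union>
    (\<lambda>j y. snd (snd y) j) ` (UNIV - {m})"
  have c3: "card (UNIV - {m}) = 3" using card4 by (simp add: card_Diff_singleton)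
  have X: "finite X" "card X \<le> 15"
  proof -
    show "finite X" by (simp add: X_def)
    have "card X \<le> card ((UNIV - {m}) \<times> (UNIV :: 4 set)) + card (UNIV - {m})"
      unfolding X_def by (rule order_trans[OF card_Un_le add_mono]; rule card_image_le; simp)
    then show "card X \<le> 15" using c3 by (simp add: card_cartesian_product)
  qed
  have Hp: "(\<lambda>y. H (snd y) j $ s) \<in> poly_funs (XM UNIV \<union> X)" for j s
  proof (cases "j = m")
    case True
    have "(\<lambda>y. \<Sum>j\<in>UNIV - {m}. snd (snd y) j * fst (snd y) j $ s) \<in> poly_funs (XM UNIV \<union> X)"
    proof (intro poly_funs_sum poly_funs.mult)
      fix j assume j: "j \<in> UNIV - {m}"
      show "(\<lambda>y. snd (snd y) j) \<in> poly_funs (XM UNIV \<union> X)"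
        using j by (intro poly_funs.coord) (auto simp: X_def)
      show "(\<lambda>y. fst (snd y) j $ s) \<in> poly_funs (XM UNIV \<union> X)"
        using j by (intro coord_poly[of _ _ "(UNIV - {m}) \<times> UNIV" "\<lambda>y. fst (snd y)"]) (auto simp: X_def)
    qed
    then show ?thesis using True by (simp add: H_def)
  next
    case False
    have "(\<lambda>y. fst (snd y) j $ s) \<in> poly_funs (XM UNIV \<union> X)"
      using False by (intro coord_poly[of _ _ "(UNIV - {m}) \<times> UNIV" "\<lambda>y. fst (snd y)"]) (auto simp: X_def)
    then show ?thesis using False by (simp add: H_def)
  qed
  show ?thesis
  proof (rule hgrow_normalised[where R = UNIV and \<phi> = \<phi> and X = X])
    show "dependent_locus m \<subseteq> points" by (auto simp: dependent_locus_def)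
    show "(\<lambda>y. \<phi> (fst y) (snd y) i $ u $ v) \<in> poly_funs (XM UNIV \<union> X)" for i u v
      unfolding \<phi>_def by (cases i) (auto intro!: poly_funs_intros Hp XM_poly)
    show "growth {y. fst y \<in> Sym4 \<and> fst y $ r $ s = 1 \<and> snd y \<in> UNIV} (XM (Pairs - {(r, s)}) \<union> X) 24"
      if "(r, s) \<in> Pairs" for r s using X by (intro growth_XM[OF that, of _ 15]) auto
    fix p assume p: "p \<in> dependent_locus m"
    then obtain G h c where G: "G \<in> p None - {0}" "\<And>i. G + sq (h i) \<in> p (Some i) - {0}"
      and hm: "h m = (\<Sum>j\<in>UNIV - {m}. c j *s h j)" by (auto simp: dependent_locus_def)
    have P: "p i \<in> P9" for i using p by (auto simp: dependent_locus_def points_def)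
    have GS: "G \<in> Sym4" using P9_memD(2)[OF P G(1)] .
    show "\<exists>M. M \<in> Sym4 \<and> M \<noteq> 0 \<and> (\<forall>k. k \<noteq> 0 \<longrightarrow> (\<exists>\<zeta>\<in>UNIV. \<forall>i. \<phi> (smul k M) \<zeta> i \<in> p i - {0}))"
    proof (intro exI[of _ G] conjI allI impI)
      fix k :: complex assume k: "k \<noteq> 0"
      have H: "H (\<lambda>j. csqrt k *s h j, c) j = csqrt k *s h j" for j
      proof -
        have "(\<Sum>j\<in>UNIV - {m}. c j *s (csqrt k *s h j)) = csqrt k *s h m"
          unfolding hm by (simp add: vec.scale_sum_right mult.commute)
        then show ?thesis by (simp add: H_def)
      qed
      have "\<phi> (smul k G) (\<lambda>j. csqrt k *s h j, c) i \<in> p i - {0}" for i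
        using P9_smul[OF P G(1) k] P9_smul[OF P G(2) k] unfolding \<phi>_def H
        by (cases i) (auto simp: outer_csqrt mat.scale_right_distrib)
      then show "\<exists>\<zeta>\<in>UNIV. \<forall>i. \<phi> (smul k G) \<zeta> i \<in> p i - {0}" by blast
    qed (use G GS in auto)
  qed
qed

text \<open>Linear dependence of the four quadrics over independent \<open>h j\<close> forces the
  basket to be a combination of their squares. There are only 16 + 4 parameters.\<close>

definition diagonal_locus :: "(4 option \<Rightarrow> mat4 set) set" where
  "diagonal_locus = {x \<in> points. \<exists>h c. (\<Sum>j\<in>UNIV. smul (c j) (sq (h j))) \<in> x None - {0} \<and>
     (\<forall>i. (\<Sum>j\<in>UNIV. smul (c j) (sq (h j))) + sq (h i) \<in> x (Some i) - {0})}"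

lemma hgrow_diagonal_locus: "hgrow diagonal_locus 24"
proof -
  define S where "S = (\<lambda>y :: (4 \<Rightarrow> complex^4) \<times> (4 \<Rightarrow> complex). \<Sum>j\<in>UNIV. smul (snd y j) (sq (fst y j)))"
  define \<phi> where "\<phi> = (\<lambda>y i. case i of None \<Rightarrow> S y | Some j \<Rightarrow> S y + sq (fst y j))"
  define X where "X = range (\<lambda>(j, s) (y :: (4 \<Rightarrow> complex^4) \<times> (4 \<Rightarrow> complex)). fst y j $ s) \<union> range (\<lambda>j y. snd y j)"
  have "card X \<le> card (UNIV :: (4 \<times> 4) set) + card (UNIV :: 4 set)"
    unfolding X_def by (rule order_trans[OF card_Un_le add_mono]; rule card_image_le; simp)
  then have X: "finite X" "card X \<le> 24" by (simp_all add: X_def)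
  have fp: "(\<lambda>y. fst y j $ s) \<in> poly_funs X" for j s
    by (rule coord_poly[of _ _ UNIV fst]) (auto simp: X_def)
  have sp: "(\<lambda>y. snd y j) \<in> poly_funs X" for j by (rule poly_funs.coord) (auto simp: X_def)
  have Sp: "(\<lambda>y. S y $ u $ v) \<in> poly_funs X" for u v
  proof -
    have "(\<lambda>y. \<Sum>j\<in>UNIV. snd y j * (fst y j $ u * fst y j $ v)) \<in> poly_funs X"
      by (intro poly_funs_sum poly_funs.mult fp sp)
    then show ?thesis by (simp add: S_def sum_component)
  qed
  have "\<exists>D. \<forall>i r s. pdeg X D (\<lambda>y. \<phi> y i $ r $ s)"
  proof (rule poly_funs_pdeg_uniform)
    fix i r s
    show "(\<lambda>y. \<phi> y i $ r $ s) \<in> poly_funs X"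
      unfolding \<phi>_def by (cases i) (auto intro!: poly_funs_intros Sp fp)
  qed
  then obtain D where D: "\<And>i r s. pdeg X D (\<lambda>y. \<phi> y i $ r $ s)" by blast
  show ?thesis
  proof (rule hgrow_family[where Y = UNIV and \<phi> = \<phi> and c = D and X = X])
    show "\<exists>y\<in>UNIV. \<forall>i. \<phi> y i \<in> p i - {0}" if p: "p \<in> diagonal_locus" for p
    proof -
      obtain h c where "(\<Sum>j\<in>UNIV. smul (c j) (sq (h j))) \<in> p None - {0}"
        "\<forall>i. (\<Sum>j\<in>UNIV. smul (c j) (sq (h j))) + sq (h i) \<in> p (Some i) - {0}"
        using p by (auto simp: diagonal_locus_def)
      then have "\<phi> (h, c) i \<in> p i - {0}" for i by (cases i) (auto simp: \<phi>_def S_def)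
      then show ?thesis by blast
    qed
    show "\<exists>g. pdeg X D g \<and> (\<forall>y\<in>UNIV. \<phi> y i $ r $ s = g y)" for i r s
      by (intro exI[of _ "\<lambda>y. \<phi> y i $ r $ s"] conjI D) simp
  qed (use growth_card X in \<open>auto simp: diagonal_locus_def\<close>)
qed

text \<open>Over independent linear forms, \<open>property_P\<close> can fail only if the four
  quadrics are linearly dependent.\<close>

lemma bad_B25_subset:
  "{x \<in> B25. \<not> property_P (x \<circ> Some)} \<subseteq> (\<Union>m\<in>UNIV. dependent_locus m) \<union> diagonal_locus"
proof
  fix x assume "x \<in> {x \<in> B25. \<not> property_P (x \<circ> Some)}"
  then have x: "x \<in> B25" "\<not> property_P (x \<circ> Some)" by auto
  obtain G h where G: "G \<in> x None - {0}" "\<And>i. G + sq (h i) \<in> x (Some i) - {0}" "G \<in> Sym4" using B25E[OF x(1)] by blast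
  have xp: "x \<in> points" using x(1) B25_points by blast
  define Q where "Q = (\<lambda>i. G + sq (h i))"
  show "x \<in> (\<Union>m\<in>UNIV. dependent_locus m) \<union> diagonal_locus"
  proof (cases "indepf UNIV h")
    case False
    then obtain c m where c: "(\<Sum>j\<in>UNIV. c j *s h j) = 0" "c m \<noteq> 0" by (auto simp: indepf_def)
    have "c m *s h m + (\<Sum>j\<in>UNIV - {m}. c j *s h j) = 0"
      using c(1) sum.remove[of UNIV m "\<lambda>j. c j *s h j"] by simp
    then have "c m *s h m = - (\<Sum>j\<in>UNIV - {m}. c j *s h j)" by (simp add: eq_neg_iff_add_eq_0)
    then have "(1 / c m) *s (c m *s h m) = (\<Sum>j\<in>UNIV - {m}. (- c j / c m) *s h j)"
      by (simp add: vec.scale_sum_right sum_negf)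
    then have "h m = (\<Sum>j\<in>UNIV - {m}. (- c j / c m) *s h j)" using c(2) by simp
    then have "x \<in> dependent_locus m"
      unfolding dependent_locus_def mem_Collect_eq using xp G(1,2)
      by (intro conjI exI[of _ G] exI[of _ h] exI[of _ "\<lambda>j. - c j / c m"]) auto
    then show ?thesis by blast
  next
    case True
    have "\<not> mindep Q"
    proof
      assume "mindep Q"
      then have "property_P (x \<circ> Some)"
        using xp G(2) by (intro property_P_common_basket[where Q = Q and G = G, OF _ _ True]) (auto simp: points_def Q_def)
      then show False using x(2) by simp
    qed
    then obtain a where a: "mcomb Q a = 0" "\<exists>i. a i \<noteq> 0" by (auto simp: mindep_def)
    \<comment> \<open>With coefficient sum zero, \<open>G\<close> would cancel and independent
      squares would satisfy a relation.\<close>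
    have s0: "sum a UNIV \<noteq> 0"
    proof
      assume "sum a UNIV = 0"
      then have "rank (mcomb Q a) = card {i. a i \<noteq> 0}" by (intro rank_mcomb_squares[OF True]) (auto simp: Q_def)
      then have "card {i. a i \<noteq> 0} = 0" using a(1) rank_zero_iff[of "mcomb Q a"] by simp
      then show False using a(2) by auto
    qed
    define s where "s = sum a UNIV"
    have "smul s G + (\<Sum>j\<in>UNIV. smul (a j) (sq (h j))) = 0"
      using a(1) by (simp add: mcomb_def Q_def mat.scale_right_distrib sum.distrib mat.scale_sum_left s_def)
    then have "smul s G = - (\<Sum>j\<in>UNIV. smul (a j) (sq (h j)))" by (simp add: eq_neg_iff_add_eq_0)
    then have "smul (1 / s) (smul s G) = (\<Sum>j\<in>UNIV. smul (- a j / s) (sq (h j)))"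
      by (simp add: mat.scale_sum_right sum_negf)
    then have G_eq: "G = (\<Sum>j\<in>UNIV. smul (- a j / s) (sq (h j)))" using s0 by (simp add: s_def)
    have "x \<in> diagonal_locus"
      unfolding diagonal_locus_def mem_Collect_eq using xp G(1,2) G_eq
      by (intro conjI exI[of _ h] exI[of _ "\<lambda>j. - a j / s"]) auto
    then show ?thesis by blast
  qed
qed

lemma hgrow_bad_B25: "hgrow {x \<in> B25. \<not> property_P (x \<circ> Some)} 24"
  by (rule hgrow_subset[OF hgrow_Un[OF hgrow_UN[OF finite hgrow_dependent_locus] hgrow_diagonal_locus] bad_B25_subset])

text \<open>Here the quadric that should be the common basket has rank at most two.\<close>

definition low_rank_locus :: "(4 \<Rightarrow> mat4 set) set" where
  "low_rank_locus = {q \<in> points. \<exists>u v h. \<forall>i. sq u + sq v + sq (h i) \<in> q i - {0}}"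

text \<open>Eight coordinates for \<open>u\<close> and \<open>v\<close>, sixteen for the
  \<open>h i\<close>.\<close>

lemma hgrow_low_rank_locus: "hgrow low_rank_locus 24"
proof -
  define \<phi> where "\<phi> = (\<lambda>(y :: ((complex^4) \<times> (complex^4)) \<times> (4 \<Rightarrow> complex^4)) i. sq (fst (fst y)) + sq (snd (fst y)) + sq (snd y i))"
  define X where "X = range (\<lambda>(j, s) (y :: ((complex^4) \<times> (complex^4)) \<times> (4 \<Rightarrow> complex^4)). snd y j $ s) \<union>
    (range (\<lambda>s y. fst (fst y) $ s) \<union> range (\<lambda>s y. snd (fst y) $ s))"
  have "card X \<le> card (UNIV :: (4 \<times> 4) set) + (card (UNIV :: 4 set) + card (UNIV :: 4 set))"
    unfolding X_def by (rule order_trans[OF card_Un_le add_mono], rule card_image_le, simp,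
        rule order_trans[OF card_Un_le add_mono]; rule card_image_le; simp)
  then have X: "finite X" "card X \<le> 24" by (simp_all add: X_def)
  have hp: "(\<lambda>y. snd y j $ s) \<in> poly_funs X" for j s
    by (rule coord_poly[of _ _ UNIV snd]) (auto simp: X_def)
  have up: "(\<lambda>y. fst (fst y) $ s) \<in> poly_funs X" and vp: "(\<lambda>y. snd (fst y) $ s) \<in> poly_funs X" for s
    by (rule poly_funs.coord, auto simp: X_def)+
  have "\<exists>D. \<forall>i r s. pdeg X D (\<lambda>y. \<phi> y i $ r $ s)"
  proof (rule poly_funs_pdeg_uniform)
    fix i r s
    show "(\<lambda>y. \<phi> y i $ r $ s) \<in> poly_funs X"
      unfolding \<phi>_def by (auto intro!: poly_funs_intros hp up vp)
  qed
  then obtain D where D: "\<And>i r s. pdeg X D (\<lambda>y. \<phi> y i $ r $ s)" by blast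
  show ?thesis
  proof (rule hgrow_family[where Y = UNIV and \<phi> = \<phi> and c = D and X = X])
    show "\<exists>y\<in>UNIV. \<forall>i. \<phi> y i \<in> p i - {0}" if p: "p \<in> low_rank_locus" for p
    proof -
      obtain u v h where "\<forall>i. sq u + sq v + sq (h i) \<in> p i - {0}" using p by (auto simp: low_rank_locus_def)
      then show ?thesis by (intro bexI[of _ "((u, v), h)"]) (auto simp: \<phi>_def)
    qed
    show "\<exists>g. pdeg X D g \<and> (\<forall>y\<in>UNIV. \<phi> y i $ r $ s = g y)" for i r s
      by (intro exI[of _ "\<lambda>y. \<phi> y i $ r $ s"] conjI D) simp
  qed (use growth_card X in \<open>auto simp: low_rank_locus_def\<close>)
qed

definition exceptional_locus :: "(4 \<Rightarrow> mat4 set) set" where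
  "exceptional_locus = {q \<in> points. \<exists>Q. (\<forall>i. Q i \<in> q i - {0}) \<and> exceptional Q}"

text \<open>Besides the twelve coordinates of the three linear forms and the nine of the quadric, three
  scalars \<open>a\<close>, \<open>b\<close>, \<open>c\<close> suffice: the others are successive square roots.\<close>

lemma hgrow_exceptional_locus: "hgrow exceptional_locus 24"
proof -
  \<comment> \<open>The vectors with indices 0, 1, 2 are \<open>x\<close>, \<open>y\<close>,
    \<open>z\<close>. Among the scalars \<open>ft\<close>, the indices 0, 1, 2 stand for
    \<open>a\<close>, \<open>b\<close>, \<open>c\<close>, index 3 for \<open>P\<close>, and 4, 5, 6
    for \<open>d\<close>, \<open>e\<close>, \<open>f\<close>.\<close>
  define fx where "fx = (\<lambda>n s (y :: mat4 \<times> (nat \<Rightarrow> complex^4) \<times> (nat \<Rightarrow> complex)). fst (snd y) n $ s)"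
  define ft where "ft = (\<lambda>n (y :: mat4 \<times> (nat \<Rightarrow> complex^4) \<times> (nat \<Rightarrow> complex)). snd (snd y) n)"
  define X0 where "X0 = (\<lambda>(n, s). fx n s) ` ({..<3} \<times> UNIV) \<union> ft ` {..<3}"
  define X where "X = X0 \<union> {ft 3, ft 4, ft 5, ft 6}"
  define R where "R = {\<zeta> :: (nat \<Rightarrow> complex^4) \<times> (nat \<Rightarrow> complex). let a = snd \<zeta> 0; b = snd \<zeta> 1; c = snd \<zeta> 2; P = snd \<zeta> 3;
    d = snd \<zeta> 4; e = snd \<zeta> 5; f = snd \<zeta> 6 in
    P = a * b - d\<^sup>2 \<and> P = a * c - e\<^sup>2 \<and> P = b * c - f\<^sup>2 \<and>
    P\<^sup>2 = ((a * b + b * c + c * a) - (1 - a - b - c)\<^sup>2 / 4) * P + (- (a * b * c))}"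
  define \<phi> where "\<phi> = (\<lambda>M (\<zeta> :: (nat \<Rightarrow> complex^4) \<times> (nat \<Rightarrow> complex)) i :: 4.
    if i = 1 then M + sq (fst \<zeta> 0) - sq (fst \<zeta> 2) else if i = 2 then M + sq (fst \<zeta> 1) - sq (fst \<zeta> 2)
    else if i = 3 then M + ternform (fst \<zeta> 0) (fst \<zeta> 1) (fst \<zeta> 2) (snd \<zeta> 0) (snd \<zeta> 1) (snd \<zeta> 2 - 1) (snd \<zeta> 4) (snd \<zeta> 5) (snd \<zeta> 6)
    else M)"
  have X0: "finite X0" "card X0 \<le> 15"
  proof -
    show "finite X0" by (simp add: X0_def)
    have "card X0 \<le> card ({..<3::nat} \<times> (UNIV :: 4 set)) + card {..<3::nat}"
      unfolding X0_def by (rule order_trans[OF card_Un_le add_mono]; rule card_image_le; simp)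
    then show "card X0 \<le> 15" by (simp add: card_cartesian_product)
  qed
  have ft0: "ft n \<in> X0" if "n < 3" for n using that by (auto simp: X0_def)
  have gr: "growth {y. fst y \<in> Sym4 \<and> fst y $ r $ s = 1 \<and> snd y \<in> R} (XM (Pairs - {(r, s)}) \<union> X) 24" 
    if rs: "(r, s) \<in> Pairs" for r s
  proof -
    let ?Y = "{y :: mat4 \<times> (nat \<Rightarrow> complex^4) \<times> (nat \<Rightarrow> complex). fst y \<in> Sym4 \<and> fst y $ r $ s = 1 \<and> snd y \<in> R}"
    let ?A = "XM (Pairs - {(r, s)}) \<union> X0"
    have c: "ft n \<in> poly_funs (insert w ?A)" "ft n \<in> poly_funs (insert w (insert w' ?A))"
      "ft n \<in> poly_funs (insert w (insert w' (insert w'' ?A)))" "ft n \<in> poly_funs ?A" if "n < 3" for n w w' w''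
      using ft0[OF that] by (auto intro: poly_funs.coord)
    have c3: "ft 3 \<in> poly_funs (insert (ft 3) ?A)" "ft 3 \<in> poly_funs (insert w (insert (ft 3) ?A))"
      "ft 3 \<in> poly_funs (insert w (insert w' (insert (ft 3) ?A)))" for w w'
      by (auto intro: poly_funs.coord)
    have RY: "ft 3 y = ft 0 y * ft 1 y - (ft 4 y)\<^sup>2" "ft 3 y = ft 0 y * ft 2 y - (ft 5 y)\<^sup>2"
      "ft 3 y = ft 1 y * ft 2 y - (ft 6 y)\<^sup>2"
      "(ft 3 y)\<^sup>2 = ((ft 0 y * ft 1 y + ft 1 y * ft 2 y + ft 2 y * ft 0 y) - (1 - ft 0 y - ft 1 y - ft 2 y)\<^sup>2 / 4) * ft 3 y
        + (- (ft 0 y * ft 1 y * ft 2 y))" if "y \<in> ?Y" for y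
      using that unfolding R_def ft_def Let_def mem_Collect_eq by blast+
    have g0: "growth ?Y ?A 24" using X0 by (intro growth_XM[OF rs, of _ 15]) auto
    \<comment> \<open>\<open>P\<close> is adjoined before \<open>d\<close>, \<open>e\<close>,
      \<open>f\<close>, because the squares of these are polynomials in \<open>a\<close>,
      \<open>b\<close>, \<open>c\<close> and \<open>P\<close>.\<close>
    have g1: "growth ?Y (insert (ft 3) ?A) 24"
      by (rule growth_quadratic'[OF g0 _ _ RY(4)]) (auto intro!: poly_funs_intros c)
    have g2: "growth ?Y (insert (ft 4) (insert (ft 3) ?A)) 24"
    proof (rule growth_quadratic'[OF g1])
      show "(ft 4 y)\<^sup>2 = (\<lambda>_. 0) y * ft 4 y + (\<lambda>y. ft 0 y * ft 1 y - ft 3 y) y" if "y \<in> ?Y" for y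
        using RY(1)[OF that] by simp
    qed (auto intro!: poly_funs_intros c c3)
    have g3: "growth ?Y (insert (ft 5) (insert (ft 4) (insert (ft 3) ?A))) 24"
    proof (rule growth_quadratic'[OF g2])
      show "(ft 5 y)\<^sup>2 = (\<lambda>_. 0) y * ft 5 y + (\<lambda>y. ft 0 y * ft 2 y - ft 3 y) y" if "y \<in> ?Y" for y
        using RY(2)[OF that] by simp
    qed (auto intro!: poly_funs_intros c c3)
    have g4: "growth ?Y (insert (ft 6) (insert (ft 5) (insert (ft 4) (insert (ft 3) ?A)))) 24"
    proof (rule growth_quadratic'[OF g3])
      show "(ft 6 y)\<^sup>2 = (\<lambda>_. 0) y * ft 6 y + (\<lambda>y. ft 1 y * ft 2 y - ft 3 y) y" if "y \<in> ?Y" for y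
        using RY(3)[OF that] by simp
    qed (auto intro!: poly_funs_intros c c3)
    have "XM (Pairs - {(r, s)}) \<union> X = insert (ft 6) (insert (ft 5) (insert (ft 4) (insert (ft 3) ?A)))"
      by (auto simp: X_def)
    then show ?thesis using g4 by simp
  qed
  have px: "fx n s \<in> poly_funs (XM UNIV \<union> X)" if "n < 3" for n s
  proof (rule poly_funs.coord)
    have "fx n s \<in> (\<lambda>(n, s). fx n s) ` ({..<3} \<times> UNIV)" using that by (intro image_eqI[of _ _ "(n, s)"]) auto
    then show "fx n s \<in> XM UNIV \<union> X" by (simp add: X_def X0_def)
  qed
  have pt: "ft n \<in> poly_funs (XM UNIV \<union> X)" if "n \<in> {0,1,2,4,5,6}" for n
    using that ft0[of n] by (intro poly_funs.coord) (auto simp: X_def)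
  show ?thesis
  proof (rule hgrow_normalised[where R = R and \<phi> = \<phi> and X = X])
    show "exceptional_locus \<subseteq> points" by (auto simp: exceptional_locus_def)
    show "(\<lambda>y. \<phi> (fst y) (snd y) i $ u $ v) \<in> poly_funs (XM UNIV \<union> X)" for i u v
    proof -
      have x: "(\<lambda>y. fst (snd y) n $ s) \<in> poly_funs (XM UNIV \<union> X)" if "n \<in> {0,1,2}" for n s
        using px[of n s] that by (auto simp: fx_def)
      have t: "(\<lambda>y. snd (snd y) n) \<in> poly_funs (XM UNIV \<union> X)" if "n \<in> {0,1,2,4,5,6}" for n
        using pt[of n] that by (simp add: ft_def)
      show ?thesis
        using exhaust_4[of i]
        by (elim disjE) (simp_all add: \<phi>_def ternform_def, (intro poly_funs_intros x t XM_poly; simp)+)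
    qed
    show "growth {y. fst y \<in> Sym4 \<and> fst y $ r $ s = 1 \<and> snd y \<in> R} (XM (Pairs - {(r, s)}) \<union> X) 24"
      if "(r, s) \<in> Pairs" for r s using gr[OF that] .
    fix p assume p: "p \<in> exceptional_locus"
    then obtain Q where Q: "\<And>i. Q i \<in> p i - {0}" "exceptional Q" by (auto simp: exceptional_locus_def)
    have P: "p i \<in> P9" for i using p by (auto simp: exceptional_locus_def points_def)
    obtain x y z a b c d e f P' where E: "P' = a * b - d\<^sup>2 \<and> P' = a * c - e\<^sup>2 \<and> P' = b * c - f\<^sup>2 \<and>
       P'\<^sup>2 = ((a * b + b * c + c * a) - (1 - a - b - c)\<^sup>2 / 4) * P' + (- (a * b * c))"
       "Q 1 = Q 4 + sq x - sq z" "Q 2 = Q 4 + sq y - sq z" "Q 3 = Q 4 + ternform x y z a b (c - 1) d e f"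
      using Q(2) unfolding exceptional_def by metis
    show "\<exists>M. M \<in> Sym4 \<and> M \<noteq> 0 \<and> (\<forall>k. k \<noteq> 0 \<longrightarrow> (\<exists>\<zeta>\<in>R. \<forall>i. \<phi> (smul k M) \<zeta> i \<in> p i - {0}))"
    proof (intro exI[of _ "Q 4"] conjI allI impI)
      show "Q 4 \<in> Sym4" using P9_memD(2)[OF P Q(1)] .
      show "Q 4 \<noteq> 0" using Q(1) by blast
      fix k :: complex assume k: "k \<noteq> 0"
      define \<zeta> where "\<zeta> = (\<lambda>n::nat. csqrt k *s (if n = 0 then x else if n = 1 then y else z),
        \<lambda>n::nat. if n = 0 then a else if n = 1 then b else if n = 2 then c else if n = 3 then P' else if n = 4 then d else if n = 5 then e else f)"
      have "\<zeta> \<in> R \<longleftrightarrow> (P' = a * b - d\<^sup>2 \<and> P' = a * c - e\<^sup>2 \<and> P' = b * c - f\<^sup>2 \<and>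
         P'\<^sup>2 = ((a * b + b * c + c * a) - (1 - a - b - c)\<^sup>2 / 4) * P' + (- (a * b * c)))"
        by (simp add: R_def \<zeta>_def Let_def)
      then have "\<zeta> \<in> R" using E(1) by blast
      moreover have "\<phi> (smul k (Q 4)) \<zeta> i = smul k (Q i)" for i
        using exhaust_4[of i] E(2-4)
        by (elim disjE) (simp_all add: \<phi>_def \<zeta>_def outer_csqrt ternform_def mat.scale_right_distrib mat.scale_right_diff_distrib mult.commute)
      ultimately show "\<exists>\<zeta>\<in>R. \<forall>i. \<phi> (smul k (Q 4)) \<zeta> i \<in> p i - {0}"
        using P9_smul[OF P Q(1) k] by (intro bexI[of _ \<zeta>]) auto
    qed
  qed
qed

lemma quadruples_points: "quadruples_with_P \<subseteq> points"
  by (auto simp: quadruples_with_P_def points_def)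

lemma hgrow_bad_quadruples: "hgrow {q \<in> quadruples_with_P. \<not> admits_common_basket q} 24"
proof (rule hgrow_subset[OF hgrow_Un[OF hgrow_low_rank_locus hgrow_exceptional_locus]])
  show "{q \<in> quadruples_with_P. \<not> admits_common_basket q} \<subseteq> low_rank_locus \<union> exceptional_locus"
  proof
    fix q assume q: "q \<in> {q \<in> quadruples_with_P. \<not> admits_common_basket q}"
    then have qp: "q \<in> points" using quadruples_points by blast
    obtain Q where Q: "\<forall>i. Q i \<in> q i - {0}" "(\<exists>u v h. \<forall>i. Q i = sq u + sq v + sq (h i)) \<or> exceptional Q"
      using quadruple_dichotomy[of q] q by blast
    from Q(2) show "q \<in> low_rank_locus \<union> exceptional_locus"
    proof
      assume "\<exists>u v h. \<forall>i. Q i = sq u + sq v + sq (h i)"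
      then have "q \<in> low_rank_locus" using qp Q(1) unfolding low_rank_locus_def mem_Collect_eq by metis
      then show ?thesis by blast
    next
      assume "exceptional Q"
      then show ?thesis using qp Q(1) by (auto simp: exceptional_locus_def)
    qed
  qed
qed

section \<open>Generic points and local coordinates\<close>

lemma det_nonzero_ker: "det (A :: complex^'n^'n) \<noteq> 0 \<longleftrightarrow> (\<forall>x. A *v x = 0 \<longrightarrow> x = 0)"
proof -
  have "det A \<noteq> 0 \<longleftrightarrow> (\<exists>B. B ** A = mat 1)"
    by (simp add: invertible_det_nz[symmetric] invertible_left_inverse)
  then show ?thesis
    using matrix_left_invertible_injective[of A] vec.inj_iff_eq_0[of A] by simp
qed

lemma det_nonzero_rows:
  assumes "det (\<chi> i s. (f i s :: complex)) \<noteq> 0" "\<And>s. (\<Sum>i\<in>UNIV. a i * f i s) = 0"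
  shows "a (i :: 'n::finite) = 0"
proof -
  let ?A = "\<chi> i s. f i s"
  have "det (transpose ?A) \<noteq> 0" using assms(1) by simp
  moreover have "transpose ?A *v (\<chi> i. a i) = 0"
    using assms(2) by (simp add: vec_eq_iff matrix_vector_mult_def transpose_def mult.commute)
  ultimately have "(\<chi> i. a i) = 0" using det_nonzero_ker by blast
  then show ?thesis by (simp add: vec_eq_iff)
qed

lemma det_nonzero_rank: "det (A :: mat4) \<noteq> 0 \<Longrightarrow> rank A = 4"
proof -
  assume "det A \<noteq> 0"
  then have "\<exists>B. B ** A = mat 1" by (simp add: invertible_det_nz[symmetric] invertible_left_inverse)
  then have "vec.span (rows A) = UNIV" using matrix_left_invertible_span_rows_gen by blast
  then have "vec.dim (rows A) = 4" using vec.dim_span[of "rows A"] vec_dim_card[where 'n = 4 and 'a = complex] by simp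
  then show "rank A = 4" by (simp add: row_rank_def_gen)
qed

lemma poly_funs_det:
  assumes "\<And>i j. (\<lambda>y. A y $ i $ j) \<in> poly_funs X"
  shows "(\<lambda>y. det (A y)) \<in> poly_funs X"
  unfolding det_def by (intro poly_funs_intros assms)

text \<open>At these four entries the matrices of the four quadrics over the base point used below are linearly
  independent.\<close>

definition test_entry :: "4 \<Rightarrow> 4 \<times> 4" where
  "test_entry a = (if a = 4 then (3, 4) else (a, a))"

text \<open>All open conditions in one polynomial, which restriction to lines can handle:
  independent linear forms, basket and quadrics of rank four, independent quadrics.\<close>

definition wdet :: "mat4 \<Rightarrow> (4 \<Rightarrow> complex^4) \<Rightarrow> complex" where
  "wdet G h = det (\<chi> i s. h i $ s) * det G * (\<Prod>i\<in>UNIV. det (G + sq (h i))) *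
     det (\<chi> i a. (G + sq (h i)) $ fst (test_entry a) $ snd (test_entry a))"

lemma wdet_poly:
  assumes "\<And>r s. (\<lambda>y. G y $ r $ s) \<in> poly_funs X" "\<And>i s. (\<lambda>y. h y i $ s) \<in> poly_funs X"
  shows "(\<lambda>y. wdet (G y) (h y)) \<in> poly_funs X"
  unfolding wdet_def by (intro poly_funs_intros poly_funs_det) (simp_all, (intro poly_funs_intros assms)+)

lemma wdet_nonzero:
  assumes "wdet G h \<noteq> 0" "G \<in> Sym4"
  shows "indepf UNIV h" "mindep (\<lambda>i. G + sq (h i))" "rank G = 4" "rank (G + sq (h i)) = 4"
proof -
  have w: "det (\<chi> i s. h i $ s) \<noteq> 0" "det G \<noteq> 0" "\<And>i. det (G + sq (h i)) \<noteq> 0"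
    "det (\<chi> i a. (G + sq (h i)) $ fst (test_entry a) $ snd (test_entry a)) \<noteq> 0"
    using assms(1) by (auto simp: wdet_def)
  show "rank G = 4" "rank (G + sq (h i)) = 4" using w det_nonzero_rank by auto
  show "indepf UNIV h" unfolding indepf_def
  proof (intro allI impI ballI)
    fix c j assume "(\<Sum>j\<in>UNIV. c j *s h j) = 0"
    then have "(\<Sum>j\<in>UNIV. c j *s h j) $ s = 0" for s by simp
    then show "c j = 0" by (intro det_nonzero_rows[OF w(1), of c]) (simp add: sum_component)
  qed
  show "mindep (\<lambda>i. G + sq (h i))" unfolding mindep_def
  proof (intro allI impI)
    fix a i assume "mcomb (\<lambda>i. G + sq (h i)) a = 0"
    then have "mcomb (\<lambda>i. G + sq (h i)) a $ r $ s = 0" for r s by simp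
    then show "a i = 0" by (intro det_nonzero_rows[OF w(4), of a]) (simp only: mcomb_def sum_component smul_nth)
  qed
qed

definition quad :: "mat4 \<Rightarrow> (4 \<Rightarrow> complex^4) \<Rightarrow> 4 \<Rightarrow> mat4" where
  "quad G h i = G + sq (h i)"

definition quint :: "mat4 \<Rightarrow> (4 \<Rightarrow> complex^4) \<Rightarrow> 4 option \<Rightarrow> mat4" where
  "quint G h = case_option G (quad G h)"

lemma quint_simps [simp]: "quint G h None = G" "quint G h (Some i) = quad G h i"
  by (simp_all add: quint_def)

lemma span_inj:
  assumes "mindep Q" "\<And>i. Q i \<in> Sym4" "\<And>i. Q i \<noteq> 0"
  shows "inj (\<lambda>i. mat.span {Q i})"
proof (rule injI, rule ccontr)
  fix i j assume ij: "mat.span {Q i} = mat.span {Q j}" "i \<noteq> j"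
  then obtain k where k: "Q i = smul k (Q j)" using mat.span_base[of "Q i" "{Q i}"] by (auto simp: mat.span_singleton)
  have "mcomb Q (\<lambda>m. (if m = i then 1 else 0) - (if m = j then k else 0)) = 0"
    unfolding mcomb_diff mcomb_unit using k by simp
  from mindepD[OF assms(1) this, of i] show False using ij(2) by simp
qed

lemma generic_points:
  assumes w: "wdet G h \<noteq> 0" and G: "G \<in> Sym4"
  shows "quad G h i \<in> Sym4 - {0}" "quint G h j \<in> Sym4 - {0}"
    "(\<lambda>i. mat.span {quad G h i}) \<in> quadruples_with_P" "(\<lambda>j. mat.span {quint G h j}) \<in> B25"
proof -
  note wn = wdet_nonzero[OF w G]
  have nz: "A \<noteq> 0" if "rank A = 4" for A :: mat4 using that rank_zero_iff[of A] by auto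
  have r4: "rank (quad G h i) = 4" for i using wn(4) by (simp add: quad_def)
  have Q: "quad G h i \<in> Sym4 - {0}" for i
    using nz[OF r4[of i]] G by (auto simp: quad_def intro: Sym4_add)
  then show "quad G h i \<in> Sym4 - {0}" .
  have Q': "quint G h j \<in> Sym4 - {0}" for j using Q G nz[OF wn(3)] by (cases j) auto
  then show "quint G h j \<in> Sym4 - {0}" .
  have P: "mat.span {quad G h i} \<in> P9" "quad G h i \<in> mat.span {quad G h i} - {0}" for i
    using Q[of i] by (auto simp: mat.span_base)
  have P': "mat.span {G} \<in> P9" "G \<in> mat.span {G} - {0}" using G nz[OF wn(3)] by (auto simp: mat.span_base)
  have qr: "qrank (mat.span {quad G h i}) = 4" "qrank (mat.span {G}) = 4" for i
    using qrank_eq[OF P] qrank_eq[OF P'] r4 wn(3) by simp_all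
  have ind: "mindep (quad G h)" using wn(2) by (simp add: quad_def[abs_def])
  have inj: "inj (\<lambda>i. mat.span {quad G h i})" using span_inj[of "quad G h", OF ind] Q by blast
  show "(\<lambda>i. mat.span {quad G h i}) \<in> quadruples_with_P"
    unfolding quadruples_with_P_def
    using P qr inj property_P_common_basket[of "\<lambda>i. mat.span {quad G h i}" "quad G h" h G, OF P wn(1) quad_def ind] by auto
  have Gq: "mat.span {G} \<noteq> mat.span {quad G h i}" for i
  proof
    assume "mat.span {G} = mat.span {quad G h i}"
    then obtain k where k: "quad G h i = smul k G" using P(2)[of i] by (auto simp: mat.span_singleton)
    then have e: "sq (h i) = smul (k - 1) G" by (simp add: quad_def vec_eq_iff algebra_simps)
    show False
    proof (cases "k = 1")
      case True
      then have "h i $ s * h i $ s = 0" for s using arg_cong[OF e, of "\<lambda>A. A $ s $ s"] by simp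
      then have "h i = 0" by (simp add: vec_eq_iff)
      moreover obtain k' where "dot (h i) (k' i) = 1" using indepf_dual[of UNIV h] wn(1) by (metis UNIV_I finite_class.finite_UNIV)
      ultimately show False by simp
    next
      case False
      then have "rank (sq (h i)) = 4" unfolding e using wn(3) by (simp add: rank_smul)
      then show False using rank_sq_le[of "h i"] by simp
    qed
  qed
  have "inj (\<lambda>j. mat.span {quint G h j})"
  proof (rule injI)
    fix a b assume ab: "mat.span {quint G h a} = mat.span {quint G h b}"
    show "a = b"
      using ab Gq Gq[symmetric] injD[OF inj] by (cases a; cases b) auto
  qed
  then have "(\<lambda>j. mat.span {quint G h j}) \<in> wide"
    unfolding wide_def points_def using P P' qr by (auto simp: quint_def split: option.splits)
  then show "(\<lambda>j. mat.span {quint G h j}) \<in> B25"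
    unfolding B25_iff using P P' by (auto simp: quad_def intro!: exI[of _ G] exI[of _ h])
qed

definition base_quadric :: mat4 where
  "base_quadric = (\<chi> u v. if u = v then 1 else if {u, v} = {3, 4} then 2 else 0)"

text \<open>Singularity could only come from the block of the indices 3 and 4, with rows (1,2),
  (2,1) or with one diagonal entry raised to 2; these are the three systems \<open>lin\<close>,
  \<open>lin'\<close>, \<open>lin''\<close>. The test matrix has the rows (2,1,1,2), (1,2,1,2),
  (1,1,2,2), (1,1,1,2).\<close>

lemma base_nonzero: "wdet base_quadric (\<lambda>i. axis i 1) \<noteq> 0"
proof -
  have ne: "(1::4) \<noteq> 2" "(1::4) \<noteq> 3" "(1::4) \<noteq> 4" "(2::4) \<noteq> 3" "(2::4) \<noteq> 4" "(3::4) \<noteq> 4" by auto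
  note simps = matrix_vector_mult_def vec_eq_iff sum_4 forall_4 base_quadric_def axis_def ne ne[symmetric]
    doubleton_eq_iff test_entry_def
  have 1: "det (\<chi> i s. (axis i 1 :: complex^4) $ s) \<noteq> 0"
    unfolding det_nonzero_ker by (auto simp: simps)
  have lin: "a = 0 \<and> b = 0" if "a + 2 * b = 0" "2 * a + b = 0" for a b :: complex
  proof -
    have "3 * a = 2 * (2 * a + b) - (a + 2 * b)" by algebra
    then show ?thesis using that by simp
  qed
  have lin': "a = 0 \<and> b = 0" if "2 * a + 2 * b = 0" "2 * a + b = 0" for a b :: complex
  proof -
    have "b = (2 * a + 2 * b) - (2 * a + b)" by algebra
    then show ?thesis using that by simp
  qed
  have lin'': "a = 0 \<and> b = 0" if "a + 2 * b = 0" "2 * a + 2 * b = 0" for a b :: complex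
    using lin'[of b a] that by (simp add: add.commute)
  have 2: "det base_quadric \<noteq> 0"
    unfolding det_nonzero_ker by (auto simp: simps dest: lin)
  have 3: "det (base_quadric + sq (axis i 1)) \<noteq> 0" for i
    unfolding det_nonzero_ker using exhaust_4[of i] by (elim disjE) (auto simp: simps dest: lin lin' lin'')
  have lin4: "a = 0 \<and> b = 0 \<and> c = 0 \<and> d = 0" if e: "2 * a + b + c + 2 * d = 0" "a + 2 * b + c + 2 * d = 0"
    "a + b + 2 * c + 2 * d = 0" "a + b + c + 2 * d = 0" for a b c d :: complex
  proof -
    have "a = (2 * a + b + c + 2 * d) - (a + b + c + 2 * d)" "b = (a + 2 * b + c + 2 * d) - (a + b + c + 2 * d)"
      "c = (a + b + 2 * c + 2 * d) - (a + b + c + 2 * d)" by algebra+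
    then have "a = 0" "b = 0" "c = 0" unfolding e by simp_all
    then show ?thesis using e(4) by simp
  qed
  have 4: "det (\<chi> i a. (base_quadric + sq (axis i 1)) $ fst (test_entry a) $ snd (test_entry a)) \<noteq> 0"
    unfolding det_nonzero_ker by (auto simp: simps dest: lin4)
  show ?thesis unfolding wdet_def using 1 2 3 4 by simp
qed

lemma base_Sym4: "base_quadric \<in> Sym4"
  by (auto simp: Sym4_iff base_quadric_def insert_commute)

section \<open>Irreducibility of the variety of quintuples\<close>

definition pr :: "4 \<Rightarrow> 4 \<Rightarrow> 4 \<times> 4" where
  "pr u v = (if (u, v) \<in> Pairs then (u, v) else (v, u))"

lemma pr_in: "pr u v \<in> Pairs"
  using Pairs_cover[of u v] by (auto simp: pr_def)

lemma pr_commute: "pr u v = pr v u"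
  using exhaust_4[of u] exhaust_4[of v] by (elim disjE) (simp_all add: pr_def Pairs_def)

lemma pr_eq: "(u, v) \<in> Pairs \<Longrightarrow> pr u v = (u, v)"
  by (simp add: pr_def)

text \<open>\<open>irreducible_image\<close> covers only the quintuples with nonzero
  \<open>wdet\<close>. The others lie in the closure: on the line from their parameters to those of
  the base point, \<open>wdet\<close> has finitely many zeros.\<close>

lemma irreducible_B25: "irreducible_space (subtopology zariski B25)"
proof -
  define G where "G = (\<lambda>y :: (4 \<times> 4) + (4 \<times> 4) \<Rightarrow> complex. (\<chi> u v. y (Inl (pr u v))) :: mat4)"
  define h where "h = (\<lambda>(y :: (4 \<times> 4) + (4 \<times> 4) \<Rightarrow> complex) i. (\<chi> s. y (Inr (i, s))) :: complex^4)"
  define w where "w = (\<lambda>y. wdet (G y) (h y))"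
  have GS: "G y \<in> Sym4" for y by (auto simp: G_def Sym4_iff pr_commute)
  have Gp: "(\<lambda>y. G y $ u $ v) \<in> poly_funs (coordfuns UNIV)" for u v
    by (auto simp: G_def coordfuns_def intro: poly_funs.coord)
  have hp: "(\<lambda>y. h y i $ s) \<in> poly_funs (coordfuns UNIV)" for i s
    by (auto simp: h_def coordfuns_def intro: poly_funs.coord)
  have wp: "w \<in> poly_funs (coordfuns UNIV)" unfolding w_def by (rule wdet_poly[OF Gp hp])
  have php: "(\<lambda>y. quint (G y) (h y) i $ r $ s) \<in> poly_funs (coordfuns UNIV)" for i r s
    by (cases i) (auto simp: quad_def intro!: poly_funs_intros Gp hp)
  have surj: "\<exists>y. G y = G' \<and> h y = h'" if "G' \<in> Sym4" for G' h'
  proof -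
    define y where "y = (\<lambda>k :: (4 \<times> 4) + (4 \<times> 4). case k of Inl (u, v) \<Rightarrow> G' $ u $ v | Inr (i, s) \<Rightarrow> h' i $ s)"
    have "G y = G'" using that by (auto simp: G_def y_def pr_def vec_eq_iff Sym4_iff)
    moreover have "h y = h'" by (auto simp: h_def y_def vec_eq_iff)
    ultimately show ?thesis by blast
  qed
  let ?Z = "(\<lambda>y i. mat.span {quint (G y) (h y) i}) ` {y \<in> UNIV. w y \<noteq> 0}"
  obtain y0 where y0: "G y0 = base_quadric" "h y0 = (\<lambda>i. axis i 1)" using surj[OF base_Sym4] by blast
  then have w0: "w y0 \<noteq> 0" using base_nonzero by (simp add: w_def)
  have irr: "irreducible_space (subtopology zariski ?Z)"
    by (rule irreducible_image[OF php wp]) (use generic_points(2) GS w0 in \<open>auto simp: w_def\<close>)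
  have ZB: "?Z \<subseteq> B25" using generic_points(4) GS by (auto simp: w_def)
  have Zp: "?Z \<subseteq> points" using ZB B25_points by blast
  have "B25 \<subseteq> zariski closure_of ?Z"
  proof
    fix x assume x: "x \<in> B25"
    then have xp: "x \<in> points" using B25_points by blast
    obtain G' h' where G': "G' \<in> x None - {0}" "\<And>i. G' + sq (h' i) \<in> x (Some i) - {0}" "G' \<in> Sym4"
      using B25E[OF x] by blast
    obtain y1 where y1: "G y1 = G'" "h y1 = h'" using surj[OF G'(3)] by blast
    have y1x: "quint (G y1) (h y1) i \<in> x i - {0}" for i using G' y1 by (cases i) (auto simp: quad_def)
    show "x \<in> zariski closure_of ?Z"
      unfolding zariski_closure_iff[OF Zp]
    proof (intro conjI ballI impI xp, rule ccontr)
      fix f assume f: "f \<in> multihom_polys" "\<forall>s\<in>?Z. f (rep s) = 0" "f (rep x) \<noteq> 0"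
      obtain d where d: "mhom d f" using f(1) multihom_polys_iff by blast
      have f1: "f (quint (G y1) (h y1)) \<noteq> 0" using mhom_rep_zero[OF d xp y1x] f(3) by blast
      have fp: "(\<lambda>y. f (quint (G y) (h y))) \<in> poly_funs (coordfuns UNIV)"
        by (rule poly_funs_subst[of f entries]) (use f(1) php in \<open>auto simp: multihom_polys_def entries_def\<close>)
      define y where "y = (\<lambda>t k. y1 k + t * (y0 k - y1 k))"
      obtain pf where pf: "\<And>t. f (quint (G (y t)) (h (y t))) = poly pf t"
        using poly_funs_line[OF fp, of y1 y0] unfolding y_def by blast
      obtain pw where pw: "\<And>t. w (y t) = poly pw t"
        using poly_funs_line[OF wp, of y1 y0] unfolding y_def by blast
      have "y 0 = y1" "y 1 = y0" by (auto simp: y_def)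
      then have "pf \<noteq> 0" "pw \<noteq> 0" using pf[of 0] pw[of 1] f1 w0 by auto
      then have "finite {t. poly (pf * pw) t = 0}" by (intro poly_roots_finite) auto
      then have "\<exists>t. t \<notin> {t. poly (pf * pw) t = 0}" by (rule ex_new_if_finite[OF infinite_UNIV_char_0])
      then obtain t where t: "poly pf t \<noteq> 0" "poly pw t \<noteq> 0" by auto
      have wt: "w (y t) \<noteq> 0" using t pw by simp
      define z where "z = (\<lambda>i. mat.span {quint (G (y t)) (h (y t)) i})"
      have "z \<in> ?Z" unfolding z_def using wt by blast
      then have "f (rep z) = 0" "z \<in> points" using f(2) Zp by blast+
      moreover have "quint (G (y t)) (h (y t)) i \<in> z i - {0}" for i
        using generic_points(2)[OF _ GS, of "y t" "h (y t)" i] wt by (auto simp: z_def w_def mat.span_base)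
      ultimately show False using mhom_rep_zero[OF d, of z] t pf by metis
    qed
  qed
  then have "B25 \<inter> zariski closure_of ?Z = B25" by blast
  then show ?thesis using irreducible_closure[OF ZB B25_points irr] by simp
qed

text \<open>Local coordinates \<open>y\<close> near the base point, chosen such that suitable entries of the four
  quadrics, made homogeneous by dividing by one diagonal entry of each, have the \<open>y\<close> as linear parts.\<close>

type_synonym idx = "(4 \<times> 4) + (4 \<times> 4)"

definition idxs :: "idx set" where
  "idxs = Inl ` (Pairs - {(1, 1)}) \<union> range Inr"

text \<open>The (1,1) entry of the basket is kept fixed, which uses up the common scaling
  factor.\<close>

definition yG :: "(idx \<Rightarrow> complex) \<Rightarrow> 4 \<Rightarrow> 4 \<Rightarrow> complex" where
  "yG y u v = (if u = 1 \<and> v = 1 then 0 else y (Inl (pr u v)))"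

text \<open>Solves the equations of \<open>site_linear_part\<close> for the variation of
  \<open>h i\<close>. The divisor 2 is the derivative of a square; the correction at (1,1)
  compensates for normalising the first quadric by its (2,2) entry, its (1,1) entry having the value
  2 at the base point.\<close>

definition eta :: "(idx \<Rightarrow> complex) \<Rightarrow> 4 \<Rightarrow> 4 \<Rightarrow> complex" where
  "eta y i s = (y (Inr (i, s)) - yG y i s + (if i = 1 \<and> s = 1 then 2 * yG y 2 2 else 0)) / (if s = i then 2 else 1)"

definition locG :: "(idx \<Rightarrow> complex) \<Rightarrow> mat4" where
  "locG y = (\<chi> u v. base_quadric $ u $ v + yG y u v)"

definition loch :: "(idx \<Rightarrow> complex) \<Rightarrow> 4 \<Rightarrow> complex^4" where
  "loch y i = (\<chi> s. (if s = i then 1 else 0) + eta y i s)"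

text \<open>The diagonal entry that normalises quadric \<open>i\<close>. It avoids the index
  \<open>i\<close>, so that the square of \<open>h i\<close> affects it only to second order; where
  possible it is (1,1), where the basket is constant.\<close>

definition nrm :: "4 \<Rightarrow> 4" where
  "nrm i = (if i = 1 then 2 else 1)"

text \<open>The basket entry at \<open>p\<close> is read off from a quadric whose index avoids both
  coordinates of \<open>p\<close>, so that its linear form contributes only to second order, and
  avoids 1, so that its normalising entry is (1,1).\<close>

definition off :: "4 \<times> 4 \<Rightarrow> 4" where
  "off p = (SOME i. i \<noteq> 1 \<and> i \<noteq> fst p \<and> i \<noteq> snd p)"

lemma off: "off p \<noteq> 1" "off p \<noteq> fst p" "off p \<noteq> snd p"
proof -
  have "card {1, fst p, snd p} \<le> 3" by (simp add: card_insert_if)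
  then have "{1, fst p, snd p} \<noteq> UNIV" by (intro notI) (simp add: card4)
  then have "\<exists>i::4. i \<noteq> 1 \<and> i \<noteq> fst p \<and> i \<noteq> snd p" by blast
  then have "off p \<noteq> 1 \<and> off p \<noteq> fst p \<and> off p \<noteq> snd p" unfolding off_def by (rule someI_ex)
  then show "off p \<noteq> 1" "off p \<noteq> fst p" "off p \<noteq> snd p" by auto
qed

text \<open>A triple \<open>(i, u, v)\<close> stands for the entry (u, v) of the i-th
  quadric.\<close>

fun site :: "idx \<Rightarrow> 4 \<times> 4 \<times> 4" where
  "site (Inl p) = (off p, fst p, snd p)"
| "site (Inr (i, s)) = (i, i, s)"

definition siteval :: "idx \<Rightarrow> complex" where
  "siteval k = (case site k of (i, u, v) \<Rightarrow> base_quadric $ u $ v + (if u = i then 1 else 0) * (if v = i then 1 else 0))"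

text \<open>An entry divided by the normalising entry, minus its value at the base point, made
  homogeneous; the remaining factors give every coordinate the multidegree of \<open>locg\<close>.
  The map \<open>e\<close> places the four quadrics inside a quadruple or a quintuple.\<close>

definition locF :: "(4 \<Rightarrow> 'i) \<Rightarrow> idx \<Rightarrow> ('i \<Rightarrow> mat4) \<Rightarrow> complex" where
  "locF e k A = (case site k of (i, u, v) \<Rightarrow>
     (A (e i) $ u $ v - siteval k * A (e i) $ nrm i $ nrm i) * (\<Prod>j\<in>UNIV - {i}. A (e j) $ nrm j $ nrm j))"

definition locg :: "(4 \<Rightarrow> 'i) \<Rightarrow> ('i \<Rightarrow> mat4) \<Rightarrow> complex" where
  "locg e A = (\<Prod>j\<in>UNIV. A (e j) $ nrm j $ nrm j)"

lemma mhom_locg: "mhom (\<lambda>k. \<Sum>j\<in>UNIV. single (e j) k) (locg e)"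
  unfolding locg_def by (intro mhom_prod mhom_single)

lemma mhom_locF: "mhom (\<lambda>k. \<Sum>j\<in>UNIV. single (e j) k) (locF e k)"
proof -
  obtain i u v where iuv: "site k = (i, u, v)" by (cases "site k")
  have "mhom (\<lambda>k. single (e i) k + (\<Sum>j\<in>UNIV - {i}. single (e j) k))
    (\<lambda>A. (A (e i) $ u $ v - siteval k * A (e i) $ nrm i $ nrm i) * (\<Prod>j\<in>UNIV - {i}. A (e j) $ nrm j $ nrm j))"
    by (intro mhom_mult mhom_prod mhom_diff mhom_cmult mhom_single)
  moreover have "single (e i) k + (\<Sum>j\<in>UNIV - {i}. single (e j) k) = (\<Sum>j\<in>UNIV. single (e j) k)" for k
    using sum.remove[of UNIV i "\<lambda>j. single (e j) k"] by simp
  ultimately show ?thesis by (simp add: locF_def[abs_def] iuv)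
qed

lemma yG_scale: "yG (\<lambda>k. t * y k) u v = t * yG y u v"
  by (simp add: yG_def)

lemma eta_scale: "eta (\<lambda>k. t * y k) i s = t * eta y i s"
  by (simp add: eta_def yG_scale algebra_simps)

lemma loc_entry: "quad (locG (\<lambda>k. t * y k)) (loch (\<lambda>k. t * y k)) i $ u $ v =
    base_quadric $ u $ v + t * yG y u v + ((if u = i then 1 else 0) + t * eta y i u) * ((if v = i then 1 else 0) + t * eta y i v)"
  by (simp add: quad_def locG_def loch_def yG_scale eta_scale)

lemma loc_deriv: "((\<lambda>t. quad (locG (\<lambda>k. t * y k)) (loch (\<lambda>k. t * y k)) i $ u $ v) has_field_derivative
    (yG y u v + eta y i u * (if v = i then 1 else 0) + (if u = i then 1 else 0) * eta y i v)) (at 0)"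
  unfolding loc_entry by (auto intro!: derivative_eq_intros)

lemma nrm_neq: "nrm i \<noteq> i"
  by (simp add: nrm_def)

lemma base_nrm: "base_quadric $ nrm i $ nrm i = 1"
  by (simp add: base_quadric_def)

lemma loc_nrm_tendsto: "((\<lambda>t. quad (locG (\<lambda>k. t * y k)) (loch (\<lambda>k. t * y k)) j $ nrm j $ nrm j) \<longlongrightarrow> 1) (at 0)"
proof -
  have "isCont (\<lambda>t. quad (locG (\<lambda>k. t * y k)) (loch (\<lambda>k. t * y k)) j $ nrm j $ nrm j) 0"
    using loc_deriv by (rule DERIV_isCont)
  then show ?thesis using nrm_neq[of j] unfolding isCont_def loc_entry by (simp add: base_nrm)
qed

lemma deriv_mult_tendsto:
  fixes f :: "complex \<Rightarrow> complex"
  assumes "(f has_field_derivative D) (at 0)" "f 0 = 0" "(N \<longlongrightarrow> 1) (at 0)"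
  shows "((\<lambda>t. f t * N t) has_field_derivative D) (at 0)"
proof -
  have "((\<lambda>t. f t / t * N t) \<longlongrightarrow> D * 1) (at 0)"
    using assms by (intro tendsto_mult) (auto simp: has_field_derivative_iff)
  then show ?thesis using assms(2) by (simp add: has_field_derivative_iff)
qed

lemma site_linear_part:
  assumes "k \<in> idxs" "site k = (i, u, v)"
  shows "(yG y u v + eta y i u * (if v = i then 1 else 0) + (if u = i then 1 else 0) * eta y i v) -
    siteval k * yG y (nrm i) (nrm i) = y k"
proof -
  have nn: "(2::4) \<noteq> 1" by simp
  from assms(1) consider p where "k = Inl p" "p \<in> Pairs" "p \<noteq> (1, 1)" | a s where "k = Inr (a, s)"
    by (auto simp: idxs_def)
  then show ?thesis
  proof cases
    case (1 p)
    then have p: "i = off p" "u = fst p" "v = snd p" using assms(2) by auto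
    have "nrm i = 1" using off(1)[of p] p by (simp add: nrm_def)
    moreover have "u \<noteq> i" "v \<noteq> i" using off[of p] p by auto
    moreover have "yG y u v = y k" using 1 p by (cases p) (auto simp: yG_def pr_eq)
    ultimately show ?thesis by (simp add: yG_def)
  next
    case (2 a s)
    then have e: "i = a" "u = a" "v = s" using assms(2) by auto
    have sv: "siteval k = base_quadric $ a $ s + (if s = a then 1 else 0)" by (simp add: 2 siteval_def)
    show ?thesis
    proof (cases "a = 1")
      case True
      have b: "base_quadric $ 1 $ s = (if s = 1 then 1 else 0)"
        using exhaust_4[of s] by (auto simp: base_quadric_def doubleton_eq_iff)
      show ?thesis unfolding e sv True using 2 True b nn
        by (auto simp: eta_def nrm_def yG_def field_simps)
    next
      case False
      then have "yG y (nrm i) (nrm i) = 0" by (simp add: e nrm_def yG_def)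
      then show ?thesis unfolding e using 2 False by (auto simp: eta_def field_simps)
    qed
  qed
qed

lemma locF_deriv:
  assumes "k \<in> idxs" "\<And>t i. \<phi> t (e i) = quad (locG (\<lambda>k. t * y k)) (loch (\<lambda>k. t * y k)) i"
  shows "((\<lambda>t. locF e k (\<phi> t)) has_field_derivative y k) (at 0)" "locF e k (\<phi> 0) = 0" "locg e (\<phi> 0) = 1"
proof -
  obtain i u v where iuv: "site k = (i, u, v)" by (cases "site k")
  let ?q = "\<lambda>t i. quad (locG (\<lambda>k. t * y k)) (loch (\<lambda>k. t * y k)) i"
  let ?f = "\<lambda>t. ?q t i $ u $ v - siteval k * ?q t i $ nrm i $ nrm i"
  have q0: "?q 0 j $ nrm j $ nrm j = 1" for j unfolding loc_entry using nrm_neq[of j] by (simp add: base_nrm)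
  have f0: "?f 0 = 0"
    unfolding q0 unfolding loc_entry by (simp add: siteval_def iuv)
  have "(?f has_field_derivative ((yG y u v + eta y i u * (if v = i then 1 else 0) + (if u = i then 1 else 0) * eta y i v) -
    siteval k * (yG y (nrm i) (nrm i) + eta y i (nrm i) * (if nrm i = i then 1 else 0) + (if nrm i = i then 1 else 0) * eta y i (nrm i)))) (at 0)"
    by (intro DERIV_diff DERIV_cmult loc_deriv)
  then have fd: "(?f has_field_derivative y k) (at 0)"
    using site_linear_part[OF assms(1) iuv, of y] nrm_neq[of i] by simp
  have "((\<lambda>t. \<Prod>j\<in>UNIV - {i}. ?q t j $ nrm j $ nrm j) \<longlongrightarrow> (\<Prod>j\<in>UNIV - {i}. 1)) (at 0)"
    by (intro tendsto_prod loc_nrm_tendsto)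
  then have N: "((\<lambda>t. \<Prod>j\<in>UNIV - {i}. ?q t j $ nrm j $ nrm j) \<longlongrightarrow> 1) (at 0)" by simp
  have F: "locF e k (\<phi> t) = ?f t * (\<Prod>j\<in>UNIV - {i}. ?q t j $ nrm j $ nrm j)" for t
    by (simp add: locF_def iuv assms(2))
  show "((\<lambda>t. locF e k (\<phi> t)) has_field_derivative y k) (at 0)"
    unfolding F by (rule deriv_mult_tendsto[OF fd f0 N])
  show "locF e k (\<phi> 0) = 0" unfolding F f0 by simp
  show "locg e (\<phi> 0) = 1" unfolding locg_def assms(2) q0 by simp
qed

lemma card_idxs: "finite idxs" "card idxs = 25"
proof -
  show fin: "finite idxs" using Pairs_finite by (simp add: idxs_def)
  have "card idxs = card (Inl ` (Pairs - {(1, 1)}) :: idx set) + card (range Inr :: idx set)"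
    unfolding idxs_def using Pairs_finite by (intro card_Un_disjoint) auto
  also have "\<dots> = 9 + 16"
    by (simp add: card_image card_Pairs Pairs_def)
  finally show "card idxs = 25" by simp
qed

lemma loc_poly:
  "(\<lambda>y. locG y $ u $ v) \<in> poly_funs (coordfuns idxs)" "(\<lambda>y. loch y i $ s) \<in> poly_funs (coordfuns idxs)"
proof -
  have yp: "(\<lambda>y. yG y u v) \<in> poly_funs (coordfuns idxs)" for u v
  proof (cases "u = 1 \<and> v = 1")
    case True
    then show ?thesis by (simp add: yG_def poly_funs.const)
  next
    case False
    then have "pr u v \<noteq> (1, 1)" by (auto simp: pr_def split: if_splits)
    then have "Inl (pr u v) \<in> idxs" using pr_in by (auto simp: idxs_def)
    then show ?thesis using False by (auto simp: yG_def coordfuns_def intro: poly_funs.coord)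
  qed
  have "(\<lambda>y. y (Inr (i, s))) \<in> poly_funs (coordfuns idxs)" for i s
    by (rule poly_funs.coord) (auto simp: coordfuns_def idxs_def)
  then have ep: "(\<lambda>y. eta y i s) \<in> poly_funs (coordfuns idxs)" for i s
    unfolding eta_def by (cases "i = 1 \<and> s = 1") (auto intro!: poly_funs_intros yp)
  show "(\<lambda>y. locG y $ u $ v) \<in> poly_funs (coordfuns idxs)"
    unfolding locG_def by (simp, intro poly_funs_intros yp)
  show "(\<lambda>y. loch y i $ s) \<in> poly_funs (coordfuns idxs)"
  proof -
    have "(\<lambda>y. (if s = i then 1 else 0) + eta y i s) \<in> poly_funs (coordfuns idxs)"
      by (intro poly_funs_intros ep)
    then show ?thesis by (simp add: loch_def)
  qed
qed

lemma loc_Sym4: "locG y \<in> Sym4"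
  using base_Sym4 by (auto simp: Sym4_iff locG_def yG_def pr_commute)

lemma loc_base: "locG (\<lambda>_. 0) = base_quadric" "loch (\<lambda>_. 0) = (\<lambda>i. axis i 1)"
  by (auto simp: locG_def loch_def yG_def eta_def vec_eq_iff axis_def)

text \<open>The forms \<open>locF\<close> involve the four quadrics alone, so the same 25
  coordinates serve for quintuples and for quadruples.\<close>

lemma krull_dim_local:
  fixes e :: "4 \<Rightarrow> 'i::finite" and \<phi> :: "(idx \<Rightarrow> complex) \<Rightarrow> 'i \<Rightarrow> mat4"
  assumes "T \<subseteq> points" "\<And>i r s. (\<lambda>y. \<phi> y i $ r $ s) \<in> poly_funs (coordfuns idxs)"
    and "\<And>y i. wdet (locG y) (loch y) \<noteq> 0 \<Longrightarrow> \<phi> y i \<in> Sym4 - {0}"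
    and "\<And>y. wdet (locG y) (loch y) \<noteq> 0 \<Longrightarrow> (\<lambda>i. mat.span {\<phi> y i}) \<in> T"
    and e: "\<And>y i. \<phi> y (e i) = quad (locG y) (loch y) i"
  shows "25 \<le> krull_dim (subtopology zariski T)"
proof -
  have "ereal (real (card idxs)) \<le> krull_dim (subtopology zariski T)"
  proof (rule krull_dim_ge[where \<phi> = \<phi> and w = "\<lambda>y. wdet (locG y) (loch y)" and F = "locF e" and g = "locg e"
      and d = "\<lambda>k. \<Sum>j\<in>UNIV. single (e j) k"])
    show "(\<lambda>y. wdet (locG y) (loch y)) \<in> poly_funs (coordfuns idxs)" by (intro wdet_poly loc_poly)
    show "wdet (locG (\<lambda>_. 0)) (loch (\<lambda>_. 0)) \<noteq> 0" unfolding loc_base by (rule base_nonzero)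
    show "mhom (\<lambda>k. \<Sum>j\<in>UNIV. single (e j) k) (locF e k)" for k by (rule mhom_locF)
    show "mhom (\<lambda>k. \<Sum>j\<in>UNIV. single (e j) k) (locg e)" by (rule mhom_locg)
    have ph: "\<phi> (\<lambda>k. t * y k) (e i) = quad (locG (\<lambda>k. t * y k)) (loch (\<lambda>k. t * y k)) i" for t y i by (rule e)
    show "((\<lambda>t. locF e k (\<phi> (\<lambda>j. t * y j))) has_field_derivative y k) (at 0)" if "k \<in> idxs" for k y
      by (rule locF_deriv(1)[of k "\<lambda>t. \<phi> (\<lambda>j. t * y j)" e y, OF that ph])
    show "locF e k (\<phi> (\<lambda>_. 0)) = 0" if "k \<in> idxs" for k
      using locF_deriv(2)[OF that, of "\<lambda>t. \<phi> (\<lambda>k. t * 0)" e "\<lambda>_. 0"] ph[of _ "\<lambda>_. 0"] by simp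
    have "Inr (1, 1) \<in> idxs" by (auto simp: idxs_def)
    then show "locg e (\<phi> (\<lambda>_. 0)) \<noteq> 0"
      using locF_deriv(3)[of _ "\<lambda>t. \<phi> (\<lambda>k. t * 0)" e "\<lambda>_. 0"] ph[of _ "\<lambda>_. 0"] by simp
  qed (use assms card_idxs in auto)
  then show ?thesis by (simp add: card_idxs)
qed

lemma krull_dim_quadruples: "25 \<le> krull_dim (subtopology zariski quadruples_with_P)"
proof (rule krull_dim_local[where e = "\<lambda>i. i" and \<phi> = "\<lambda>y. quad (locG y) (loch y)"])
  show "(\<lambda>y. quad (locG y) (loch y) i $ r $ s) \<in> poly_funs (coordfuns idxs)" for i r s
    by (auto simp: quad_def intro!: poly_funs_intros loc_poly)
qed (use quadruples_points generic_points(1,3) loc_Sym4 in auto)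

lemma krull_dim_B25: "krull_dim (subtopology zariski B25) = 25"
proof (rule antisym)
  have "25 = ereal (real 25)" by simp
  then show "krull_dim (subtopology zariski B25) \<le> 25"
    using krull_dim_le[OF B25_points hgrow_B25, of B25] closure_of_subset[of B25 zariski] B25_points by simp
  show "25 \<le> krull_dim (subtopology zariski B25)"
  proof (rule krull_dim_local[where e = Some and \<phi> = "\<lambda>y. quint (locG y) (loch y)"])
    show "(\<lambda>y. quint (locG y) (loch y) i $ r $ s) \<in> poly_funs (coordfuns idxs)" for i r s
      by (cases i) (auto simp: quad_def intro!: poly_funs_intros loc_poly)
  qed (use B25_points generic_points(2,4) loc_Sym4 in auto)
qed

section \<open>Removing the closures of the bad loci\<close>

lemma krull_dim_closure_le:
  assumes "B \<subseteq> points" "hgrow B 24" "T \<subseteq> zariski closure_of B"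
  shows "krull_dim (subtopology zariski T) < 25"
  using krull_dim_le[OF assms] by (rule order.strict_trans1) simp

lemma dense_open_B25: "holds_on_dense_open B25 (\<lambda>x. property_P (x \<circ> Some))"
proof -
  define B where "B = {x \<in> B25. \<not> property_P (x \<circ> Some)}"
  define U where "U = B25 - zariski closure_of B"
  let ?T = "subtopology zariski B25"
  have Bp: "B \<subseteq> points" using B25_points by (auto simp: B_def)
  have top: "topspace ?T = B25" using B25_points by auto
  have closed: "closedin ?T (B25 \<inter> zariski closure_of B)"
    unfolding closedin_subtopology by (intro exI[of _ "zariski closure_of B"]) auto
  have "U = topspace ?T - (B25 \<inter> zariski closure_of B)" unfolding top U_def by blast
  then have openU: "openin ?T U" using closed by (simp only: closedin_def)
  \<comment> \<open>The closure of the bad locus has dimension at most 24, so it is a proper closed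
    subset; in an irreducible space its complement is dense.\<close>
  have "B25 \<inter> zariski closure_of B \<noteq> B25"
  proof
    assume "B25 \<inter> zariski closure_of B = B25"
    then have "krull_dim ?T < 25" using krull_dim_closure_le[OF Bp] hgrow_bad_B25 by (auto simp: B_def)
    then show False using krull_dim_B25 by simp
  qed
  moreover have "(?T closure_of U) \<union> (B25 \<inter> zariski closure_of B) = topspace ?T"
  proof
    show "(?T closure_of U) \<union> (B25 \<inter> zariski closure_of B) \<subseteq> topspace ?T"
      using closure_of_subset_topspace[of ?T U] top by auto
    show "topspace ?T \<subseteq> (?T closure_of U) \<union> (B25 \<inter> zariski closure_of B)"
      using closure_of_subset[of U ?T] top by (auto simp: U_def)
  qed
  ultimately have "?T closure_of U = topspace ?T"
    using irreducible_B25 closed closedin_closure_of[of ?T U] unfolding irreducible_space_def top by metis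
  moreover have "property_P (x \<circ> Some)" if "x \<in> U" for x
    using that closure_of_subset[of B zariski] Bp by (auto simp: U_def B_def)
  ultimately show ?thesis unfolding holds_on_dense_open_def using openU top by auto
qed

lemma off_smaller_quadruples: "holds_off_smaller_dim quadruples_with_P admits_common_basket"
proof -
  define B where "B = {q \<in> quadruples_with_P. \<not> admits_common_basket q}"
  define U where "U = quadruples_with_P - zariski closure_of B"
  let ?T = "subtopology zariski quadruples_with_P"
  have Bp: "B \<subseteq> points" using quadruples_points by (auto simp: B_def)
  have top: "topspace ?T = quadruples_with_P" using quadruples_points by auto
  have closed: "closedin ?T (quadruples_with_P \<inter> zariski closure_of B)"
    unfolding closedin_subtopology by (intro exI[of _ "zariski closure_of B"]) auto
  have "U = topspace ?T - (quadruples_with_P \<inter> zariski closure_of B)" unfolding top U_def by blast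
  then have openU: "openin ?T U" using closed by (simp only: closedin_def)
  \<comment> \<open>For a possibly reducible space only this remains: dimension at most 24 of the
    removed part against at least 25 of the whole.\<close>
  have "krull_dim (subtopology zariski (quadruples_with_P - U)) < 25"
    by (rule krull_dim_closure_le[OF Bp]) (use hgrow_bad_quadruples in \<open>auto simp: B_def U_def\<close>)
  then have "krull_dim (subtopology zariski (quadruples_with_P - U)) < krull_dim ?T"
    using krull_dim_quadruples by (rule order.strict_trans2)
  moreover have "admits_common_basket x" if "x \<in> U" for x
    using that closure_of_subset[of B zariski] Bp by (auto simp: U_def B_def)
  ultimately show ?thesis unfolding holds_off_smaller_dim_def using openU by blast
qed

theorem proposition0p4:
  shows "quasi_projective B25 \<and>
    irreducible_space (subtopology zariski B25) \<and>
    krull_dim (subtopology zariski B25) = 25 \<and>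
    holds_on_dense_open B25 (\<lambda>x. property_P (x \<circ> Some)) \<and>
    holds_off_smaller_dim quadruples_with_P admits_common_basket"
  using quasi_projective_B25 irreducible_B25 krull_dim_B25 dense_open_B25 off_smaller_quadruples by blast

end
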